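(* Every graph of maximum degree at most three has slope parameter at most seven.
   Context: For a set $P$ of points in the plane and a set $\Sigma$ of slopes, $G(P,\Sigma)$ denotes the graph with vertex set $P$ in which $p,q\in P$ are adjacent if and only if the slope of the line $pq$ belongs to $\Sigma$. The slope parameter $s(G)$ of a graph $G$ is the size of the smallest set $\Sigma$ of slopes such that $G$ is isomorphic to $G(P,\Sigma)$ for some finite point set $P$. *)

theory Defs
  imports
    Complex_Main
    "HOL-Library.Extended_Nat"
    "Graph_Theory.Pair_Digraph"
    "Graph_Theory.Digraph_Isomorphism"
begin

text \<open>
  Finite simple graphs are the loopless symmetric finite digraphs \<open>pair_graph\<close>: an edge
  \<open>uv\<close> is the pair of arcs \<open>(u, v)\<close> and \<open>(v, u)\<close>, so the degree of a vertex is its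
  \<open>out_degree\<close>.
\<close>

datatype slope = Finite_slope real | Vertical

text \<open>The slope of the line through \<open>p\<close> and \<open>q\<close>; meaningful only for \<open>p \<noteq> q\<close>.\<close>

definition line_slope :: "real \<times> real \<Rightarrow> real \<times> real \<Rightarrow> slope" where
  "line_slope p q =
     (if fst p = fst q then Vertical
      else Finite_slope ((snd q - snd p) / (fst q - fst p)))"

definition slope_graph :: "(real \<times> real) set \<Rightarrow> slope set \<Rightarrow> (real \<times> real) pair_pre_digraph" where
  "slope_graph P S =
     \<lparr> pverts = P,
       parcs = {(p, q). p \<in> P \<and> q \<in> P \<and> p \<noteq> q \<and> line_slope p q \<in> S} \<rparr>"

text \<open>
  The infimum is taken in \<open>enat\<close>, so that it is a minimum whenever a finite slope set exists,
  and is \<open>\<infinity>\<close> (rather than \<open>0\<close>) if there is none.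
\<close>

definition slope_parameter :: "'a pair_pre_digraph \<Rightarrow> enat" where
  "slope_parameter G =
     Inf {enat (card S) |S P. finite S \<and> finite P \<and>
            digraph_iso (with_proj G) (with_proj (slope_graph P S))}"

end

theory Submission
  imports Defs "HOL-Computational_Algebra.Polynomial"
begin

text \<open>
  Color the edges with seven colors and let color \<open>i\<close> have slope \<open>\<sigma> i\<close>. The positions of the vertices that
  respect all slopes form a linear space, and a generic element of it realizes the graph unless some pair
  of vertices is forced onto a line of a forbidden slope. By duality such an obstruction is an equilibrium
  stress: an antisymmetric weight \<open>w\<close> on the edges such that \<open>w\<close> and \<open>\<sigma> w\<close> are both flows, up to one pair of
  opposite forces. Absence of stresses is a polynomial condition on \<open>\<sigma>\<close>, so it holds for generic slopes as
  soon as it holds for one, possibly degenerate, choice.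

  Stress-freeness survives gluing along at most three edges: contract one side to a single vertex. This reduces
  to graphs with at most six vertices, for which explicit drawings are given, and to graphs in which a small
  edge cut isolates hardly anything. In the latter, three colors are used only on the edges at one
  vertex \<open>x\<^sub>0\<close>, and four colors suffice for the rest. At a vertex of degree three with distinct slopes one
  vanishing weight kills the other two, and giving two colors at a vertex \<open>z\<close> of the claw the same slope kills the third
  edge at \<open>z\<close>. This zero spreads along a cycle through \<open>z\<close> that avoids the loaded vertices. Components
  \<open>K\<^sub>4\<close> have to be excluded; they are drawn on a line instead.
\<close>

section \<open>Generic slopes\<close>

text \<open>Stress-freeness says that the edges are independent conditions on the positions. For K4
  this is fatal: six independent conditions on eight coordinates leave only the translations, so all
  points coincide and nothing is separated. Hence K4 is not good under any coloring. This also
  shapes the induction: contracting one side of a three-edge cut may turn a triangle on the other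
  side into a K4, so such cuts need an argument of their own.

  A cut may have at most three edges because the contracted vertex has to stay subcubic. Colorings
  are kept proper because a force through a cut edge enters the other side at the end of that edge,
  where no further edge may have the same slope.

  The number seven is four plus three. Deleting the centre of the claw from a connected graph leaves
  a vertex of degree at most two in every component. Such vertices can be peeled off one after the
  other, and each edge at a peeled vertex sees at most two colors at its far end and one at its near
  end.\<close>

inductive poly_fun :: "((nat \<Rightarrow> real) \<Rightarrow> real) \<Rightarrow> bool" where
  const: "poly_fun (\<lambda>\<sigma>. a)"
| var: "poly_fun (\<lambda>\<sigma>. \<sigma> i)"
| add: "poly_fun f \<Longrightarrow> poly_fun g \<Longrightarrow> poly_fun (\<lambda>\<sigma>. f \<sigma> + g \<sigma>)"
| mult: "poly_fun f \<Longrightarrow> poly_fun g \<Longrightarrow> poly_fun (\<lambda>\<sigma>. f \<sigma> * g \<sigma>)"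

lemma poly_fun_uminus: "poly_fun f \<Longrightarrow> poly_fun (\<lambda>\<sigma>. - f \<sigma>)"
  using poly_fun.mult[OF poly_fun.const[of "-1"], of f] by simp

lemma poly_fun_diff: "poly_fun f \<Longrightarrow> poly_fun g \<Longrightarrow> poly_fun (\<lambda>\<sigma>. f \<sigma> - g \<sigma>)"
  using poly_fun.add[OF _ poly_fun_uminus, of f g] by simp

lemma poly_fun_compose: "poly_fun f \<Longrightarrow> poly_fun (\<lambda>\<sigma>. f (\<lambda>i. \<sigma> (\<pi> i)))"
  by (induction rule: poly_fun.induct) (auto intro: poly_fun.intros)

lemma poly_fun_on_line:
  assumes "poly_fun f"
  shows "\<exists>p. \<forall>t. f (\<lambda>i. a i + t * b i) = poly p t"
  using assms
proof (induction rule: poly_fun.induct)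
  case (const c)
  show ?case by (rule exI[of _ "[:c:]"]) simp
next
  case (var i)
  show ?case by (rule exI[of _ "[:a i, b i:]"]) simp
next
  case (add f g)
  then obtain p q where "\<forall>t. f (\<lambda>i. a i + t * b i) = poly p t" "\<forall>t. g (\<lambda>i. a i + t * b i) = poly q t"
    by blast
  then show ?case by (intro exI[of _ "p + q"]) simp
next
  case (mult f g)
  then obtain p q where "\<forall>t. f (\<lambda>i. a i + t * b i) = poly p t" "\<forall>t. g (\<lambda>i. a i + t * b i) = poly q t"
    by blast
  then show ?case by (intro exI[of _ "p * q"]) simp
qed

text \<open>The property holds on a nonempty Zariski-open set, given by the nonvanishing of one
  polynomial.\<close>

definition generic :: "((nat \<Rightarrow> real) \<Rightarrow> bool) \<Rightarrow> bool" where
  "generic P \<longleftrightarrow> (\<exists>f. poly_fun f \<and> (\<exists>\<sigma>. f \<sigma> \<noteq> 0) \<and> (\<forall>\<sigma>. f \<sigma> \<noteq> 0 \<longrightarrow> P \<sigma>))"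

lemma generic_ex: "generic P \<Longrightarrow> \<exists>\<sigma>. P \<sigma>"
  by (auto simp: generic_def)

lemma generic_mono: "generic P \<Longrightarrow> (\<And>\<sigma>. P \<sigma> \<Longrightarrow> Q \<sigma>) \<Longrightarrow> generic Q"
  by (auto simp: generic_def)

lemma generic_True: "generic (\<lambda>\<sigma>. True)"
  unfolding generic_def by (rule exI[of _ "\<lambda>\<sigma>. 1"]) (auto intro: poly_fun.const)

text \<open>The product of the two polynomials has to be nonzero somewhere. On the line that joins a
  point where \<open>f\<close> does not vanish to one where \<open>g\<close> does not, both restrict
  to nonzero univariate polynomials, whose product is again nonzero.\<close>

lemma generic_conj:
  assumes "generic P" "generic Q"
  shows "generic (\<lambda>\<sigma>. P \<sigma> \<and> Q \<sigma>)"
proof -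
  obtain f a where f: "poly_fun f" "f a \<noteq> 0" "\<And>\<sigma>. f \<sigma> \<noteq> 0 \<Longrightarrow> P \<sigma>"
    using assms(1) unfolding generic_def by blast
  obtain g b where g: "poly_fun g" "g b \<noteq> 0" "\<And>\<sigma>. g \<sigma> \<noteq> 0 \<Longrightarrow> Q \<sigma>"
    using assms(2) unfolding generic_def by blast
  let ?l = "\<lambda>t i. a i + t * (b i - a i)"
  obtain p where p: "\<And>t. f (?l t) = poly p t"
    using poly_fun_on_line[OF f(1), of a "\<lambda>i. b i - a i"] by blast
  obtain q where q: "\<And>t. g (?l t) = poly q t"
    using poly_fun_on_line[OF g(1), of a "\<lambda>i. b i - a i"] by blast
  have "poly p 0 \<noteq> 0" "poly q 1 \<noteq> 0"
    using f(2) g(2) p[of 0] q[of 1] by simp_all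
  then have "p * q \<noteq> 0" by auto
  then obtain t where "poly (p * q) t \<noteq> 0"
    using poly_all_0_iff_0 by blast
  then have "f (?l t) * g (?l t) \<noteq> 0"
    by (simp add: p q)
  then show ?thesis
    unfolding generic_def
    by (intro exI[of _ "\<lambda>\<sigma>. f \<sigma> * g \<sigma>"]) (use f g in \<open>auto intro: poly_fun.mult\<close>)
qed

lemma generic_ball:
  assumes "finite A" "\<And>a. a \<in> A \<Longrightarrow> generic (P a)"
  shows "generic (\<lambda>\<sigma>. \<forall>a\<in>A. P a \<sigma>)"
  using assms
proof (induction rule: finite_induct)
  case empty
  then show ?case by (simp add: generic_True)
next
  case (insert a A)
  have "generic (\<lambda>\<sigma>. P a \<sigma> \<and> (\<forall>a\<in>A. P a \<sigma>))"
    using insert by (intro generic_conj) auto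
  then show ?case by simp
qed

lemma generic_permute:
  assumes "generic P" "bij \<pi>"
  shows "generic (\<lambda>\<sigma>. P (\<lambda>i. \<sigma> (\<pi> i)))"
proof -
  obtain f a where f: "poly_fun f" "f a \<noteq> 0" "\<And>\<sigma>. f \<sigma> \<noteq> 0 \<Longrightarrow> P \<sigma>"
    using assms(1) unfolding generic_def by blast
  have "(\<lambda>i. (a \<circ> inv \<pi>) (\<pi> i)) = a"
    using assms(2) by (auto simp: bij_def)
  then have "f (\<lambda>i. (a \<circ> inv \<pi>) (\<pi> i)) \<noteq> 0"
    using f(2) by simp
  then show ?thesis
    unfolding generic_def
    by (intro exI[of _ "\<lambda>\<sigma>. f (\<lambda>i. \<sigma> (\<pi> i))"])
       (use f in \<open>auto intro: poly_fun_compose\<close>)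
qed

lemma generic_inj_on:
  assumes "finite A"
  shows "generic (\<lambda>\<sigma>. inj_on \<sigma> A)"
proof -
  let ?D = "{x \<in> A \<times> A. fst x \<noteq> snd x}"
  have "generic (\<lambda>\<sigma>. \<forall>x\<in>?D. \<sigma> (fst x) \<noteq> \<sigma> (snd x))"
  proof (rule generic_ball)
    show "finite ?D" using assms by simp
    fix x assume x: "x \<in> ?D"
    have "poly_fun (\<lambda>\<sigma>. \<sigma> (fst x) - \<sigma> (snd x))"
      by (intro poly_fun_diff poly_fun.var)
    moreover have "\<exists>\<sigma> :: nat \<Rightarrow> real. \<sigma> (fst x) - \<sigma> (snd x) \<noteq> 0"
      using x by (intro exI[of _ "\<lambda>k. of_bool (k = fst x)"]) auto
    ultimately show "generic (\<lambda>\<sigma>. \<sigma> (fst x) \<noteq> \<sigma> (snd x))"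
      unfolding generic_def by (intro exI[of _ "\<lambda>\<sigma>. \<sigma> (fst x) - \<sigma> (snd x)"]) auto
  qed
  then show ?thesis
    by (rule generic_mono) (force simp: inj_on_def)
qed

text \<open>Fraction-free Gaussian elimination takes the place of a nonvanishing maximal minor: the
  certificate is a product of pivots, each of them nonzero at \<open>\<sigma>\<^sub>0\<close>. The
  induction eliminates one unknown at a time.\<close>

lemma generic_trivial_kernel:
  fixes A :: "'i \<Rightarrow> 'j \<Rightarrow> (nat \<Rightarrow> real) \<Rightarrow> real"
  assumes "finite I" "\<And>i j. poly_fun (A i j)"
    and "\<And>w. \<forall>j\<in>J. (\<Sum>i\<in>I. w i * A i j \<sigma>\<^sub>0) = 0 \<Longrightarrow> \<forall>i\<in>I. w i = 0"
  shows "generic (\<lambda>\<sigma>. \<forall>w. (\<forall>j\<in>J. (\<Sum>i\<in>I. w i * A i j \<sigma>) = 0) \<longrightarrow> (\<forall>i\<in>I. w i = 0))"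
proof -
  have "\<exists>f. poly_fun f \<and> f \<sigma>\<^sub>0 \<noteq> 0 \<and>
      (\<forall>\<sigma>. f \<sigma> \<noteq> 0 \<longrightarrow> (\<forall>w. (\<forall>j\<in>J. (\<Sum>i\<in>I. w i * A i j \<sigma>) = 0) \<longrightarrow> (\<forall>i\<in>I. w i = 0)))"
    using assms
  proof (induction I arbitrary: A rule: finite_induct)
    case empty
    show ?case by (rule exI[of _ "\<lambda>\<sigma>. 1"]) (auto intro: poly_fun.const)
  next
    case (insert k I)
    have "\<exists>j\<in>J. A k j \<sigma>\<^sub>0 \<noteq> 0"
    proof (rule ccontr)
      assume "\<not> ?thesis"
      then have "\<forall>j\<in>J. (\<Sum>i\<in>insert k I. of_bool (i = k) * A i j \<sigma>\<^sub>0) = 0"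
        using insert.hyps by (auto intro!: sum.neutral)
      from insert.prems(2)[OF this] show False by auto
    qed
    then obtain j\<^sub>0 where j0: "j\<^sub>0 \<in> J" "A k j\<^sub>0 \<sigma>\<^sub>0 \<noteq> 0" by blast
    \<comment> \<open>Cross-multiplying with the pivot instead of dividing by it keeps the entries
      polynomial.\<close>
    define B where "B i j \<sigma> = A k j\<^sub>0 \<sigma> * A i j \<sigma> - A i j\<^sub>0 \<sigma> * A k j \<sigma>" for i j \<sigma>
    have B_sum: "(\<Sum>i\<in>I. w i * B i j \<sigma>) =
        A k j\<^sub>0 \<sigma> * (\<Sum>i\<in>I. w i * A i j \<sigma>) - A k j \<sigma> * (\<Sum>i\<in>I. w i * A i j\<^sub>0 \<sigma>)" for w j \<sigma>
      by (simp add: B_def sum_distrib_left sum_subtractf algebra_simps)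
    have "\<exists>f. poly_fun f \<and> f \<sigma>\<^sub>0 \<noteq> 0 \<and>
      (\<forall>\<sigma>. f \<sigma> \<noteq> 0 \<longrightarrow> (\<forall>w. (\<forall>j\<in>J. (\<Sum>i\<in>I. w i * B i j \<sigma>) = 0) \<longrightarrow> (\<forall>i\<in>I. w i = 0)))"
    proof (rule insert.IH)
      show "poly_fun (B i j)" for i j
        unfolding B_def by (intro poly_fun_diff poly_fun.mult insert.prems)
      fix w assume w: "\<forall>j\<in>J. (\<Sum>i\<in>I. w i * B i j \<sigma>\<^sub>0) = 0"
      \<comment> \<open>A kernel vector of the reduced system lifts to the original one: scale it by
        the pivot and let the coordinate \<open>k\<close> balance the column
        \<open>j\<^sub>0\<close>.\<close>
      define w' where "w' = (\<lambda>i. A k j\<^sub>0 \<sigma>\<^sub>0 * w i)(k := - (\<Sum>i\<in>I. w i * A i j\<^sub>0 \<sigma>\<^sub>0))"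
      have "(\<Sum>i\<in>insert k I. w' i * A i j \<sigma>\<^sub>0) = (\<Sum>i\<in>I. w i * B i j \<sigma>\<^sub>0)" for j
      proof -
        have "(\<Sum>i\<in>insert k I. w' i * A i j \<sigma>\<^sub>0) =
            w' k * A k j \<sigma>\<^sub>0 + (\<Sum>i\<in>I. A k j\<^sub>0 \<sigma>\<^sub>0 * (w i * A i j \<sigma>\<^sub>0))"
          using insert.hyps by (auto simp: w'_def mult.assoc intro!: sum.cong)
        then show ?thesis
          by (simp add: B_sum w'_def flip: sum_distrib_left)
      qed
      then have "\<forall>i\<in>insert k I. w' i = 0"
        using w by (intro insert.prems(2)) simp
      then show "\<forall>i\<in>I. w i = 0"
        using j0(2) insert.hyps by (auto simp: w'_def split: if_splits)
    qed
    then obtain f where f: "poly_fun f" "f \<sigma>\<^sub>0 \<noteq> 0"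
      "\<And>\<sigma> w. f \<sigma> \<noteq> 0 \<Longrightarrow> \<forall>j\<in>J. (\<Sum>i\<in>I. w i * B i j \<sigma>) = 0 \<Longrightarrow> \<forall>i\<in>I. w i = 0"
      by blast
    show ?case
    proof (intro exI[of _ "\<lambda>\<sigma>. f \<sigma> * A k j\<^sub>0 \<sigma>"] conjI allI impI)
      show "poly_fun (\<lambda>\<sigma>. f \<sigma> * A k j\<^sub>0 \<sigma>)"
        by (intro poly_fun.mult f insert.prems)
      show "f \<sigma>\<^sub>0 * A k j\<^sub>0 \<sigma>\<^sub>0 \<noteq> 0" using f(2) j0(2) by simp
      fix \<sigma> w
      assume nz: "f \<sigma> * A k j\<^sub>0 \<sigma> \<noteq> 0"
        and w: "\<forall>j\<in>J. (\<Sum>i\<in>insert k I. w i * A i j \<sigma>) = 0"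
      have s: "(\<Sum>i\<in>I. w i * A i j \<sigma>) = - w k * A k j \<sigma>" if "j \<in> J" for j
        using w[rule_format, OF that] insert.hyps by simp
      have "\<forall>j\<in>J. (\<Sum>i\<in>I. w i * B i j \<sigma>) = 0"
        using s j0(1) by (simp add: B_sum)
      then have *: "\<forall>i\<in>I. w i = 0" using f(3)[of \<sigma> w] nz by fastforce
      then have "(\<Sum>i\<in>I. w i * A i j\<^sub>0 \<sigma>) = 0" by (simp add: sum.neutral)
      then have "w k = 0" using s[OF j0(1)] nz by simp
      with * show "\<forall>i\<in>insert k I. w i = 0" by simp
    qed
  qed
  then show ?thesis unfolding generic_def by blast
qed

text \<open>Finite-dimensional duality: the annihilator of a common kernel is the span of the
  functionals. When one more functional is added, either it vanishes on the kernel of the others and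
  contributes nothing, or a vector \<open>z0\<close> of that kernel on which it is nonzero
  determines its coefficient.\<close>

lemma functional_in_span:
  fixes r :: "'i \<Rightarrow> 'j \<Rightarrow> real"
  assumes "finite I" "finite J"
    and "\<And>z. \<forall>i\<in>I. (\<Sum>j\<in>J. r i j * z j) = 0 \<Longrightarrow> (\<Sum>j\<in>J. g j * z j) = 0"
  shows "\<exists>l. \<forall>j\<in>J. g j = (\<Sum>i\<in>I. l i * r i j)"
  using assms(1,3)
proof (induction I arbitrary: g rule: finite_induct)
  case empty
  have "g k = 0" if "k \<in> J" for k
    using empty.prems[of "\<lambda>j. of_bool (j = k)"] that assms(2) by simp
  then show ?case by simp
next
  case (insert k I)
  let ?ker = "\<lambda>z. \<forall>i\<in>I. (\<Sum>j\<in>J. r i j * z j) = 0"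
  let ?ap = "\<lambda>g z. \<Sum>j\<in>J. g j * (z j :: real)"
  show ?case
  proof (cases "\<forall>z. ?ker z \<longrightarrow> ?ap (r k) z = 0")
    case True
    then have "\<exists>l. \<forall>j\<in>J. g j = (\<Sum>i\<in>I. l i * r i j)"
      by (intro insert.IH insert.prems) auto
    then obtain l where l: "\<forall>j\<in>J. g j = (\<Sum>i\<in>I. l i * r i j)" ..
    have "(\<Sum>i\<in>I. (l(k := 0)) i * r i j) = (\<Sum>i\<in>I. l i * r i j)" for j
      using insert.hyps by (auto intro!: sum.cong)
    then show ?thesis
      using l insert.hyps by (intro exI[of _ "l(k := 0)"]) simp
  next
    case False
    then obtain z0 where z0: "?ker z0" "?ap (r k) z0 \<noteq> 0" by blast
    define a where "a = ?ap g z0 / ?ap (r k) z0"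
    have "\<exists>l. \<forall>j\<in>J. g j - a * r k j = (\<Sum>i\<in>I. l i * r i j)"
    proof (rule insert.IH)
      fix z assume z: "?ker z"
      define b where "b = ?ap (r k) z / ?ap (r k) z0"
      have ap: "?ap h (\<lambda>j. z j - b * z0 j) = ?ap h z - b * ?ap h z0" for h
        by (simp add: sum_subtractf sum_distrib_left algebra_simps)
      have "\<forall>i\<in>insert k I. ?ap (r i) (\<lambda>j. z j - b * z0 j) = 0"
        using z z0 by (simp add: ap) (simp add: b_def)
      then have "?ap g (\<lambda>j. z j - b * z0 j) = 0" by (rule insert.prems)
      then have "?ap g z = b * ?ap g z0" by (simp add: ap)
      moreover have "(\<Sum>j\<in>J. (g j - a * r k j) * z j) = ?ap g z - a * ?ap (r k) z"
        by (simp add: sum_subtractf sum_distrib_left algebra_simps)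
      ultimately show "(\<Sum>j\<in>J. (g j - a * r k j) * z j) = 0"
        using z0(2) by (simp add: a_def b_def)
    qed
    then obtain l where l: "\<forall>j\<in>J. g j - a * r k j = (\<Sum>i\<in>I. l i * r i j)" ..
    have "(\<Sum>i\<in>I. (l(k := a)) i * r i j) = (\<Sum>i\<in>I. l i * r i j)" for j
      using insert.hyps by (auto intro!: sum.cong)
    then show ?thesis
      using l insert.hyps
      by (intro exI[of _ "l(k := a)"]) (auto simp: algebra_simps)
  qed
qed

text \<open>Start at a point that is right for all of \<open>Q\<close> and move in a direction that
  is right for the new form \<open>k\<close>. Along this line none of the forms vanishes
  identically, so each excludes at most one parameter \<open>t\<close>.\<close>

lemma avoid_hyperplanes:
  fixes L :: "'q \<Rightarrow> ('j \<Rightarrow> real) \<Rightarrow> real"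
  assumes "finite Q"
    and lin: "\<And>q z z' t. L q (\<lambda>j. z j + t * z' j) = L q z + t * L q z'"
    and S0: "S (\<lambda>j. 0)" and S: "\<And>z z' t. S z \<Longrightarrow> S z' \<Longrightarrow> S (\<lambda>j. z j + t * z' j)"
    and nz: "\<And>q. q \<in> Q \<Longrightarrow> \<exists>z. S z \<and> L q z \<noteq> 0"
  shows "\<exists>z. S z \<and> (\<forall>q\<in>Q. L q z \<noteq> 0)"
  using assms(1) nz
proof (induction rule: finite_induct)
  case empty
  then show ?case using S0 by blast
next
  case (insert k Q)
  obtain z where z: "S z" "\<forall>q\<in>Q. L q z \<noteq> 0" using insert by auto
  obtain y where y: "S y" "L k y \<noteq> 0" using insert.prems by auto
  have "finite ((\<lambda>q. - L q z / L q y) ` insert k Q)" using insert.hyps by simp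
  then obtain t where t: "t \<notin> (\<lambda>q. - L q z / L q y) ` insert k Q \<union> {0}"
    using ex_new_if_finite[OF infinite_UNIV_char_0] by (metis finite_Un finite.emptyI finite.insertI)
  have "L q (\<lambda>j. z j + t * y j) \<noteq> 0" if q: "q \<in> insert k Q" for q
  proof
    assume "L q (\<lambda>j. z j + t * y j) = 0"
    then have *: "L q z = - t * L q y" by (simp add: lin)
    show False
    proof (cases "L q y = 0")
      case True
      then have "L q z = 0" "q \<noteq> k" using * y(2) by auto
      then show False using z(2) q by auto
    next
      case False
      then have "t = - L q z / L q y" using * by (simp add: field_simps)
      then show False using t q by blast
    qed
  qed
  then show ?case using S[OF z(1) y(1), of t] by blast
qed

section \<open>Stresses and slope realizations\<close>

definition dipole :: "'a \<Rightarrow> 'a \<Rightarrow> 'a \<Rightarrow> real" where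
  "dipole u v x = of_bool (x = u) - of_bool (x = v)"

text \<open>Up to a quarter turn, the edge \<open>xy\<close> acts on \<open>x\<close> with the force
  \<open>w x y\<close> times the vector with coordinates 1 and \<open>\<sigma> (c x y)\<close>. The
  two sums are the coordinates of the resultant force, which has to equal the load with coordinates
  \<open>f x\<close> and \<open>g x\<close>.\<close>

definition stress ::
    "'a set \<Rightarrow> ('a \<Rightarrow> 'a \<Rightarrow> bool) \<Rightarrow> ('a \<Rightarrow> 'a \<Rightarrow> nat) \<Rightarrow> (nat \<Rightarrow> real) \<Rightarrow>
     ('a \<Rightarrow> 'a \<Rightarrow> real) \<Rightarrow> ('a \<Rightarrow> real) \<Rightarrow> ('a \<Rightarrow> real) \<Rightarrow> bool" where
  "stress V E c \<sigma> w f g \<longleftrightarrow>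
     (\<forall>x y. w x y = - w y x) \<and> (\<forall>x y. \<not> E x y \<longrightarrow> w x y = 0) \<and>
     (\<forall>x\<in>V. (\<Sum>y\<in>V. w x y) = f x) \<and> (\<forall>x\<in>V. (\<Sum>y\<in>V. \<sigma> (c x y) * w x y) = g x)"

definition stress_free where
  "stress_free V E c \<sigma> \<longleftrightarrow> (\<forall>w. stress V E c \<sigma> w (\<lambda>x. 0) (\<lambda>x. 0) \<longrightarrow> (\<forall>x y. w x y = 0))"

text \<open>This is dual to the existence of positions in which \<open>u\<close> and
  \<open>v\<close> are not on a common line of slope \<open>\<sigma> s\<close>. An edge of color
  \<open>s\<close> is exempt, as it can carry such a load itself. Adjacent vertices are still tested
  with the other colors, which keeps their points apart.\<close>

definition separating where
  "separating V E c \<sigma> \<longleftrightarrow>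
     (\<forall>u\<in>V. \<forall>v\<in>V. \<forall>s<7. u \<noteq> v \<longrightarrow> \<not> (E u v \<and> c u v = s) \<longrightarrow>
       (\<forall>w \<phi>. stress V E c \<sigma> w (\<lambda>x. \<phi> * dipole u v x) (\<lambda>x. \<sigma> s * \<phi> * dipole u v x) \<longrightarrow> \<phi> = 0))"

definition graph_on :: "'a set \<Rightarrow> ('a \<Rightarrow> 'a \<Rightarrow> bool) \<Rightarrow> bool" where
  "graph_on V E \<longleftrightarrow> finite V \<and> (\<forall>x y. E x y \<longrightarrow> x \<in> V \<and> y \<in> V \<and> x \<noteq> y \<and> E y x)"

definition coloring :: "('a \<Rightarrow> 'a \<Rightarrow> bool) \<Rightarrow> ('a \<Rightarrow> 'a \<Rightarrow> nat) \<Rightarrow> bool" where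
  "coloring E c \<longleftrightarrow> (\<forall>x y. E x y \<longrightarrow> c x y = c y x \<and> c x y < 7)"

lemma graph_onD:
  assumes "graph_on V E"
  shows "finite V" "E x y \<Longrightarrow> x \<in> V" "E x y \<Longrightarrow> y \<in> V" "E x y \<Longrightarrow> x \<noteq> y" "E x y \<Longrightarrow> E y x"
  using assms by (auto simp: graph_on_def)

lemma graph_on_sym: "graph_on V E \<Longrightarrow> E x y \<longleftrightarrow> E y x"
  by (auto simp: graph_on_def)

text \<open>The component \<open>True\<close> of \<open>z\<close> is the ordinate and
  \<open>False\<close> the abscissa. The form vanishes if and only if the points of \<open>x\<close>
  and \<open>y\<close> coincide or span a line of slope \<open>m\<close>.\<close>

definition line_form :: "real \<Rightarrow> 'a \<Rightarrow> 'a \<Rightarrow> ('a \<times> bool \<Rightarrow> real) \<Rightarrow> real" where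
  "line_form m x y z = (z (x, True) - z (y, True)) - m * (z (x, False) - z (y, False))"

text \<open>Otherwise the form of the pair \<open>u\<close>, \<open>v\<close> vanishes on all
  positions that respect the edges, so it is a linear combination of the edge forms. The
  coefficients are a stress whose load is a dipole of strength 1, which \<open>separating\<close>
  forbids.\<close>

lemma separating_solution:
  assumes G: "graph_on V E" "coloring E c" "separating V E c \<sigma>"
    and uv: "u \<in> V" "v \<in> V" "u \<noteq> v" "s < 7" "\<not> (E u v \<and> c u v = s)"
  shows "\<exists>z. (\<forall>x y. E x y \<longrightarrow> line_form (\<sigma> (c x y)) x y z = 0) \<and> line_form (\<sigma> s) u v z \<noteq> 0"
proof (rule ccontr)
  assume no: "\<not> ?thesis"
  note fin = graph_onD(1)[OF G(1)]
  define I where "I = {(x, y). E x y}"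
  define J where "J = V \<times> (UNIV :: bool set)"
  define cf where "cf m x y j = (if snd j then dipole x y (fst j) else - m * dipole x y (fst j))"
    for m x y and j :: "'a \<times> bool"
  have I: "I \<subseteq> V \<times> V" using graph_onD[OF G(1)] by (auto simp: I_def)
  have finI: "finite I" by (rule finite_subset[OF I]) (use fin in auto)
  have pick: "(\<Sum>p\<in>V. of_bool (p = q) * h p) = h q" if "q \<in> V" for q and h :: "'a \<Rightarrow> real"
    using that fin by simp
  have form: "(\<Sum>j\<in>J. cf m x y j * z j) = line_form m x y z" if "x \<in> V" "y \<in> V" for m x y z
  proof -
    have "(\<Sum>j\<in>J. cf m x y j * z j) = (\<Sum>p\<in>V. \<Sum>b\<in>UNIV. cf m x y (p, b) * z (p, b))"
      by (simp add: J_def sum.cartesian_product)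
    also have "\<dots> = (\<Sum>p\<in>V. dipole x y p * (z (p, True) - m * z (p, False)))"
      by (simp add: UNIV_bool cf_def algebra_simps)
    also have "\<dots> = (\<Sum>p\<in>V. of_bool (p = x) * (z (p, True) - m * z (p, False))) -
        (\<Sum>p\<in>V. of_bool (p = y) * (z (p, True) - m * z (p, False)))"
      by (simp only: dipole_def left_diff_distrib sum_subtractf)
    also have "\<dots> = line_form m x y z"
      by (simp only: pick that) (simp add: line_form_def algebra_simps)
    finally show ?thesis .
  qed
  have "\<exists>l. \<forall>j\<in>J. cf (\<sigma> s) u v j = (\<Sum>i\<in>I. l i * cf (\<sigma> (c (fst i) (snd i))) (fst i) (snd i) j)"
  proof (rule functional_in_span[OF finI])
    show "finite J" using fin by (simp add: J_def)
    fix z assume z: "\<forall>i\<in>I. (\<Sum>j\<in>J. cf (\<sigma> (c (fst i) (snd i))) (fst i) (snd i) j * z j) = 0"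
    have "line_form (\<sigma> (c x y)) x y z = 0" if "E x y" for x y
      using z[rule_format, of "(x, y)"] that form[of x y] graph_onD(2,3)[OF G(1) that]
      by (simp add: I_def)
    then show "(\<Sum>j\<in>J. cf (\<sigma> s) u v j * z j) = 0"
      unfolding form[OF uv(1,2)] using no by blast
  qed
  then obtain l where l: "\<And>j. j \<in> J \<Longrightarrow>
      cf (\<sigma> s) u v j = (\<Sum>i\<in>I. l i * cf (\<sigma> (c (fst i) (snd i))) (fst i) (snd i) j)" by blast
  \<comment> \<open>Every edge occurs as two arcs with unrelated coefficients; antisymmetrizing
    merges them into one weight.\<close>
  define k where "k x y = (if E x y then l (x, y) else 0)" for x y
  define w where "w x y = k x y - k y x" for x y
  have key: "(\<Sum>i\<in>I. l i * (h (fst i) (snd i) * dipole (fst i) (snd i) p)) = (\<Sum>y\<in>V. h p y * w p y)"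
    if p: "p \<in> V" and h: "\<And>x y. E x y \<Longrightarrow> h x y = h y x" for h p
  proof -
    have "(\<Sum>i\<in>I. l i * (h (fst i) (snd i) * dipole (fst i) (snd i) p)) =
        (\<Sum>i\<in>V \<times> V. k (fst i) (snd i) * (h (fst i) (snd i) * dipole (fst i) (snd i) p))"
      by (rule sum.mono_neutral_cong_left) (use I fin in \<open>auto simp: I_def k_def\<close>)
    also have "\<dots> = (\<Sum>x\<in>V. \<Sum>y\<in>V. k x y * (h x y * dipole x y p))"
      by (simp add: sum.cartesian_product case_prod_beta)
    also have "\<dots> = (\<Sum>x\<in>V. \<Sum>y\<in>V. of_bool (p = x) * (k x y * h x y)) -
        (\<Sum>x\<in>V. \<Sum>y\<in>V. of_bool (p = y) * (k x y * h x y))"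
      by (simp add: dipole_def left_diff_distrib right_diff_distrib sum_subtractf mult_ac)
    also have "(\<Sum>x\<in>V. \<Sum>y\<in>V. of_bool (p = x) * (k x y * h x y)) = (\<Sum>y\<in>V. k p y * h p y)"
      using fin p by (simp flip: sum_distrib_left)
    also have "(\<Sum>x\<in>V. \<Sum>y\<in>V. of_bool (p = y) * (k x y * h x y)) = (\<Sum>x\<in>V. k x p * h x p)"
      using fin p by simp
    also have "\<dots> = (\<Sum>y\<in>V. k y p * h p y)"
      by (rule sum.cong) (auto simp: k_def dest: h)
    finally show ?thesis
      by (simp add: w_def sum_subtractf algebra_simps)
  qed
  have "stress V E c \<sigma> w (\<lambda>x. 1 * dipole u v x) (\<lambda>x. \<sigma> s * 1 * dipole u v x)"
    unfolding stress_def
  proof (intro conjI allI ballI impI)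
    fix x y
    show "w x y = - w y x" by (simp add: w_def)
    show "w x y = 0" if "\<not> E x y"
      using that graph_on_sym[OF G(1), of x y] by (simp add: w_def k_def)
  next
    fix x assume x: "x \<in> V"
    have "dipole u v x = (\<Sum>y\<in>V. 1 * w x y)"
      using l[of "(x, True)"] x by (subst key[symmetric]) (auto simp: J_def cf_def)
    then show "(\<Sum>y\<in>V. w x y) = 1 * dipole u v x" by simp
    have "\<sigma> s * dipole u v x =
        (\<Sum>i\<in>I. l i * (\<sigma> (c (fst i) (snd i)) * dipole (fst i) (snd i) x))"
      using l[of "(x, False)"] x by (simp add: J_def cf_def sum_negf)
    also have "\<dots> = (\<Sum>y\<in>V. \<sigma> (c x y) * w x y)"
      by (rule key[OF x]) (use G(2) in \<open>metis coloring_def\<close>)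
    finally show "(\<Sum>y\<in>V. \<sigma> (c x y) * w x y) = \<sigma> s * 1 * dipole u v x" by simp
  qed
  then have "(1 :: real) = 0"
    using G(3) uv unfolding separating_def by blast
  then show False by simp
qed

lemma separating_points:
  assumes G: "graph_on V E" "coloring E c" "separating V E c \<sigma>"
  shows "\<exists>z. (\<forall>x y. E x y \<longrightarrow> line_form (\<sigma> (c x y)) x y z = 0) \<and>
     (\<forall>u\<in>V. \<forall>v\<in>V. \<forall>s<7. u \<noteq> v \<longrightarrow> \<not> (E u v \<and> c u v = s) \<longrightarrow> line_form (\<sigma> s) u v z \<noteq> 0)"
proof -
  define Q where "Q = {(u, v, s). u \<in> V \<and> v \<in> V \<and> s < 7 \<and> u \<noteq> v \<and> \<not> (E u v \<and> c u v = s)}"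
  define L where "L q z = line_form (\<sigma> (snd (snd q))) (fst q) (fst (snd q)) z"
    for q :: "'a \<times> 'a \<times> nat" and z
  have "\<exists>z. (\<forall>x y. E x y \<longrightarrow> line_form (\<sigma> (c x y)) x y z = 0) \<and> (\<forall>q\<in>Q. L q z \<noteq> 0)"
  proof (rule avoid_hyperplanes)
    show "finite Q"
      by (rule finite_subset[of _ "V \<times> V \<times> {..<7}"]) (use graph_onD(1)[OF G(1)] in \<open>auto simp: Q_def\<close>)
    show "L q (\<lambda>j. z j + t * z' j) = L q z + t * L q z'" for q z z' t
      by (simp add: L_def line_form_def algebra_simps)
    show "\<forall>x y. E x y \<longrightarrow> line_form (\<sigma> (c x y)) x y (\<lambda>j. 0) = 0"
      by (simp add: line_form_def)
    show "\<forall>x y. E x y \<longrightarrow> line_form (\<sigma> (c x y)) x y (\<lambda>j. z j + t * z' j) = 0"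
      if "\<forall>x y. E x y \<longrightarrow> line_form (\<sigma> (c x y)) x y z = 0"
        "\<forall>x y. E x y \<longrightarrow> line_form (\<sigma> (c x y)) x y z' = 0" for z z' t
    proof (intro allI impI)
      fix x y assume "E x y"
      have "line_form m x y (\<lambda>j. z j + t * z' j) = line_form m x y z + t * line_form m x y z'" for m
        by (simp add: line_form_def algebra_simps)
      then show "line_form (\<sigma> (c x y)) x y (\<lambda>j. z j + t * z' j) = 0"
        using that \<open>E x y\<close> by simp
    qed
    show "\<exists>z. (\<forall>x y. E x y \<longrightarrow> line_form (\<sigma> (c x y)) x y z = 0) \<and> L q z \<noteq> 0" if "q \<in> Q" for q
      using that separating_solution[OF G, of "fst q" "fst (snd q)" "snd (snd q)"]
      by (auto simp: Q_def L_def)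
  qed
  then obtain z where z: "\<forall>x y. E x y \<longrightarrow> line_form (\<sigma> (c x y)) x y z = 0" "\<forall>q\<in>Q. L q z \<noteq> 0" by blast
  have "line_form (\<sigma> s) u v z \<noteq> 0"
    if "u \<in> V" "v \<in> V" "s < 7" "u \<noteq> v" "\<not> (E u v \<and> c u v = s)" for u v s
    using z(2)[rule_format, of "(u, v, s)"] that by (simp add: Q_def L_def)
  then show ?thesis using z(1) by blast
qed

section \<open>Genericity of stress conditions\<close>

lemma stressD:
  assumes "stress V E c \<sigma> w f g"
  shows "w x y = - w y x" "\<not> E x y \<Longrightarrow> w x y = 0"
    "x \<in> V \<Longrightarrow> (\<Sum>y\<in>V. w x y) = f x" "x \<in> V \<Longrightarrow> (\<Sum>y\<in>V. \<sigma> (c x y) * w x y) = g x"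
  using assms unfolding stress_def by blast+

lemma sum_edges:
  assumes "graph_on V E" "\<And>x y. \<not> E x y \<Longrightarrow> w x y = (0 :: real)"
  shows "(\<Sum>i\<in>{(x, y). E x y}. w (fst i) (snd i) * h (fst i) (snd i)) = (\<Sum>x\<in>V. \<Sum>y\<in>V. w x y * h x y)"
proof -
  have "(\<Sum>i\<in>{(x, y). E x y}. w (fst i) (snd i) * h (fst i) (snd i)) =
      (\<Sum>i\<in>V \<times> V. w (fst i) (snd i) * h (fst i) (snd i))"
    by (rule sum.mono_neutral_left)
       (use graph_onD[OF assms(1)] assms(2) in auto)
  then show ?thesis by (simp add: sum.cartesian_product case_prod_beta)
qed

text \<open>The load strengths \<open>\<phi> k\<close> are treated as unknowns beside the weights,
  so that a statement about stresses under unknown loads becomes the triviality of a kernel. The set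
  \<open>K\<close> is empty for stress-freeness, a singleton for separation, and has two elements
  for loose pairs.\<close>

lemma generic_stress_kernel:
  fixes F :: "'k \<Rightarrow> 'a \<Rightarrow> (nat \<Rightarrow> real) \<Rightarrow> real"
  assumes G: "graph_on V E" and K: "finite K"
    and poly: "\<And>k x. poly_fun (F k x)" "\<And>k x. poly_fun (H k x)"
    and ker: "\<And>w \<phi>. stress V E c \<sigma>\<^sub>0 w (\<lambda>x. \<Sum>k\<in>K. \<phi> k * F k x \<sigma>\<^sub>0) (\<lambda>x. \<Sum>k\<in>K. \<phi> k * H k x \<sigma>\<^sub>0) \<Longrightarrow>
        (\<forall>x y. w x y = 0) \<and> (\<forall>k\<in>K. \<phi> k = 0)"
  shows "generic (\<lambda>\<sigma>. \<forall>w \<phi>. stress V E c \<sigma> w (\<lambda>x. \<Sum>k\<in>K. \<phi> k * F k x \<sigma>) (\<lambda>x. \<Sum>k\<in>K. \<phi> k * H k x \<sigma>) \<longrightarrow>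
        (\<forall>x y. w x y = 0) \<and> (\<forall>k\<in>K. \<phi> k = 0))"
proof -
  note fin = graph_onD(1)[OF G]
  define arcs where "arcs = {(x, y). E x y}"
  have fin_arcs: "finite arcs"
    by (rule finite_subset[of _ "V \<times> V"]) (use graph_onD[OF G] in \<open>auto simp: arcs_def\<close>)
  \<comment> \<open>The first index is an unknown, namely an arc weight or a load strength. The
    second is an equation: antisymmetry at an arc, or one of the two balance equations at a vertex,
    the one weighted by slopes being marked \<open>True\<close>.\<close>
  define A :: "('a \<times> 'a) + 'k \<Rightarrow> ('a \<times> 'a) + ('a \<times> bool) \<Rightarrow> (nat \<Rightarrow> real) \<Rightarrow> real"
    where "A i j \<sigma> = (case j of
      Inl e \<Rightarrow> (case i of Inl a \<Rightarrow> of_bool (a = e) + of_bool (a = prod.swap e) | Inr k \<Rightarrow> 0)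
    | Inr b \<Rightarrow> (case i of
        Inl a \<Rightarrow> of_bool (fst a = fst b) * (if snd b then \<sigma> (c (fst a) (snd a)) else 1)
      | Inr k \<Rightarrow> - (if snd b then H k (fst b) \<sigma> else F k (fst b) \<sigma>)))" for i j \<sigma>
  define J where "J = arcs <+> (V \<times> (UNIV :: bool set))"
  have polyA: "poly_fun (A i j)" for i j
  proof (cases j)
    case (Inl e)
    then have "A i j = (\<lambda>\<sigma>. case i of Inl a \<Rightarrow> of_bool (a = e) + of_bool (a = prod.swap e) | Inr k \<Rightarrow> 0)"
      by (simp add: A_def fun_eq_iff)
    then show ?thesis by (simp add: poly_fun.const)
  next
    case (Inr b)
    show ?thesis
    proof (cases i)
      case (Inl a)
      then have "A i j = (\<lambda>\<sigma>. of_bool (fst a = fst b) * (if snd b then \<sigma> (c (fst a) (snd a)) else 1))"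
        using Inr by (simp add: A_def fun_eq_iff)
      then show ?thesis
        by (cases "snd b") (simp_all add: poly_fun.const poly_fun.mult poly_fun.var)
    next
      case (Inr k)
      then have "A i j = (\<lambda>\<sigma>. - (if snd b then H k (fst b) else F k (fst b)) \<sigma>)"
        using \<open>j = Inr b\<close> by (simp add: A_def fun_eq_iff)
      moreover have "poly_fun (if snd b then H k (fst b) else F k (fst b))"
        using poly by simp
      ultimately show ?thesis using poly_fun_uminus by metis
    qed
  qed
  have pick: "(\<Sum>p\<in>V. of_bool (p = q) * h p) = h q" if "q \<in> V" for q and h :: "'a \<Rightarrow> real"
    using that fin by simp
  define ext where "ext w \<phi> = case_sum (\<lambda>a. w (fst a) (snd a)) \<phi>"
    for w :: "'a \<Rightarrow> 'a \<Rightarrow> real" and \<phi> :: "'k \<Rightarrow> real"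
  have iff: "(\<forall>j\<in>J. (\<Sum>i\<in>arcs <+> K. ext w \<phi> i * A i j \<sigma>) = 0) \<longleftrightarrow>
      stress V E c \<sigma> w (\<lambda>x. \<Sum>k\<in>K. \<phi> k * F k x \<sigma>) (\<lambda>x. \<Sum>k\<in>K. \<phi> k * H k x \<sigma>)"
    if w: "\<And>x y. \<not> E x y \<Longrightarrow> w x y = 0" for w \<phi> \<sigma>
  proof -
    have split: "(\<Sum>i\<in>arcs <+> K. ext w \<phi> i * A i j \<sigma>) =
        (\<Sum>a\<in>arcs. w (fst a) (snd a) * A (Inl a) j \<sigma>) + (\<Sum>k\<in>K. \<phi> k * A (Inr k) j \<sigma>)" for j
      using fin_arcs K by (subst sum.Plus) (auto simp: ext_def)
    have anti: "(\<Sum>i\<in>arcs <+> K. ext w \<phi> i * A i (Inl (x, y)) \<sigma>) = w x y + w y x"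
      if "E x y" for x y
      unfolding split using that fin_arcs graph_onD(5)[OF G that]
      by (simp add: A_def distrib_left sum.distrib, simp add: arcs_def)
    have vertex: "(\<Sum>i\<in>arcs <+> K. ext w \<phi> i * A i (Inr (x, b)) \<sigma>) =
        (\<Sum>y\<in>V. w x y * (if b then \<sigma> (c x y) else 1)) -
        (\<Sum>k\<in>K. \<phi> k * (if b then H k x \<sigma> else F k x \<sigma>))" if x: "x \<in> V" for x b
    proof -
      have "(\<Sum>a\<in>arcs. w (fst a) (snd a) * A (Inl a) (Inr (x, b)) \<sigma>) =
         (\<Sum>p\<in>V. \<Sum>q\<in>V. w p q * (of_bool (p = x) * (if b then \<sigma> (c p q) else 1)))"
        unfolding arcs_def A_def
        by (subst sum_edges[OF G w, symmetric]) simp_all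
      also have "\<dots> = (\<Sum>p\<in>V. of_bool (p = x) * (\<Sum>q\<in>V. w p q * (if b then \<sigma> (c p q) else 1)))"
        by (simp add: sum_distrib_left mult_ac)
      also have "\<dots> = (\<Sum>y\<in>V. w x y * (if b then \<sigma> (c x y) else 1))"
        by (rule pick[OF x])
      finally show ?thesis
        unfolding split by (cases b) (simp_all add: A_def sum_negf)
    qed
    have "(\<forall>j\<in>J. (\<Sum>i\<in>arcs <+> K. ext w \<phi> i * A i j \<sigma>) = 0) \<longleftrightarrow>
        (\<forall>x y. E x y \<longrightarrow> w x y + w y x = 0) \<and>
        (\<forall>x\<in>V. (\<Sum>y\<in>V. w x y) - (\<Sum>k\<in>K. \<phi> k * F k x \<sigma>) = 0 \<and>
           (\<Sum>y\<in>V. w x y * \<sigma> (c x y)) - (\<Sum>k\<in>K. \<phi> k * H k x \<sigma>) = 0)"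
    proof -
      define S where "S j = (\<Sum>i\<in>arcs <+> K. ext w \<phi> i * A i j \<sigma>)" for j
      have "(\<forall>j\<in>J. S j = 0) \<longleftrightarrow> (\<forall>x y. E x y \<longrightarrow> S (Inl (x, y)) = 0) \<and>
          (\<forall>x\<in>V. S (Inr (x, False)) = 0 \<and> S (Inr (x, True)) = 0)"
        by (auto simp: J_def arcs_def) (metis (full_types))
      then show ?thesis
        using anti vertex unfolding S_def by (simp cong: conj_cong)
    qed
    also have "(\<forall>x y. E x y \<longrightarrow> w x y + w y x = 0) \<longleftrightarrow> (\<forall>x y. w x y = - w y x)"
    proof -
      have "w x y + w y x = 0" if "\<not> E x y" for x y
        using w that graph_on_sym[OF G, of x y] by simp
      then show ?thesis by (metis add_eq_0_iff)
    qed
    finally show ?thesis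
      unfolding stress_def using w by (simp add: mult.commute ball_conj_distrib)
  qed
  have "generic (\<lambda>\<sigma>. \<forall>\<theta>. (\<forall>j\<in>J. (\<Sum>i\<in>arcs <+> K. \<theta> i * A i j \<sigma>) = 0) \<longrightarrow> (\<forall>i\<in>arcs <+> K. \<theta> i = 0))"
  proof (rule generic_trivial_kernel)
    show "finite (arcs <+> K)" using fin_arcs K by simp
    fix \<theta> assume \<theta>: "\<forall>j\<in>J. (\<Sum>i\<in>arcs <+> K. \<theta> i * A i j \<sigma>\<^sub>0) = 0"
    define w where "w x y = (if E x y then \<theta> (Inl (x, y)) else 0)" for x y
    have eq: "\<theta> i = ext w (\<theta> \<circ> Inr) i" if "i \<in> arcs <+> K" for i
      using that by (auto simp: ext_def w_def arcs_def)
    have "\<forall>j\<in>J. (\<Sum>i\<in>arcs <+> K. ext w (\<theta> \<circ> Inr) i * A i j \<sigma>\<^sub>0) = 0"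
      using \<theta> by (simp add: eq cong: sum.cong)
    then have "(\<forall>x y. w x y = 0) \<and> (\<forall>k\<in>K. (\<theta> \<circ> Inr) k = 0)"
      using iff[of w "\<theta> \<circ> Inr" \<sigma>\<^sub>0] by (intro ker) (simp add: w_def[abs_def])
    then show "\<forall>i\<in>arcs <+> K. \<theta> i = 0"
    proof (intro ballI)
      fix i assume i: "i \<in> arcs <+> K"
      have "ext w (\<theta> \<circ> Inr) i = 0"
        using \<open>(\<forall>x y. w x y = 0) \<and> _\<close> i by (auto simp: ext_def)
      then show "\<theta> i = 0" using eq[OF i] by (rule trans[rotated])
    qed
  qed (rule polyA)
  then show ?thesis
  proof (rule generic_mono, intro allI impI)
    fix \<sigma> w \<phi>
    assume triv: "\<forall>\<theta>. (\<forall>j\<in>J. (\<Sum>i\<in>arcs <+> K. \<theta> i * A i j \<sigma>) = 0) \<longrightarrow> (\<forall>i\<in>arcs <+> K. \<theta> i = 0)"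
      and st: "stress V E c \<sigma> w (\<lambda>x. \<Sum>k\<in>K. \<phi> k * F k x \<sigma>) (\<lambda>x. \<Sum>k\<in>K. \<phi> k * H k x \<sigma>)"
    note supp = stressD(2)[OF st]
    have "\<forall>i\<in>arcs <+> K. ext w \<phi> i = 0"
      using triv iff[of w \<phi> \<sigma>] supp st by blast
    note ext0 = bspec[OF this]
    have "w x y = 0" if "E x y" for x y
      using ext0[of "Inl (x, y)"] that by (auto simp: ext_def arcs_def)
    moreover have "\<phi> k = 0" if "k \<in> K" for k
      using ext0[of "Inr k"] that by (auto simp: ext_def)
    ultimately show "(\<forall>x y. w x y = 0) \<and> (\<forall>k\<in>K. \<phi> k = 0)"
      using supp by blast
  qed
qed

definition nice where
  "nice V E c \<sigma> \<longleftrightarrow> stress_free V E c \<sigma> \<and> separating V E c \<sigma>"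

definition proper where
  "proper E c \<longleftrightarrow> (\<forall>x y z. E x y \<longrightarrow> E x z \<longrightarrow> y \<noteq> z \<longrightarrow> c x y \<noteq> c x z)"

definition good where
  "good V E \<longleftrightarrow> (\<exists>c. coloring E c \<and> proper E c \<and> generic (nice V E c))"

lemma stress_loads: 
  "stress V E c \<sigma> w f g \<Longrightarrow> (\<And>x. x \<in> V \<Longrightarrow> f x = f' x) \<Longrightarrow> (\<And>x. x \<in> V \<Longrightarrow> g x = g' x) \<Longrightarrow>
   stress V E c \<sigma> w f' g'"
  unfolding stress_def by (metis (no_types, lifting))

text \<open>Separation by itself is not the triviality of a kernel, since a nonzero stress with
  \<open>\<phi> = 0\<close> might remain. Stress-freeness rules this out, and so both properties
  together are full-rank conditions that pass from \<open>\<sigma>\<^sub>0\<close> to generic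
  slopes.\<close>

lemma nice_generic:
  assumes G: "graph_on V E" and nice: "nice V E c \<sigma>\<^sub>0"
  shows "generic (nice V E c)"
proof -
  note fin = graph_onD(1)[OF G]
  have sf: "generic (stress_free V E c)"
  proof -
    have "generic (\<lambda>\<sigma>. \<forall>w \<phi>. stress V E c \<sigma> w (\<lambda>x. \<Sum>k\<in>{}. \<phi> k * 0) (\<lambda>x. \<Sum>k\<in>{}. \<phi> k * 0) \<longrightarrow>
        (\<forall>x y. w x y = 0) \<and> (\<forall>k\<in>({} :: unit set). \<phi> k = 0))"
      by (rule generic_stress_kernel[OF G])
         (use nice in \<open>auto simp: nice_def stress_free_def intro: poly_fun.const\<close>)
    then show ?thesis by (rule generic_mono) (simp add: stress_free_def)
  qed
  define Q where "Q = {(u, v, s). u \<in> V \<and> v \<in> V \<and> s < (7 :: nat) \<and> u \<noteq> v \<and> \<not> (E u v \<and> c u v = s)}"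
  define D where "D q = dipole (fst q) (fst (snd q))" for q :: "'a \<times> 'a \<times> nat"
  have "generic (\<lambda>\<sigma>. \<forall>q\<in>Q. \<forall>w (\<phi> :: unit \<Rightarrow> real).
      stress V E c \<sigma> w (\<lambda>x. \<Sum>k\<in>{()}. \<phi> k * D q x) (\<lambda>x. \<Sum>k\<in>{()}. \<phi> k * (\<sigma> (snd (snd q)) * D q x)) \<longrightarrow>
      (\<forall>x y. w x y = 0) \<and> (\<forall>k\<in>{()}. \<phi> k = 0))"
  proof (intro generic_ball generic_stress_kernel[OF G])
    show "finite Q"
      by (rule finite_subset[of _ "V \<times> V \<times> {..<7}"]) (use fin in \<open>auto simp: Q_def\<close>)
    fix q w and \<phi> :: "unit \<Rightarrow> real"
    assume q: "q \<in> Q" and st: "stress V E c \<sigma>\<^sub>0 w (\<lambda>x. \<Sum>k\<in>{()}. \<phi> k * D q x)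
        (\<lambda>x. \<Sum>k\<in>{()}. \<phi> k * (\<sigma>\<^sub>0 (snd (snd q)) * D q x))"
    obtain u v s where quvs: "q = (u, v, s)" by (cases q)
    from st have "stress V E c \<sigma>\<^sub>0 w (\<lambda>x. \<phi> () * dipole u v x) (\<lambda>x. \<sigma>\<^sub>0 s * \<phi> () * dipole u v x)"
      by (simp add: D_def quvs mult_ac)
    then have "\<phi> () = 0"
      using nice q quvs unfolding nice_def separating_def Q_def by blast
    moreover from this have "\<forall>x y. w x y = 0"
      using st nice by (simp add: nice_def stress_free_def)
    ultimately show "(\<forall>x y. w x y = 0) \<and> (\<forall>k\<in>{()}. \<phi> k = 0)" by simp
  qed (auto intro: poly_fun.intros)
  from generic_conj[OF sf this] show ?thesis
  proof (rule generic_mono, elim conjE)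
    fix \<sigma> assume sf: "stress_free V E c \<sigma>" and sep: "\<forall>q\<in>Q. \<forall>w (\<phi> :: unit \<Rightarrow> real).
      stress V E c \<sigma> w (\<lambda>x. \<Sum>k\<in>{()}. \<phi> k * D q x) (\<lambda>x. \<Sum>k\<in>{()}. \<phi> k * (\<sigma> (snd (snd q)) * D q x)) \<longrightarrow>
      (\<forall>x y. w x y = 0) \<and> (\<forall>k\<in>{()}. \<phi> k = 0)"
    have "separating V E c \<sigma>"
      unfolding separating_def
    proof (intro ballI allI impI)
      fix u v s w \<phi>
      assume "u \<in> V" "v \<in> V" "s < (7 :: nat)" "u \<noteq> v" "\<not> (E u v \<and> c u v = s)"
        and st: "stress V E c \<sigma> w (\<lambda>x. \<phi> * dipole u v x) (\<lambda>x. \<sigma> s * \<phi> * dipole u v x)"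
      then have "(u, v, s) \<in> Q" by (simp add: Q_def)
      from sep[rule_format, OF this, of w "\<lambda>_. \<phi>"] st show "\<phi> = 0"
        by (simp add: D_def mult_ac)
    qed
    with sf show "nice V E c \<sigma>" by (simp add: nice_def)
  qed
qed

text \<open>Multiply the balance equations by the coordinates of \<open>z\<close> and add up. The
  two ends of an edge contribute its weight times its line form, which is zero, so the work of the
  load has to vanish too.\<close>

lemma virtual_work:
  assumes G: "graph_on V E" "coloring E c" and uv: "u \<in> V" "v \<in> V"
    and st: "stress V E c \<sigma> w (\<lambda>x. \<phi> * dipole u v x) (\<lambda>x. m * \<phi> * dipole u v x)"
    and sol: "\<And>x y. E x y \<Longrightarrow> line_form (\<sigma> (c x y)) x y z = 0"
  shows "\<phi> * line_form m u v z = 0"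
proof -
  note fin = graph_onD(1)[OF G(1)]
  note anti = stressD(1)[OF st] and supp = stressD(2)[OF st]
  let ?T = "\<lambda>x y. w x y * (z (x, True) - \<sigma> (c x y) * z (x, False))"
  have T: "?T x y + ?T y x = 0" for x y
  proof (cases "E x y")
    case True
    then have "c y x = c x y" using G(2) by (metis coloring_def)
    then have "?T x y + ?T y x = w x y * line_form (\<sigma> (c x y)) x y z"
      by (simp add: anti[of y x] line_form_def algebra_simps)
    then show ?thesis using sol[OF True] by simp
  next
    case False
    then show ?thesis using supp[of x y] anti[of y x] by simp
  qed
  have "2 * (\<Sum>x\<in>V. \<Sum>y\<in>V. ?T x y) = (\<Sum>x\<in>V. \<Sum>y\<in>V. ?T x y) + (\<Sum>y\<in>V. \<Sum>x\<in>V. ?T x y)"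
    using sum.swap[of "\<lambda>x y. ?T x y" V V] by simp
  also have "\<dots> = (\<Sum>x\<in>V. \<Sum>y\<in>V. ?T x y + ?T y x)"
    by (simp add: sum.distrib)
  finally have "(\<Sum>x\<in>V. \<Sum>y\<in>V. ?T x y) = 0" by (simp only: T) simp
  moreover have "(\<Sum>y\<in>V. ?T x y) = \<phi> * (dipole u v x * (z (x, True) - m * z (x, False)))"
    if "x \<in> V" for x
  proof -
    have "(\<Sum>y\<in>V. ?T x y) =
        z (x, True) * (\<Sum>y\<in>V. w x y) - z (x, False) * (\<Sum>y\<in>V. \<sigma> (c x y) * w x y)"
      by (simp add: sum_distrib_left sum_distrib_right right_diff_distrib sum_subtractf mult_ac)
    then show ?thesis
      by (simp only: stressD(3,4)[OF st that]) (simp add: algebra_simps)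
  qed
  ultimately have "0 = \<phi> * (\<Sum>x\<in>V. dipole u v x * (z (x, True) - m * z (x, False)))"
    by (simp add: sum_distrib_left)
  also have "(\<Sum>x\<in>V. dipole u v x * (z (x, True) - m * z (x, False))) =
      (\<Sum>x\<in>V. of_bool (x = u) * (z (x, True) - m * z (x, False))) -
      (\<Sum>x\<in>V. of_bool (x = v) * (z (x, True) - m * z (x, False)))"
    by (simp only: dipole_def left_diff_distrib sum_subtractf)
  also have "\<dots> = line_form m u v z"
  proof -
    have pick: "(\<Sum>p\<in>V. of_bool (p = q) * h p) = h q" if "q \<in> V" for q and h :: "'a \<Rightarrow> real"
      using that fin by simp
    show ?thesis by (simp only: pick uv) (simp add: line_form_def algebra_simps)
  qed
  finally show ?thesis by simp
qed

lemma nice_by_positions: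
  assumes G: "graph_on V E" "coloring E c" and "stress_free V E c \<sigma>"
    and sol: "\<And>x y. E x y \<Longrightarrow> line_form (\<sigma> (c x y)) x y z = 0"
    and sep: "\<And>u v s. u \<in> V \<Longrightarrow> v \<in> V \<Longrightarrow> s < 7 \<Longrightarrow> u \<noteq> v \<Longrightarrow> \<not> (E u v \<and> c u v = s) \<Longrightarrow>
      line_form (\<sigma> s) u v z \<noteq> 0"
  shows "nice V E c \<sigma>"
  using assms(3) virtual_work[OF G _ _ _ sol] sep
  unfolding nice_def separating_def by (metis mult_eq_0_iff)

section \<open>Operations on graphs\<close>

text \<open>The total force between two fibres of \<open>h\<close>. Edges inside a fibre would
  become loops, hence the value 0 on the diagonal.\<close>

definition push :: "'a set \<Rightarrow> ('a \<Rightarrow> 'b) \<Rightarrow> ('a \<Rightarrow> 'a \<Rightarrow> real) \<Rightarrow> 'b \<Rightarrow> 'b \<Rightarrow> real" where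
  "push V h w a b =
     (if a = b then 0 else (\<Sum>x\<in>{x \<in> V. h x = a}. \<Sum>y\<in>{y \<in> V. h y = b}. w x y))"

text \<open>Add up the balance equations over a fibre. The edges inside the fibre cancel by
  antisymmetry, and those between fibres keep their color under \<open>h\<close>. The auxiliary fact
  \<open>key\<close> covers both equations, with the factor 1 and with the slope as factor.\<close>

lemma stress_push:
  assumes G: "graph_on V E" "coloring E c" and st: "stress V E c \<sigma> w f g"
    and V': "finite V'" "h ` V \<subseteq> V'"
    and h: "\<And>x y. E x y \<Longrightarrow> h x \<noteq> h y \<Longrightarrow> E' (h x) (h y) \<and> c' (h x) (h y) = c x y"
  shows "stress V' E' c' \<sigma> (push V h w)
    (\<lambda>a. \<Sum>x\<in>{x \<in> V. h x = a}. f x) (\<lambda>a. \<Sum>x\<in>{x \<in> V. h x = a}. g x)"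
proof -
  note fin = graph_onD(1)[OF G(1)] and anti = stressD(1)[OF st] and supp = stressD(2)[OF st]
  have key: "(\<Sum>b\<in>V'. k' a b * push V h w a b) = (\<Sum>x\<in>{x \<in> V. h x = a}. \<Sum>y\<in>V. k x y * w x y)"
    if k: "\<And>x y. E x y \<Longrightarrow> k x y = k y x" "\<And>x y. E x y \<Longrightarrow> h x \<noteq> h y \<Longrightarrow> k' (h x) (h y) = k x y"
    for k k' a
  proof -
    let ?F = "\<lambda>a. {x \<in> V. h x = a}"
    have term_eq: "k' a b * push V h w a b =
        (\<Sum>x\<in>?F a. \<Sum>y\<in>?F b. of_bool (h x \<noteq> h y) * (k x y * w x y))" for b
    proof (cases "a = b")
      case True
      then show ?thesis by (auto simp: push_def intro!: sum.neutral[symmetric])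
    next
      case False
      have "k' a b * w x y = of_bool (h x \<noteq> h y) * (k x y * w x y)"
        if "x \<in> ?F a" "y \<in> ?F b" for x y
        using that False k(2)[of x y] supp[of x y] by (cases "E x y") auto
      then have "(\<Sum>x\<in>?F a. \<Sum>y\<in>?F b. k' a b * w x y) =
          (\<Sum>x\<in>?F a. \<Sum>y\<in>?F b. of_bool (h x \<noteq> h y) * (k x y * w x y))"
        by (intro sum.cong refl)
      then show ?thesis
        using False by (simp add: push_def sum_distrib_left)
    qed
    have "(\<Sum>b\<in>V'. k' a b * push V h w a b) =
        (\<Sum>x\<in>?F a. \<Sum>b\<in>V'. \<Sum>y\<in>?F b. of_bool (h x \<noteq> h y) * (k x y * w x y))"
      unfolding term_eq by (rule sum.swap)
    also have "\<dots> = (\<Sum>x\<in>?F a. \<Sum>y\<in>V. of_bool (h x \<noteq> h y) * (k x y * w x y))"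
      by (intro sum.cong refl sum.group fin V')
    also have "\<dots> = (\<Sum>x\<in>?F a. (\<Sum>y\<in>V. k x y * w x y) - (\<Sum>y\<in>?F a. k x y * w x y))"
    proof (intro sum.cong refl)
      fix x assume x: "x \<in> ?F a"
      have "(\<Sum>y\<in>V. k x y * w x y) =
          (\<Sum>y\<in>V. of_bool (h x \<noteq> h y) * (k x y * w x y)) + (\<Sum>y\<in>V. of_bool (h y = a) * (k x y * w x y))"
        using x by (auto simp flip: sum.distrib intro!: sum.cong)
      also have "(\<Sum>y\<in>V. of_bool (h y = a) * (k x y * w x y)) = (\<Sum>y\<in>?F a. k x y * w x y)"
        using fin by (simp add: Int_def)
      finally show "(\<Sum>y\<in>V. of_bool (h x \<noteq> h y) * (k x y * w x y)) =
          (\<Sum>y\<in>V. k x y * w x y) - (\<Sum>y\<in>?F a. k x y * w x y)" by simp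
    qed
    also have "\<dots> = (\<Sum>x\<in>?F a. \<Sum>y\<in>V. k x y * w x y) - (\<Sum>x\<in>?F a. \<Sum>y\<in>?F a. k x y * w x y)"
      by (rule sum_subtractf)
    also have "(\<Sum>x\<in>?F a. \<Sum>y\<in>?F a. k x y * w x y) = 0"
    proof -
      have swap: "k x y * w x y = - (k y x * w y x)" for x y
        using k(1)[of x y] supp[of x y] anti[of x y] by (cases "E x y") auto
      have "(\<Sum>x\<in>?F a. \<Sum>y\<in>?F a. k x y * w x y) = (\<Sum>y\<in>?F a. \<Sum>x\<in>?F a. k x y * w x y)"
        by (rule sum.swap)
      also have "\<dots> = - (\<Sum>y\<in>?F a. \<Sum>x\<in>?F a. k y x * w y x)"
        by (subst swap) (simp add: sum_negf)
      finally show ?thesis by simp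
    qed
    finally show ?thesis by simp
  qed
  have flip: "push V h w a b = - push V h w b a" for a b
  proof -
    have "(\<Sum>x\<in>{x \<in> V. h x = a}. \<Sum>y\<in>{y \<in> V. h y = b}. w x y) =
        (\<Sum>y\<in>{y \<in> V. h y = b}. \<Sum>x\<in>{x \<in> V. h x = a}. w x y)"
      by (rule sum.swap)
    also have "\<dots> = - (\<Sum>y\<in>{y \<in> V. h y = b}. \<Sum>x\<in>{x \<in> V. h x = a}. w y x)"
      by (subst anti) (simp add: sum_negf)
    finally show ?thesis by (simp add: push_def)
  qed
  have off: "push V h w a b = 0" if "\<not> E' a b" for a b
    using h supp that by (auto simp: push_def intro!: sum.neutral)
  have "(\<Sum>b\<in>V'. push V h w a b) = (\<Sum>x\<in>{x \<in> V. h x = a}. f x)" for a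
    using key[of "\<lambda>x y. 1" "\<lambda>x y. 1" a] stressD(3)[OF st] by simp
  moreover have "(\<Sum>b\<in>V'. \<sigma> (c' a b) * push V h w a b) = (\<Sum>x\<in>{x \<in> V. h x = a}. g x)" for a
  proof -
    have "(\<Sum>b\<in>V'. \<sigma> (c' a b) * push V h w a b) =
        (\<Sum>x\<in>{x \<in> V. h x = a}. \<Sum>y\<in>V. \<sigma> (c x y) * w x y)"
      by (rule key) (use G(2) h in \<open>auto simp: coloring_def\<close>, metis)
    then show ?thesis using stressD(4)[OF st] by simp
  qed
  ultimately show ?thesis
    unfolding stress_def using flip off by blast
qed

lemma push_dipole:
  assumes "finite V" "u \<in> V" "v \<in> V"
  shows "(\<Sum>x\<in>{x \<in> V. h x = a}. t * dipole u v x) = t * dipole (h u) (h v) a"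
proof -
  have "(\<Sum>x\<in>{x \<in> V. h x = a}. of_bool (x = p)) = (of_bool (a = h p) :: real)" if "p \<in> V" for p
    using assms(1) that by (auto simp: of_bool_def)
  then show ?thesis
    using assms by (simp add: dipole_def sum_subtractf flip: sum_distrib_left)
qed

lemma stress_push_dipole:
  assumes G: "graph_on V E" "coloring E c" and uv: "u \<in> V" "v \<in> V"
    and st: "stress V E c \<sigma> w (\<lambda>x. \<phi> * dipole u v x) (\<lambda>x. m * \<phi> * dipole u v x)"
    and V': "finite V'" "h ` V \<subseteq> V'"
    and h: "\<And>x y. E x y \<Longrightarrow> h x \<noteq> h y \<Longrightarrow> E' (h x) (h y) \<and> c' (h x) (h y) = c x y"
  shows "stress V' E' c' \<sigma> (push V h w)
    (\<lambda>a. \<phi> * dipole (h u) (h v) a) (\<lambda>a. m * \<phi> * dipole (h u) (h v) a)"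
proof -
  have "stress V' E' c' \<sigma> (push V h w) (\<lambda>a. \<Sum>x\<in>{x \<in> V. h x = a}. \<phi> * dipole u v x)
      (\<lambda>a. \<Sum>x\<in>{x \<in> V. h x = a}. m * \<phi> * dipole u v x)"
    by (rule stress_push[OF G st V' h])
  then show ?thesis by (simp only: push_dipole[OF graph_onD(1)[OF G(1)] uv])
qed

text \<open>A single edge resists opposite forces at its ends exactly in its own direction. Taking a
  multiple of this elementary stress out of \<open>w\<close> changes the load by the same
  multiple.\<close>

lemma stress_subtract_edge:
  assumes G: "graph_on V E" "coloring E c" and uv: "E u v"
    and st: "stress V E c \<sigma> w f g"
  shows "stress V E c \<sigma> (\<lambda>x y. w x y - t * (of_bool (x = u \<and> y = v) - of_bool (x = v \<and> y = u)))
    (\<lambda>x. f x - t * dipole u v x) (\<lambda>x. g x - \<sigma> (c u v) * t * dipole u v x)"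
    (is "stress V E c \<sigma> ?w _ _")
proof -
  have vu: "E v u" "c v u = c u v" and V: "u \<in> V" "v \<in> V"
    using G uv unfolding graph_on_def coloring_def by metis+
  have pick: "(\<Sum>p\<in>V. of_bool (p = q) * k p) = k q" if "q \<in> V" for q and k :: "'a \<Rightarrow> real"
    using that graph_onD(1)[OF G(1)] by simp
  have corr: "(\<Sum>y\<in>V. k y * ?w x y) =
      (\<Sum>y\<in>V. k y * w x y) - t * (of_bool (x = u) * k v - of_bool (x = v) * k u)" for x k
  proof -
    have "(\<Sum>y\<in>V. k y * ?w x y) = (\<Sum>y\<in>V. k y * w x y) -
        t * (of_bool (x = u) * (\<Sum>y\<in>V. of_bool (y = v) * k y) - of_bool (x = v) * (\<Sum>y\<in>V. of_bool (y = u) * k y))"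
      unfolding sum_distrib_left sum_subtractf[symmetric]
      by (intro sum.cong refl) (simp add: of_bool_conj algebra_simps)
    then show ?thesis by (simp only: pick V)
  qed
  show ?thesis
    unfolding stress_def
  proof (intro conjI allI ballI impI)
    fix x y
    define a b :: real where "a = of_bool (x = u \<and> y = v)" and "b = of_bool (x = v \<and> y = u)"
    have "of_bool (y = u \<and> x = v) = b" "of_bool (y = v \<and> x = u) = a"
      by (simp_all add: a_def b_def conj_commute)
    then have "w x y - t * (a - b) = - (w y x - t * (of_bool (y = u \<and> x = v) - of_bool (y = v \<and> x = u)))"
      using stressD(1)[OF st, of x y] by (simp only:) (simp add: algebra_simps)
    then show "?w x y = - ?w y x" unfolding a_def b_def .
    show "?w x y = 0" if "\<not> E x y"
    proof -
      have "\<not> (x = u \<and> y = v)" "\<not> (x = v \<and> y = u)" using that uv(1) vu(1) by auto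
      then show ?thesis using stressD(2)[OF st that] by (simp only: of_bool_eq) simp
    qed
  next
    fix x assume x: "x \<in> V"
    show "(\<Sum>y\<in>V. ?w x y) = f x - t * dipole u v x"
      using corr[of "\<lambda>_. 1" x] stressD(3)[OF st x] by (simp add: dipole_def)
    show "(\<Sum>y\<in>V. \<sigma> (c x y) * ?w x y) = g x - \<sigma> (c u v) * t * dipole u v x"
      using corr[of "\<lambda>y. \<sigma> (c x y)" x] stressD(4)[OF st x] vu(2) graph_onD(4)[OF G(1) uv]
      by (cases "x = u"; cases "x = v") (simp_all add: dipole_def)
  qed
qed

lemma stress_absorb:
  assumes G: "graph_on V E" "coloring E c" and uv: "E u v" "c u v = s"
    and st: "stress V E c \<sigma> w (\<lambda>x. \<phi> * dipole u v x) (\<lambda>x. \<sigma> s * \<phi> * dipole u v x)"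
  shows "stress V E c \<sigma> (\<lambda>x y. w x y - \<phi> * (of_bool (x = u \<and> y = v) - of_bool (x = v \<and> y = u)))
    (\<lambda>x. 0) (\<lambda>x. 0)"
  using stress_subtract_edge[OF G uv(1) st, of \<phi>] uv(2) by simp

text \<open>Weights and loads are pushed along \<open>f\<close>. The only delicate pair is
  nonadjacent, while its image is an edge of color \<open>s\<close> that could carry the load.
  Stress-freeness then makes \<open>\<phi>\<close> the pushed weight of this edge, which is 0
  because it comes from a nonadjacent pair.\<close>

lemma good_embed:
  assumes G: "graph_on V E" and H: "graph_on V' E'" "good V' E'"
    and f: "inj_on f V" "f ` V \<subseteq> V'" "\<And>x y. E x y \<Longrightarrow> E' (f x) (f y)"
  shows "good V E"
proof -
  obtain c' where c': "coloring E' c'" "proper E' c'" "generic (nice V' E' c')"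
    using H(2) unfolding good_def by blast
  define c where "c x y = c' (f x) (f y)" for x y
  have col: "coloring E c"
    unfolding coloring_def c_def using c'(1) f(3) unfolding coloring_def by blast
  have "proper E c"
    using c'(2) f graph_onD(2,3)[OF G] unfolding proper_def c_def by (metis inj_onD)
  have pushed: "push V f w (f x) (f y) = w x y"
    if "stress V E c \<sigma> w k l" "x \<in> V" "y \<in> V" "x \<noteq> y" for w x y \<sigma> k l
  proof -
    have "{p \<in> V. f p = f q} = {q}" if "q \<in> V" for q
      using f(1) that by (auto dest: inj_onD)
    moreover have "f x \<noteq> f y"
      using f(1) that by (auto dest: inj_onD)
    ultimately show ?thesis
      using that by (simp add: push_def)
  qed
  have "nice V E c \<sigma>" if nice: "nice V' E' c' \<sigma>" for \<sigma>
    unfolding nice_def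
  proof
    note fin' = graph_onD(1)[OF H(1)]
    show "stress_free V E c \<sigma>"
      unfolding stress_free_def
    proof (intro allI impI)
      fix w x y assume st: "stress V E c \<sigma> w (\<lambda>x. 0) (\<lambda>x. 0)"
      have "stress V' E' c' \<sigma> (push V f w) (\<lambda>x. 0) (\<lambda>x. 0)"
        using stress_push[OF G col st fin' f(2), of E' c'] f(3) by (simp add: c_def)
      then have "push V f w a b = 0" for a b
        using nice by (auto simp: nice_def stress_free_def)
      then show "w x y = 0"
        using pushed[OF st, of x y] stressD(2)[OF st, of x y] graph_onD(2-4)[OF G, of x y] by (cases "E x y") auto
    qed
    show "separating V E c \<sigma>"
      unfolding separating_def
    proof (intro ballI allI impI)
      fix u v s w \<phi>
      assume uv: "u \<in> V" "v \<in> V" "s < (7 :: nat)" "u \<noteq> v" "\<not> (E u v \<and> c u v = s)"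
        and st: "stress V E c \<sigma> w (\<lambda>x. \<phi> * dipole u v x) (\<lambda>x. \<sigma> s * \<phi> * dipole u v x)"
      show "\<phi> = 0"
      proof (cases "E' (f u) (f v) \<and> c' (f u) (f v) = s")
        case False
        have "stress V' E' c' \<sigma> (push V f w) (\<lambda>x. \<phi> * dipole (f u) (f v) x)
            (\<lambda>x. \<sigma> s * \<phi> * dipole (f u) (f v) x)"
          by (rule stress_push_dipole[OF G col uv(1,2) st fin' f(2)]) (use f(3) in \<open>simp add: c_def\<close>)
        moreover have "f u \<noteq> f v" using f(1) uv by (auto dest: inj_onD)
        ultimately show ?thesis
          using nice False uv f(2) unfolding nice_def separating_def by blast
      next
        case True
        have "stress V' E' c' \<sigma> (push V f w) (\<lambda>x. \<phi> * dipole (f u) (f v) x)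
            (\<lambda>x. \<sigma> s * \<phi> * dipole (f u) (f v) x)"
          by (rule stress_push_dipole[OF G col uv(1,2) st fin' f(2)]) (use f(3) in \<open>simp add: c_def\<close>)
        from stress_absorb[OF H(1) c'(1) _ _ this]
        have "push V f w (f u) (f v) - \<phi> * (of_bool (f u = f u \<and> f v = f v) - of_bool (f u = f v \<and> f v = f u)) = 0"
          using nice True unfolding nice_def stress_free_def by blast
        moreover have "\<not> E u v" using uv(5) True by (auto simp: c_def)
        moreover have "f u \<noteq> f v" using f(1) uv by (auto dest: inj_onD)
        ultimately show ?thesis
          using pushed[OF st uv(1,2,4)] stressD(2)[OF st, of u v] by simp
      qed
    qed
  qed
  then have "generic (nice V E c)"
    using c'(3) by (rule generic_mono[rotated])
  with col \<open>proper E c\<close> show ?thesis unfolding good_def by blast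
qed

section \<open>Contraction and gluing along an edge cut\<close>

definition induced :: "('a \<Rightarrow> 'a \<Rightarrow> bool) \<Rightarrow> 'a set \<Rightarrow> 'a \<Rightarrow> 'a \<Rightarrow> bool" where
  "induced E X x y \<longleftrightarrow> E x y \<and> x \<in> X \<and> y \<in> X"

text \<open>The set \<open>X\<close> is contracted to one of its own vertices and not to a fresh
  point. The quotient thus stays on the same vertex type, over which the induction for minimal
  counterexamples ranges.\<close>

definition collapse :: "'a set \<Rightarrow> 'a \<Rightarrow> 'a \<Rightarrow> 'a" where
  "collapse X r x = (if x \<in> X then r else x)"

definition quotient_edge :: "('a \<Rightarrow> 'a \<Rightarrow> bool) \<Rightarrow> ('a \<Rightarrow> 'b) \<Rightarrow> 'b \<Rightarrow> 'b \<Rightarrow> bool" where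
  "quotient_edge E h a b \<longleftrightarrow> a \<noteq> b \<and> (\<exists>x y. E x y \<and> h x = a \<and> h y = b)"

lemma separatingD:
  assumes "separating V E c \<sigma>" "u \<in> V" "v \<in> V" "u \<noteq> v" "s < 7" "\<not> (E u v \<and> c u v = s)"
    and "stress V E c \<sigma> w (\<lambda>x. \<phi> * dipole u v x) (\<lambda>x. \<sigma> s * \<phi> * dipole u v x)"
  shows "\<phi> = 0"
  using assms unfolding separating_def by blast

lemma graph_on_induced: "graph_on V E \<Longrightarrow> X \<subseteq> V \<Longrightarrow> graph_on X (induced E X)"
  by (auto simp: graph_on_def induced_def intro: finite_subset)

lemma graph_on_quotient:
  assumes "graph_on V E" "X \<subseteq> V" "r \<in> X"
  shows "graph_on (insert r (V - X)) (quotient_edge E (collapse X r))"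
proof -
  have "collapse X r x \<in> insert r (V - X)" if "x \<in> V" for x
    using that by (simp add: collapse_def)
  moreover have "finite (insert r (V - X))" using graph_onD(1)[OF assms(1)] by simp
  ultimately show ?thesis
    using assms(1) unfolding graph_on_def quotient_edge_def by metis
qed

lemma stress_restrict:
  assumes G: "graph_on V E" and st: "stress V E c \<sigma> w f g" and X: "X \<subseteq> V"
  shows "stress X (induced E X) c \<sigma> (\<lambda>x y. if x \<in> X \<and> y \<in> X then w x y else 0)
    (\<lambda>x. f x - (\<Sum>y\<in>V - X. w x y)) (\<lambda>x. g x - (\<Sum>y\<in>V - X. \<sigma> (c x y) * w x y))"
    (is "stress _ _ _ _ ?w _ _")
  unfolding stress_def
proof (intro conjI allI ballI impI)
  fix x y
  show "?w x y = - ?w y x" using stressD(1)[OF st, of x y] by (simp only: conj_commute[of "y \<in> X"]) simp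
  show "?w x y = 0" if "\<not> induced E X x y"
    using that stressD(2)[OF st, of x y] by (auto simp: induced_def)
next
  fix x assume x: "x \<in> X"
  have split: "sum k V = sum k X + sum k (V - X)" for k :: "'a \<Rightarrow> real"
    using X graph_onD(1)[OF G] by (metis add.commute sum.subset_diff)
  show "(\<Sum>y\<in>X. ?w x y) = f x - (\<Sum>y\<in>V - X. w x y)"
    using stressD(3)[OF st, of x] X x split[of "w x"] by auto
  show "(\<Sum>y\<in>X. \<sigma> (c x y) * ?w x y) = g x - (\<Sum>y\<in>V - X. \<sigma> (c x y) * w x y)"
    using stressD(4)[OF st, of x] X x split[of "\<lambda>y. \<sigma> (c x y) * w x y"] by auto
qed

text \<open>Since an outer vertex has at most one neighbour in \<open>X\<close>, no two cut edges
  are merged by the contraction, and the pushed weights are the weights of the individual cut edges.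
  If the quotient forces them to be zero, what remains is a stress inside \<open>X\<close>. The one
  interaction of the two sides is a load between a vertex of \<open>X\<close> and an outer vertex,
  treated in \<open>mixed\<close>.\<close>

lemma nice_glue:
  assumes G: "graph_on V E" "coloring E c" "proper E c"
    and X: "X \<subseteq> V" "r \<in> X"
    and one: "\<And>x x' y. E x y \<Longrightarrow> E x' y \<Longrightarrow> x \<in> X \<Longrightarrow> x' \<in> X \<Longrightarrow> y \<notin> X \<Longrightarrow> x = x'"
    and c': "coloring (quotient_edge E (collapse X r)) c'"
      "\<And>x y. E x y \<Longrightarrow> collapse X r x \<noteq> collapse X r y \<Longrightarrow> c' (collapse X r x) (collapse X r y) = c x y"
    and outer: "nice (insert r (V - X)) (quotient_edge E (collapse X r)) c' \<sigma>"
    and inner: "nice X (induced E X) c \<sigma>"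
  shows "nice V E c \<sigma>"
proof -
  let ?h = "collapse X r" and ?V' = "insert r (V - X)" and ?E' = "quotient_edge E (collapse X r)"
  note fin = graph_onD(1)[OF G(1)]
  note G' = graph_on_quotient[OF G(1) X]
  have hV: "?h ` V \<subseteq> ?V'" by (auto simp: collapse_def)
  have hom: "?E' (?h x) (?h y) \<and> c' (?h x) (?h y) = c x y" if "E x y" "?h x \<noteq> ?h y" for x y
    using that c'(2) by (auto simp: quotient_edge_def)
  have fin': "finite ?V'" using fin by simp
  have fib: "{x \<in> V. ?h x = r} = X" "\<And>y. y \<in> V - X \<Longrightarrow> {x \<in> V. ?h x = y} = {y}"
    using X by (auto simp: collapse_def)
  have out_out: "push V ?h w x y = w x y" if "x \<in> V - X" "y \<in> V - X" "x \<noteq> y" for w x y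
    using that fib(2) by (simp add: push_def)
  have in_out: "push V ?h w r y = w x y"
    if st: "stress V E c \<sigma> w f g" and xy: "E x y" "x \<in> X" "y \<notin> X" for w f g x y
  proof -
    have y: "y \<in> V - X" using xy graph_onD(3)[OF G(1)] by auto
    have "push V ?h w r y = (\<Sum>x\<in>X. w x y)"
      using y X(2) fib by (auto simp: push_def)
    also have "\<dots> = (\<Sum>x\<in>{x}. w x y)"
    proof (rule sum.mono_neutral_right)
      show "finite X" by (rule finite_subset[OF X(1) fin])
      show "\<forall>i\<in>X - {x}. w i y = 0"
        using one[OF _ xy(1) _ xy(2,3)] stressD(2)[OF st] by blast
    qed (use xy in auto)
    finally show ?thesis by simp
  qed
  have inner_zero: "w x y = 0"
    if st: "stress V E c \<sigma> w f g" and zero: "\<And>x y. E x y \<Longrightarrow> \<not> (x \<in> X \<and> y \<in> X) \<Longrightarrow> w x y = 0"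
      and loads: "\<And>x. x \<in> X \<Longrightarrow> f x = 0 \<and> g x = 0" for w f g x y
  proof -
    have "(\<Sum>y\<in>V - X. w x y) = 0" "(\<Sum>y\<in>V - X. \<sigma> (c x y) * w x y) = 0" if "x \<in> X" for x
    proof -
      have "w x y = 0" if "y \<in> V - X" for y
        using zero[of x y] stressD(2)[OF st, of x y] that by blast
      then show "(\<Sum>y\<in>V - X. w x y) = 0" "(\<Sum>y\<in>V - X. \<sigma> (c x y) * w x y) = 0" by simp_all
    qed
    with loads have "stress X (induced E X) c \<sigma> (\<lambda>x y. if x \<in> X \<and> y \<in> X then w x y else 0) (\<lambda>x. 0) (\<lambda>x. 0)"
      by (intro stress_loads[OF stress_restrict[OF G(1) st X(1)]]) simp_all
    then have "(if x \<in> X \<and> y \<in> X then w x y else 0) = 0"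
      using inner unfolding nice_def stress_free_def by blast
    then show ?thesis using zero[of x y] stressD(2)[OF st, of x y] by (auto split: if_splits)
  qed
  have cross_zero: "w x y = 0"
    if st: "stress V E c \<sigma> w f g" and zero: "\<And>a b. push V ?h w a b = 0"
      and xy: "E x y" "\<not> (x \<in> X \<and> y \<in> X)" for w f g x y
  proof -
    note xV = graph_onD(2,3,4)[OF G(1) xy(1)]
    consider "x \<notin> X" "y \<notin> X" | "x \<in> X" "y \<notin> X" | "x \<notin> X" "y \<in> X" using xy by blast
    then show ?thesis
    proof cases
      case 1
      then show ?thesis using out_out[of x y w] zero xV by simp
    next
      case 2
      then show ?thesis using in_out[OF st xy(1)] zero by simp
    next
      case 3
      then show ?thesis
        using in_out[OF st graph_onD(5)[OF G(1) xy(1)]] zero stressD(1)[OF st, of x y] by simp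
    qed
  qed
  have sf: "stress_free V E c \<sigma>"
    unfolding stress_free_def
  proof (intro allI impI)
    fix w x y assume st: "stress V E c \<sigma> w (\<lambda>x. 0) (\<lambda>x. 0)"
    have "stress ?V' ?E' c' \<sigma> (push V ?h w) (\<lambda>x. 0) (\<lambda>x. 0)"
      using stress_push[OF G(1,2) st fin' hV hom] by simp
    then have "push V ?h w a b = 0" for a b
      using outer by (auto simp: nice_def stress_free_def)
    from inner_zero[OF st cross_zero[OF st this]] show "w x y = 0" by simp
  qed
  have mixed: "\<phi> = 0"
    if uv: "u \<in> X" "v \<in> V - X" "s < 7" "\<not> (E u v \<and> c u v = s)"
      and st: "stress V E c \<sigma> w (\<lambda>x. \<phi> * dipole u v x) (\<lambda>x. \<sigma> s * \<phi> * dipole u v x)" for u v s w \<phi>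
  proof -
    have huv: "?h u = r" "?h v = v" "u \<in> V" "v \<in> V" "r \<noteq> v"
      using uv X by (auto simp: collapse_def)
    have st': "stress ?V' ?E' c' \<sigma> (push V ?h w) (\<lambda>x. \<phi> * dipole r v x) (\<lambda>x. \<sigma> s * \<phi> * dipole r v x)"
      using stress_push_dipole[OF G(1,2) huv(3,4) st fin' hV hom] by (simp add: huv)
    show ?thesis
    proof (cases "?E' r v \<and> c' r v = s")
      case False
      then show ?thesis
        using outer st' uv huv unfolding nice_def separating_def by blast
    next
      case True
      \<comment> \<open>Here the quotient edge can carry the load. In the original graph the cut
        edge \<open>q v\<close> carries it and passes it on to \<open>X\<close> as a dipole at
        \<open>u\<close> and \<open>q\<close> of the same slope. Properness at \<open>q\<close>
        guarantees that \<open>u q\<close> is not an edge of color \<open>s\<close>, so the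
        separation inside \<open>X\<close> applies.\<close>
      then obtain x y where "E x y" "?h x = r" "?h y = v"
        unfolding quotient_edge_def by blast
      then have "E x v" "x \<in> X"
        using huv uv X graph_onD(2)[OF G(1)] by (auto simp: collapse_def split: if_splits)
      then obtain q where q: "E q v" "q \<in> X" by blast
      have cq: "c q v = s" using True c'(2)[OF q(1)] q uv huv(5) by (simp add: collapse_def)
      then have "q \<noteq> u" using uv q by auto
      define a where "a x y = (\<phi> :: real) * (of_bool (x = r \<and> y = v) - of_bool (x = v \<and> y = r))" for x y
      have "push V ?h w x y - a x y = 0" for x y
        using stress_absorb[OF G' c'(1) _ _ st'] True outer
        unfolding nice_def stress_free_def a_def by blast
      then have pa: "push V ?h w x y = a x y" for x y by simp
      have wq: "w q v = \<phi>"
        using in_out[OF st q] uv pa[of r v] huv by (simp add: a_def)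
      have zero: "w x y = 0" if xy: "E x y" "x \<in> X" "y \<notin> X" "y \<noteq> v" for x y
        using in_out[OF st xy(1-3)] pa[of r y] xy X huv by (auto simp: a_def)
      have only: "w x y = of_bool (x = q \<and> y = v) * \<phi>" if "x \<in> X" "y \<in> V - X" for x y
      proof (cases "E x y")
        case True
        then show ?thesis using zero[of x y] wq that one[OF True, of q] q by auto
      next
        case False
        then show ?thesis using stressD(2)[OF st False] q by auto
      qed
      have pick: "(\<Sum>y\<in>V - X. of_bool (y = v) * k y) = k v" for k :: "'a \<Rightarrow> real"
        using uv fin by simp
      have "(\<Sum>y\<in>V - X. k y * w x y) = of_bool (x = q) * \<phi> * k v" if x: "x \<in> X" for x and k :: "'a \<Rightarrow> real"
      proof -
        have "(\<Sum>y\<in>V - X. k y * w x y) = (\<Sum>y\<in>V - X. of_bool (y = v) * (of_bool (x = q) * \<phi> * k y))"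
          using only[OF x] by (intro sum.cong refl) (simp add: of_bool_conj)
        then show ?thesis by (simp only: pick)
      qed
      note sums = this[of _ "\<lambda>_. 1"] this
      have "stress X (induced E X) c \<sigma> (\<lambda>x y. if x \<in> X \<and> y \<in> X then w x y else 0)
          (\<lambda>x. \<phi> * dipole u q x) (\<lambda>x. \<sigma> s * \<phi> * dipole u q x)"
      proof (rule stress_loads[OF stress_restrict[OF G(1) st X(1)]])
        fix x assume x: "x \<in> X"
        then have "x \<noteq> v" using uv by auto
        show "\<phi> * dipole u v x - (\<Sum>y\<in>V - X. w x y) = \<phi> * dipole u q x"
          using sums(1)[OF x] \<open>x \<noteq> v\<close> by (simp add: dipole_def algebra_simps)
        show "\<sigma> s * \<phi> * dipole u v x - (\<Sum>y\<in>V - X. \<sigma> (c x y) * w x y) = \<sigma> s * \<phi> * dipole u q x"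
          using sums(2)[OF x, of "\<lambda>y. \<sigma> (c x y)"] \<open>x \<noteq> v\<close> cq
          by (cases "x = q") (simp_all add: dipole_def algebra_simps)
      qed
      moreover have "\<not> (induced E X u q \<and> c u q = s)"
      proof
        assume "induced E X u q \<and> c u q = s"
        then have "E q u" "c q u = s" using G graph_on_sym[OF G(1)] unfolding induced_def coloring_def by metis+
        then show False using G(3) q(1) cq uv unfolding proper_def by blast
      qed
      ultimately show ?thesis
        using inner uv q \<open>q \<noteq> u\<close> separatingD[where V = X and u = u and v = q and s = s] unfolding nice_def by blast
    qed
  qed
  have "separating V E c \<sigma>"
    unfolding separating_def
  proof (intro ballI allI impI)
    fix u v s w \<phi>
    assume uv: "u \<in> V" "v \<in> V" "s < (7 :: nat)" "u \<noteq> v" "\<not> (E u v \<and> c u v = s)"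
      and st: "stress V E c \<sigma> w (\<lambda>x. \<phi> * dipole u v x) (\<lambda>x. \<sigma> s * \<phi> * dipole u v x)"
    have st': "stress ?V' ?E' c' \<sigma> (push V ?h w) (\<lambda>x. \<phi> * dipole (?h u) (?h v) x)
        (\<lambda>x. \<sigma> s * \<phi> * dipole (?h u) (?h v) x)"
      by (rule stress_push_dipole[OF G(1,2) uv(1,2) st fin' hV hom])
    consider "u \<notin> X" "v \<notin> X" | "u \<in> X" "v \<notin> X" | "u \<notin> X" "v \<in> X" | "u \<in> X" "v \<in> X" by blast
    then show "\<phi> = 0"
    proof cases
      case 1
      then have h: "?h u = u" "?h v = v" by (auto simp: collapse_def)
      have "\<not> (?E' u v \<and> c' u v = s)"
      proof
        assume *: "?E' u v \<and> c' u v = s"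
        then have "E u v"
          using 1 X by (auto simp: quotient_edge_def collapse_def split: if_splits)
        then show False using uv c'(2)[of u v] * h by auto
      qed
      moreover have "u \<in> ?V'" "v \<in> ?V'" using uv 1 by auto
      ultimately show ?thesis
        using outer st' uv(3,4) unfolding nice_def separating_def h by blast
    next
      case 2
      then show ?thesis using mixed[OF _ _ uv(3,5) st] uv by blast
    next
      case 3
      have d: "dipole u v x = - dipole v u x" for x by (simp add: dipole_def)
      have "stress V E c \<sigma> w (\<lambda>x. - \<phi> * dipole v u x) (\<lambda>x. \<sigma> s * - \<phi> * dipole v u x)"
        using st by (simp add: d)
      moreover have "\<not> (E v u \<and> c v u = s)"
        using uv(5) G(2) graph_on_sym[OF G(1)] unfolding coloring_def by metis
      ultimately have "- \<phi> = 0" using mixed[of v u s w "- \<phi>"] 3 uv by blast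
      then show ?thesis by simp
    next
      case 4
      then have "stress ?V' ?E' c' \<sigma> (push V ?h w) (\<lambda>x. 0) (\<lambda>x. 0)"
        using st' by (simp add: collapse_def dipole_def)
      then have "push V ?h w a b = 0" for a b
        using outer by (auto simp: nice_def stress_free_def)
      note zero = cross_zero[OF st this]
      have "stress X (induced E X) c \<sigma> (\<lambda>x y. if x \<in> X \<and> y \<in> X then w x y else 0)
          (\<lambda>x. \<phi> * dipole u v x) (\<lambda>x. \<sigma> s * \<phi> * dipole u v x)"
      proof (rule stress_loads[OF stress_restrict[OF G(1) st X(1)]])
        fix x assume x: "x \<in> X"
        have "w x y = 0" if "y \<in> V - X" for y
          using zero[of x y] stressD(2)[OF st, of x y] that by auto
        then show "\<phi> * dipole u v x - (\<Sum>y\<in>V - X. w x y) = \<phi> * dipole u v x"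
          "\<sigma> s * \<phi> * dipole u v x - (\<Sum>y\<in>V - X. \<sigma> (c x y) * w x y) = \<sigma> s * \<phi> * dipole u v x"
          by simp_all
      qed
      moreover have "\<not> (induced E X u v \<and> c u v = s)" using uv by (auto simp: induced_def)
      ultimately show ?thesis
        using inner 4 uv unfolding nice_def separating_def by blast
    qed
  qed
  with sf show ?thesis by (simp add: nice_def)
qed

lemma nice_permute:
  assumes "bij \<pi>" "\<And>i. \<pi> i < 7 \<longleftrightarrow> i < (7 :: nat)" "nice V E c (\<lambda>i. \<sigma> (\<pi> i))"
  shows "nice V E (\<lambda>x y. \<pi> (c x y)) \<sigma>"
proof -
  have eq: "stress V E (\<lambda>x y. \<pi> (c x y)) \<sigma> = stress V E c (\<lambda>i. \<sigma> (\<pi> i))"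
    by (simp add: stress_def fun_eq_iff)
  have "separating V E (\<lambda>x y. \<pi> (c x y)) \<sigma>"
    unfolding separating_def eq
  proof (intro ballI allI impI)
    fix u v s w \<phi>
    assume uv: "u \<in> V" "v \<in> V" "s < (7 :: nat)" "u \<noteq> v" "\<not> (E u v \<and> \<pi> (c u v) = s)"
      and st: "stress V E c (\<lambda>i. \<sigma> (\<pi> i)) w (\<lambda>x. \<phi> * dipole u v x) (\<lambda>x. \<sigma> s * \<phi> * dipole u v x)"
    obtain t where t: "s = \<pi> t" using assms(1) by (metis bij_pointE)
    then have "t < 7" "\<not> (E u v \<and> c u v = t)" using uv assms(2) by auto
    then show "\<phi> = 0" using assms(3) uv st unfolding nice_def separating_def t by blast
  qed
  then show ?thesis using assms(3) by (simp add: nice_def stress_free_def eq)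
qed

lemma extend_to_permutation:
  fixes e d :: "'a \<Rightarrow> nat"
  assumes "finite N" "inj_on e N" "inj_on d N" "e ` N \<subseteq> {..<7}" "d ` N \<subseteq> {..<7}"
  shows "\<exists>\<pi>. bij \<pi> \<and> (\<forall>i. \<pi> i < 7 \<longleftrightarrow> i < 7) \<and> (\<forall>y\<in>N. \<pi> (e y) = d y)"
proof -
  have "card ({..<7} - e ` N) = card ({..<7} - d ` N)"
    using assms by (simp add: card_Diff_subset card_image)
  then obtain g where g: "bij_betw g ({..<7} - e ` N) ({..<7} - d ` N)"
    using finite_same_card_bij[of "{..<7} - e ` N" "{..<7} - d ` N"] by auto
  let ?k = "\<lambda>i. d (the_inv_into N e i)"
  have k: "bij_betw ?k (e ` N) (d ` N)"
    using bij_betw_trans[OF bij_betw_the_inv_into[OF inj_on_imp_bij_betw[OF assms(2)]]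
        inj_on_imp_bij_betw[OF assms(3)]] by (simp add: comp_def)
  define \<pi> where "\<pi> i = (if i \<in> e ` N then ?k i else if i < 7 then g i else i)" for i
  have "bij_betw \<pi> (e ` N) (d ` N) \<longleftrightarrow> bij_betw ?k (e ` N) (d ` N)"
    "bij_betw \<pi> ({..<7} - e ` N) ({..<7} - d ` N) \<longleftrightarrow> bij_betw g ({..<7} - e ` N) ({..<7} - d ` N)"
    by (rule bij_betw_cong; simp add: \<pi>_def)+
  then have "bij_betw \<pi> (e ` N) (d ` N)" "bij_betw \<pi> ({..<7} - e ` N) ({..<7} - d ` N)"
    using k g by blast+
  then have b7: "bij_betw \<pi> {..<7} {..<7}"
    using bij_betw_combine[of \<pi> "e ` N" "d ` N" "{..<7} - e ` N" "{..<7} - d ` N"] assms(4,5)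
    by (simp add: Un_absorb1)
  have id7: "\<pi> i = i" if "\<not> i < 7" for i
    using assms(4) that by (fastforce simp: \<pi>_def)
  have "bij_betw \<pi> {7..} {7..} \<longleftrightarrow> bij_betw id {7..} {7 :: nat..}"
    by (rule bij_betw_cong) (simp add: id7)
  then have "bij_betw \<pi> {7..} {7..}" by simp
  with b7 have "bij_betw \<pi> ({..<7} \<union> {7..}) ({..<7} \<union> {7..})"
    by (rule bij_betw_combine) auto
  moreover have "{..<7} \<union> {7..} = (UNIV :: nat set)" by auto
  ultimately have "bij \<pi>" by simp
  moreover have "\<pi> i < 7 \<longleftrightarrow> i < 7" for i
  proof (cases "i < 7")
    case True
    then show ?thesis using bij_betwE[OF b7] by auto
  next
    case False
    then show ?thesis using id7 by simp
  qed
  moreover have "\<pi> (e y) = d y" if "y \<in> N" for y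
    using that the_inv_into_f_f[OF assms(2)] by (simp add: \<pi>_def)
  ultimately show ?thesis by blast
qed

text \<open>Greedy choice: a new element has to avoid its own two forbidden colors and the at most
  \<open>card N - 1\<close> colors chosen so far.\<close>

lemma distinct_free_colors:
  assumes "finite N" "card N + 2 \<le> k" "\<And>y. y \<in> N \<Longrightarrow> finite (F y) \<and> card (F y) \<le> 2"
  shows "\<exists>e. inj_on e N \<and> (\<forall>y\<in>N. e y < (k :: nat) \<and> e y \<notin> F y)"
  using assms
proof (induction N rule: finite_induct)
  case empty
  then show ?case by simp
next
  case (insert a N)
  then obtain e where e: "inj_on e N" "\<forall>y\<in>N. e y < k \<and> e y \<notin> F y" by auto
  have Fa: "finite (F a)" "card (F a) \<le> 2" using insert.prems by auto
  have "card (F a \<union> e ` N) < k"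
    using card_Un_le[of "F a" "e ` N"] Fa(2) insert.prems(1) insert.hyps
      card_image_le[OF insert.hyps(1), of e] by simp
  then have "\<not> {..<k} \<subseteq> F a \<union> e ` N"
    using card_mono[of "F a \<union> e ` N" "{..<k}"] Fa(1) insert.hyps by auto
  then obtain t where t: "t < k" "t \<notin> F a" "t \<notin> e ` N" by auto
  have "inj_on (e(a := t)) (insert a N)"
    using e(1) t(3) insert.hyps by (auto simp: inj_on_def)
  moreover have "\<forall>y\<in>insert a N. (e(a := t)) y < k \<and> (e(a := t)) y \<notin> F y"
    using e(2) t by auto
  ultimately show ?case by blast
qed

text \<open>The two colorings have to agree on the cut edges. In the quotient these edges meet at
  \<open>r\<close> and so have distinct colors. In the inner coloring they get distinct colors that
  are free at their inner ends, and a permutation of the inner palette matches the two choices. It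
  merely permutes the slopes, so the inner part stays generically nice.\<close>

lemma good_glue:
  assumes G: "graph_on V E" and deg: "\<And>x. x \<in> V \<Longrightarrow> card {y. E x y} \<le> 3"
    and X: "X \<subseteq> V" "r \<in> X"
    and one: "\<And>x x' y. E x y \<Longrightarrow> E x' y \<Longrightarrow> x \<in> X \<Longrightarrow> x' \<in> X \<Longrightarrow> y \<notin> X \<Longrightarrow> x = x'"
    and small: "card {y \<in> V - X. \<exists>x\<in>X. E x y} \<le> 3"
    and inner: "good X (induced E X)"
    and outer: "good (insert r (V - X)) (quotient_edge E (collapse X r))"
  shows "good V E"
proof -
  let ?h = "collapse X r" and ?E' = "quotient_edge E (collapse X r)"
  note fin = graph_onD(1)[OF G]
  note G' = graph_on_quotient[OF G X]
  obtain c1 where c1: "coloring (induced E X) c1" "proper (induced E X) c1" "generic (nice X (induced E X) c1)"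
    using inner unfolding good_def by blast
  obtain c2 where c2: "coloring ?E' c2" "proper ?E' c2" "generic (nice (insert r (V - X)) ?E' c2)"
    using outer unfolding good_def by blast
  define N where "N = {y \<in> V - X. \<exists>x\<in>X. E x y}"
  define q where "q y = (SOME x. x \<in> X \<and> E x y)" for y
  have q: "q y \<in> X" "E (q y) y" if "y \<in> N" for y
  proof -
    have "\<exists>x. x \<in> X \<and> E x y" using that by (auto simp: N_def)
    from someI_ex[OF this] show "q y \<in> X" "E (q y) y" by (simp_all add: q_def)
  qed
  have q_eq: "x = q y" if "E x y" "x \<in> X" "y \<notin> X" for x y
  proof -
    have "y \<in> N" using that graph_onD(3)[OF G that(1)] unfolding N_def by blast
    then show ?thesis using one[OF that(1) q(2) that(2) q(1) that(3)] by simp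
  qed
  define F where "F y = c1 (q y) ` {z. induced E X (q y) z}" for y
  have finE: "finite {z. E x z}" for x
    by (rule finite_subset[OF _ fin]) (use graph_onD[OF G] in auto)
  have F: "finite (F y) \<and> card (F y) \<le> 2" if y: "y \<in> N" for y
  proof -
    have sub: "{z. induced E X (q y) z} \<subseteq> {z. E (q y) z} - {y}"
      using y by (auto simp: induced_def N_def)
    have "card ({z. E (q y) z} - {y}) \<le> 2"
      using deg[of "q y"] q[OF y] X finE[of "q y"] by (simp add: card_Diff_singleton subsetD)
    then have "card {z. induced E X (q y) z} \<le> 2"
      using card_mono[OF _ sub] finE[of "q y"] by simp
    moreover have "finite {z. induced E X (q y) z}"
      using sub finE[of "q y"] by (meson finite_Diff finite_subset)
    ultimately show ?thesis
      unfolding F_def using card_image_le le_trans by blast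
  qed
  have finN: "finite N" using fin by (simp add: N_def)
  \<comment> \<open>The color of the cut edge at \<open>y\<close> in terms of the inner palette. The
    inner end of that edge has at most two edges inside \<open>X\<close>, and there are at most
    three outer vertices.\<close>
  obtain e where e: "inj_on e N" "\<forall>y\<in>N. e y < 7 \<and> e y \<notin> F y"
    using distinct_free_colors[OF finN, of 7 F] small F by (auto simp: N_def)
  have rN: "?E' r y" "y \<noteq> r" if "y \<in> N" for y
  proof -
    show "y \<noteq> r" using that X by (auto simp: N_def)
    have "?h (q y) = r" "?h y = y" using that q[OF that] by (auto simp: N_def collapse_def)
    then show "?E' r y" using q[OF that] \<open>y \<noteq> r\<close> unfolding quotient_edge_def by metis
  qed
  have d: "inj_on (c2 r) N" "c2 r ` N \<subseteq> {..<7}"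
    using c2(1,2) rN unfolding proper_def coloring_def inj_on_def by blast+
  obtain \<pi> where \<pi>: "bij \<pi>" "\<And>i. \<pi> i < 7 \<longleftrightarrow> i < 7" "\<And>y. y \<in> N \<Longrightarrow> \<pi> (e y) = c2 r y"
    using extend_to_permutation[OF finN e(1) d(1) _ d(2)] e(2) by (auto simp: image_subset_iff)
  define c where "c x y = (if x \<in> X \<and> y \<in> X then \<pi> (c1 x y) else c2 (?h x) (?h y))" for x y
  have hom: "?E' (?h x) (?h y)" if "E x y" "\<not> (x \<in> X \<and> y \<in> X)" for x y
    using that graph_onD(4)[OF G that(1)] X unfolding quotient_edge_def
    by (auto simp: collapse_def)
  have col: "coloring E c"
    unfolding coloring_def
  proof (intro allI impI)
    fix x y assume xy: "E x y"
    show "c x y = c y x \<and> c x y < 7"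
    proof (cases "x \<in> X \<and> y \<in> X")
      case True
      then have "induced E X x y" using xy by (simp add: induced_def)
      then have "c1 x y = c1 y x" "c1 x y < 7" using c1(1) unfolding coloring_def by blast+
      then show ?thesis using True \<pi>(2) by (simp add: c_def)
    next
      case False
      then show ?thesis using c2(1) hom[OF xy False] by (auto simp: c_def coloring_def)
    qed
  qed
  have prp: "proper E c"
    unfolding proper_def
  proof (intro allI impI)
    fix x y z assume xy: "E x y" "E x z" "y \<noteq> z"
    have mix: "c x y \<noteq> c x z" if "x \<in> X" "y \<in> X" "z \<notin> X" "E x y" "E x z" for x y z
    proof -
      have z: "z \<in> N" using that graph_onD(3)[OF G that(5)] by (auto simp: N_def)
      have "c1 x y \<in> F z"
        unfolding F_def using q_eq[OF that(5,1,3)] that by (auto simp: induced_def)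
      then have "c1 x y \<noteq> e z" using e(2) z by auto
      then have "\<pi> (c1 x y) \<noteq> \<pi> (e z)" using \<pi>(1) by (simp add: bij_def inj_eq)
      then show ?thesis using \<pi>(3)[OF z] that by (simp add: c_def collapse_def)
    qed
    have outs: "c x y \<noteq> c x z" if "?h y \<noteq> ?h z" "\<not> (x \<in> X \<and> y \<in> X)" "\<not> (x \<in> X \<and> z \<in> X)"
      using that c2(2) hom[OF xy(1)] hom[OF xy(2)] unfolding proper_def c_def by auto
    show "c x y \<noteq> c x z"
    proof (cases "x \<in> X")
      case True
      consider "y \<in> X" "z \<in> X" | "y \<in> X" "z \<notin> X" | "y \<notin> X" "z \<in> X" | "y \<notin> X" "z \<notin> X" by blast
      then show ?thesis
      proof cases
        case 1
        then have "c1 x y \<noteq> c1 x z"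
          using c1(2) True xy unfolding proper_def induced_def by blast
        then show ?thesis using 1 True \<pi>(1) by (simp add: c_def bij_def inj_eq)
      next
        case 2
        then show ?thesis using mix True xy by blast
      next
        case 3
        then show ?thesis using mix[of x z y] True xy by metis
      next
        case 4
        then show ?thesis using outs xy(3) by (simp add: collapse_def)
      qed
    next
      case False
      have "?h y \<noteq> ?h z"
      proof
        assume "?h y = ?h z"
        then have "y \<in> X" "z \<in> X"
          using xy(3) X by (auto simp: collapse_def split: if_splits)
        then show False
          using one[of y x z] False xy graph_onD(5)[OF G] by blast
      qed
      then show ?thesis using outs False by blast
    qed
  qed
  have "generic (\<lambda>\<sigma>. nice X (induced E X) c1 (\<lambda>i. \<sigma> (\<pi> i)) \<and> nice (insert r (V - X)) ?E' c2 \<sigma>)"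
    by (intro generic_conj generic_permute[OF c1(3) \<pi>(1)] c2(3))
  then have "generic (nice V E c)"
  proof (rule generic_mono, elim conjE)
    fix \<sigma> assume n1: "nice X (induced E X) c1 (\<lambda>i. \<sigma> (\<pi> i))" and n2: "nice (insert r (V - X)) ?E' c2 \<sigma>"
    have n1': "nice X (induced E X) (\<lambda>x y. \<pi> (c1 x y)) \<sigma>"
      by (rule nice_permute[OF \<pi>(1,2) n1])
    have eq: "stress X (induced E X) (\<lambda>x y. \<pi> (c1 x y)) \<sigma> = stress X (induced E X) c \<sigma>"
      by (simp add: stress_def fun_eq_iff c_def cong: sum.cong)
    have "separating X (induced E X) c \<sigma>"
      using n1' unfolding nice_def separating_def eq induced_def by (auto simp: c_def)
    then have n3: "nice X (induced E X) c \<sigma>"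
      using n1' by (simp add: nice_def stress_free_def eq)
    show "nice V E c \<sigma>"
    proof (rule nice_glue[where X = X and r = r and c' = c2, OF G col prp X _ c2(1) _ n2 n3])
      show "x = x'" if "E x y" "E x' y" "x \<in> X" "x' \<in> X" "y \<notin> X" for x x' y
        by (rule one[OF that])
      show "c2 (?h x) (?h y) = c x y" if "?h x \<noteq> ?h y" for x y
        using that by (auto simp: c_def collapse_def)
    qed
  qed
  with col prp show ?thesis unfolding good_def by blast
qed

section \<open>Coloring around a claw\<close>

definition nb :: "('a \<Rightarrow> 'a \<Rightarrow> bool) \<Rightarrow> 'a \<Rightarrow> 'a set" where
  "nb E x = {y. E x y}"

lemma nb_iff [simp]: "y \<in> nb E x \<longleftrightarrow> E x y"
  by (simp add: nb_def)

lemma finite_nb: "graph_on V E \<Longrightarrow> finite (nb E x)"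
  by (rule finite_subset[of _ V]) (auto dest: graph_onD)

text \<open>Peel off a vertex \<open>y\<close> of degree at most two. In the rest its neighbours
  have degree at most two, so each of its edges avoids two colors at the far end and one at
  \<open>y\<close>. The third hypothesis, about unions of components, survives: if such a set of the
  smaller graph sends an edge to \<open>y\<close>, the degree of an end has dropped to at most
  two.\<close>

lemma four_coloring:
  assumes "graph_on V E" "\<And>x. x \<in> V \<Longrightarrow> card (nb E x) \<le> 3"
    and "\<And>X. X \<subseteq> V \<Longrightarrow> X \<noteq> {} \<Longrightarrow> (\<And>x y. x \<in> X \<Longrightarrow> E x y \<Longrightarrow> y \<in> X) \<Longrightarrow> \<exists>x\<in>X. card (nb E x) \<le> 2"
  shows "\<exists>c. (\<forall>x y. E x y \<longrightarrow> c x y = c y x \<and> c x y < (4 :: nat)) \<and> proper E c"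
  using assms
proof (induction "card V" arbitrary: V E)
  case 0
  then have "V = {}" by (auto dest: graph_onD)
  then have "\<not> E x y" for x y using 0 by (auto dest: graph_onD)
  then show ?case by (auto simp: proper_def)
next
  case (Suc n V E)
  note G = Suc.prems(1)
  note GD = graph_onD[OF G]
  have "V \<noteq> {}" using Suc.hyps(2) by auto
  then obtain y where y: "y \<in> V" "card (nb E y) \<le> 2"
    using Suc.prems(3)[of V] GD(3) by blast
  define V' where "V' = V - {y}"
  define E' where "E' = induced E V'"
  have sub: "nb E' x \<subseteq> nb E x" for x by (auto simp: E'_def induced_def)
  have card_sub: "card (nb E' x) \<le> card (nb E x)" for x
    by (rule card_mono[OF finite_nb[OF G] sub])
  have drop: "card (nb E' x) \<le> 2" if "x \<in> V" "E x y" for x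
  proof -
    have "nb E' x \<subseteq> nb E x - {y}" by (auto simp: E'_def induced_def V'_def)
    then have "card (nb E' x) \<le> card (nb E x - {y})"
      by (intro card_mono) (auto simp: finite_nb[OF G])
    also have "\<dots> = card (nb E x) - 1" using that finite_nb[OF G] by simp
    finally show ?thesis using Suc.prems(2)[OF that(1)] by simp
  qed
  have G': "graph_on V' E'" unfolding E'_def by (rule graph_on_induced[OF G]) (auto simp: V'_def)
  have "\<exists>c. (\<forall>x y. E' x y \<longrightarrow> c x y = c y x \<and> c x y < (4 :: nat)) \<and> proper E' c"
  proof (rule Suc.hyps(1)[OF _ G'])
    show "n = card V'" using Suc.hyps(2) y GD(1) by (simp add: V'_def)
    show "card (nb E' x) \<le> 3" if "x \<in> V'" for x
      using card_sub[of x] Suc.prems(2)[of x] that by (simp add: V'_def)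
    fix X assume X: "X \<subseteq> V'" "X \<noteq> {}" "\<And>x y. x \<in> X \<Longrightarrow> E' x y \<Longrightarrow> y \<in> X"
    show "\<exists>x\<in>X. card (nb E' x) \<le> 2"
    proof (cases "\<exists>x\<in>X. E x y")
      case True
      then show ?thesis using drop X(1) by (auto simp: V'_def)
    next
      case False
      have "\<exists>x\<in>X. card (nb E x) \<le> 2"
      proof (rule Suc.prems(3)[OF _ X(2)])
        show "X \<subseteq> V" using X(1) by (auto simp: V'_def)
        fix a b assume ab: "a \<in> X" "E a b"
        then have "b \<noteq> y" using False by auto
        then have "E' a b" using ab X(1) GD(3) by (auto simp: E'_def induced_def V'_def)
        then show "b \<in> X" using X(3) ab(1) by blast
      qed
      then show ?thesis using card_sub le_trans by blast
    qed
  qed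
  then obtain c' where c': "\<And>x y. E' x y \<Longrightarrow> c' x y = c' y x" "\<And>x y. E' x y \<Longrightarrow> c' x y < (4 :: nat)" "proper E' c'"
    by blast
  obtain e where e: "inj_on e (nb E y)" "\<forall>z\<in>nb E y. e z < 4 \<and> e z \<notin> c' z ` nb E' z"
  proof -
    have "finite (c' z ` nb E' z) \<and> card (c' z ` nb E' z) \<le> 2" if "z \<in> nb E y" for z
    proof -
      have "E z y" "z \<in> V" using that GD by auto
      then show ?thesis
        using card_image_le[OF finite_nb[OF G'], of "c' z" z] drop[of z] finite_nb[OF G', of z] by simp
    qed
    then show ?thesis
      using distinct_free_colors[OF finite_nb[OF G], of y 4 "\<lambda>z. c' z ` nb E' z"] y that by auto
  qed
  define c where "c a b = (if a = y then e b else if b = y then e a else c' a b)" for a b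
  have E'I: "E' a b" if "E a b" "a \<noteq> y" "b \<noteq> y" for a b
    using that GD by (auto simp: E'_def induced_def V'_def)
  have sym: "c a b = c b a \<and> c a b < 4" if "E a b" for a b
  proof -
    have ab: "a \<noteq> b" "E b a" using that GD by auto
    consider "a = y" | "b = y" | "a \<noteq> y" "b \<noteq> y" by blast
    then show ?thesis
    proof cases
      case 3
      then show ?thesis using c'(1,2)[OF E'I[OF that]] by (simp add: c_def)
    qed (use ab that e(2) in \<open>auto simp: c_def\<close>)
  qed
  moreover have "proper E c"
    unfolding proper_def
  proof (intro allI impI)
    fix a b d assume abd: "E a b" "E a d" "b \<noteq> d"
    have mix: "c a y \<noteq> c a d" if "E a y" "E a d" "d \<noteq> y" for a d
    proof -
      have "a \<noteq> y" "E y a" using that GD by auto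
      then have "e a \<notin> c' a ` nb E' a" using e(2) by simp
      moreover have "c' a d \<in> c' a ` nb E' a" using E'I[OF that(2) \<open>a \<noteq> y\<close> that(3)] by simp
      ultimately have "e a \<noteq> c' a d" by metis
      then show ?thesis using \<open>a \<noteq> y\<close> that by (simp add: c_def)
    qed
    show "c a b \<noteq> c a d"
    proof (cases "a = y")
      case True
      then show ?thesis using e(1) abd by (auto simp: c_def dest: inj_onD)
    next
      case False
      consider "b = y" | "d = y" | "b \<noteq> y" "d \<noteq> y" by blast
      then show ?thesis
      proof cases
        case 1
        then show ?thesis using mix[of a d] abd by simp
      next
        case 2
        then show ?thesis using mix[of a b] abd by simp
      next
        case 3
        then show ?thesis
          using c'(3) E'I[OF abd(1) False] E'I[OF abd(2) False] abd(3) False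
          unfolding proper_def c_def by simp
      qed
    qed
  qed
  ultimately show ?case by blast
qed

text \<open>The edges at \<open>x0\<close> get the colors 4, 5 and 6, the others four ordinary
  colors. Two claw colors meet only at \<open>x0\<close>, and a given claw color meets an ordinary
  one only at the leaf of its edge. Such a pair of colors at \<open>z\<close> therefore determines
  \<open>z\<close>, and giving both colors the same slope disturbs no other vertex.\<close>

lemma claw_coloring:
  assumes G: "graph_on V E" and deg: "\<And>x. x \<in> V \<Longrightarrow> card (nb E x) \<le> 3"
    and x0: "x0 \<in> V" "card (nb E x0) = 3"
    and conn: "\<And>X. X \<subseteq> V \<Longrightarrow> X \<noteq> {} \<Longrightarrow> X \<noteq> V \<Longrightarrow> \<exists>x\<in>X. \<exists>y. E x y \<and> y \<notin> X"
  shows "\<exists>c. coloring E c \<and> proper E c \<and>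
    (\<forall>z q r t a b. E z q \<and> E z r \<and> q \<noteq> r \<and> (z = x0 \<or> x0 = q \<or> x0 = r) \<and> E t a \<and> E t b \<and>
       c t a = c z q \<and> c t b = c z r \<longrightarrow> t = z)"
proof -
  note GD = graph_onD[OF G]
  define E' where "E' = induced E (V - {x0})"
  have G': "graph_on (V - {x0}) E'" unfolding E'_def by (rule graph_on_induced[OF G]) auto
  have sub: "card (nb E' x) \<le> card (nb E x)" for x
    by (rule card_mono[OF finite_nb[OF G]]) (auto simp: E'_def induced_def)
  have drop: "card (nb E' x) \<le> 2" if "x \<in> V" "E x x0" for x
  proof -
    have "card (nb E' x) \<le> card (nb E x - {x0})"
      by (rule card_mono) (auto simp: finite_nb[OF G] E'_def induced_def)
    then show ?thesis using deg[OF that(1)] that finite_nb[OF G, of x] by simp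
  qed
  have "\<exists>c. (\<forall>x y. E' x y \<longrightarrow> c x y = c y x \<and> c x y < (4 :: nat)) \<and> proper E' c"
  proof (rule four_coloring[OF G'])
    show "card (nb E' x) \<le> 3" if "x \<in> V - {x0}" for x
      using sub[of x] deg[of x] that by simp
    fix X assume X: "X \<subseteq> V - {x0}" "X \<noteq> {}" and cl: "\<And>x y. x \<in> X \<Longrightarrow> E' x y \<Longrightarrow> y \<in> X"
    obtain x y where xy: "x \<in> X" "E x y" "y \<notin> X"
      using conn[of X] X x0(1) by blast
    have "y = x0"
      using cl[OF xy(1), of y] xy X GD(3)[OF xy(2)] by (auto simp: E'_def induced_def)
    then show "\<exists>x\<in>X. card (nb E' x) \<le> 2" using drop xy X(1) by blast
  qed
  then obtain c' where c': "\<And>x y. E' x y \<Longrightarrow> c' x y = c' y x" "\<And>x y. E' x y \<Longrightarrow> c' x y < (4 :: nat)" "proper E' c'"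
    by blast
  obtain f where f: "inj_on f (nb E x0)" "\<And>y. E x0 y \<Longrightarrow> f y < (3 :: nat)"
  proof -
    obtain f where "bij_betw f (nb E x0) {0..<card (nb E x0)}"
      using ex_bij_betw_finite_nat[OF finite_nb[OF G]] by blast
    then show ?thesis using that[of f] x0(2) by (force simp: bij_betw_def)
  qed
  define c where "c a b = (if a = x0 then 4 + f b else if b = x0 then 4 + f a else c' a b)" for a b
  have E'I: "E' a b" if "E a b" "a \<noteq> x0" "b \<noteq> x0" for a b
    using that GD by (auto simp: E'_def induced_def)
  have sp: "c x0 b = 4 + f b" "c b x0 = 4 + f b" "f b < 3" "b \<noteq> x0" "E b x0" if "E x0 b" for b
    using that GD f(2) by (auto simp: c_def)
  have ord: "c a b < 4" "c a b = c b a" if "E a b" "a \<noteq> x0" "b \<noteq> x0" for a b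
    using that c'(1,2)[OF E'I[OF that]] by (simp_all add: c_def)
  have f_inj: "a = b" if "E x0 a" "E x0 b" "f a = f b" for a b
    using f(1) that by (auto dest: inj_onD)
  have col: "coloring E c"
    unfolding coloring_def
  proof (intro allI impI)
    fix a b assume ab: "E a b"
    consider "a = x0" | "b = x0" | "a \<noteq> x0" "b \<noteq> x0" by blast
    then show "c a b = c b a \<and> c a b < 7"
    proof cases
      case 1 then show ?thesis using sp(1-3)[of b] ab by simp
    next
      case 2 then show ?thesis using sp(1-3)[of a] GD(5)[OF ab] by simp
    next
      case 3 then show ?thesis using ord[OF ab] by simp
    qed
  qed
  have special: "t = x0 \<or> a = x0" if "E t a" "4 \<le> c t a" for t a
    using ord(1)[OF that(1)] that(2) by fastforce
  have prp: "proper E c"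
    unfolding proper_def
  proof (intro allI impI)
    fix a b d assume abd: "E a b" "E a d" "b \<noteq> d"
    show "c a b \<noteq> c a d"
    proof (cases "a = x0")
      case True
      then show ?thesis using sp(1) f_inj abd by auto
    next
      case False
      have sa: "c a x0 \<ge> 4" using False by (simp add: c_def)
      consider "b = x0" | "d = x0" | "b \<noteq> x0" "d \<noteq> x0" by blast
      then show ?thesis
      proof cases
        case 1
        then show ?thesis using ord(1)[OF abd(2) False] sa abd(3) by force
      next
        case 2
        then show ?thesis using ord(1)[OF abd(1) False] sa abd(3) by force
      next
        case 3
        then show ?thesis
          using c'(3) E'I[OF abd(1) False] E'I[OF abd(2) False] abd(3) False
          unfolding proper_def c_def by simp
      qed
    qed
  qed
  have "t = z" if h: "E z q" "E z r" "q \<noteq> r" "z = x0 \<or> x0 = q \<or> x0 = r" "E t a" "E t b"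
    "c t a = c z q" "c t b = c z r" for z q r t a b
  proof (cases "z = x0")
    case True
    then have big: "4 \<le> c t a" "4 \<le> c t b" using sp(1) h by auto
    show ?thesis
    proof (rule ccontr)
      assume "t \<noteq> z"
      then have "a = x0" "b = x0" using special[OF h(5) big(1)] special[OF h(6) big(2)] True by auto
      then have "c z q = c z r" using h by simp
      then show False using prp h unfolding proper_def by blast
    qed
  next
    case False
    have main: "t = z" if h: "E z x0" "E z r" "r \<noteq> x0" "E t a" "E t b" "c t a = c z x0" "c t b = c z r" for r a b
    proof (rule ccontr)
      assume ne: "t \<noteq> z"
      have small: "c t b < 4" using ord(1)[OF h(2) False h(3)] h(7) by simp
      have z: "E x0 z" using GD(5)[OF h(1)] .
      have "4 \<le> c t a" using sp(2)[OF z] h(6) by simp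
      then consider "t = x0" | "a = x0" using special[OF h(4)] by blast
      then show False
      proof cases
        case 1
        then show False using sp(1)[of b] h(5) small by simp
      next
        case 2
        then have "E x0 t" using GD(5)[OF h(4)] by simp
        then show False using sp(2)[OF z] sp(2)[of t] h(6) 2 f_inj[of t z] z ne by auto
      qed
    qed
    show ?thesis
    proof (cases "x0 = q")
      case True
      then show ?thesis using main[of r a b] h by auto
    next
      case F: False
      then have "x0 = r" using h(4) False by auto
      then show ?thesis using main[of q b a] h by auto
    qed
  qed
  then have "\<forall>z q r t a b. E z q \<and> E z r \<and> q \<noteq> r \<and> (z = x0 \<or> x0 = q \<or> x0 = r) \<and> E t a \<and> E t b \<and>
       c t a = c z q \<and> c t b = c z r \<longrightarrow> t = z"
    by blast
  with col prp show ?thesis by blast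
qed

section \<open>Highly connected graphs\<close>

text \<open>The number of edges of the cut, not of outer vertices: a vertex with two neighbours in
  \<open>X\<close> counts twice.\<close>

definition boundary :: "'a set \<Rightarrow> ('a \<Rightarrow> 'a \<Rightarrow> bool) \<Rightarrow> 'a set \<Rightarrow> nat" where
  "boundary V E X = (\<Sum>y\<in>V - X. card (nb E y \<inter> X))"

lemma boundary_swap:
  assumes "graph_on V E" "X \<subseteq> V"
  shows "boundary V E X = (\<Sum>x\<in>X. card (nb E x - X))"
proof -
  note fin = graph_onD(1)[OF assms(1)]
  have finX: "finite X" using assms fin finite_subset by auto
  have "boundary V E X = (\<Sum>y\<in>V - X. \<Sum>x\<in>X. of_bool (E y x))"
    unfolding boundary_def using finX by (intro sum.cong refl) (simp add: Int_commute nb_def)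
  also have "\<dots> = (\<Sum>x\<in>X. \<Sum>y\<in>V - X. of_bool (E y x))"
    by (rule sum.swap)
  also have "\<dots> = (\<Sum>x\<in>X. card (nb E x - X))"
  proof (intro sum.cong refl)
    fix x
    have "(V - X) \<inter> {y. E y x} = nb E x - X" using assms(1) by (auto simp: graph_on_def)
    then show "(\<Sum>y\<in>V - X. of_bool (E y x)) = card (nb E x - X)"
      using fin by simp
  qed
  finally show ?thesis .
qed

lemma boundary_compl:
  assumes "graph_on V E" "X \<subseteq> V"
  shows "boundary V E (V - X) = boundary V E X"
proof -
  have "boundary V E (V - X) = (\<Sum>x\<in>X. card (nb E x \<inter> (V - X)))"
    using assms(2) by (simp add: boundary_def double_diff)
  moreover have "nb E x \<inter> (V - X) = nb E x - X" for x
    using assms(1) by (auto simp: graph_on_def)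
  ultimately show ?thesis by (simp add: boundary_swap[OF assms])
qed

lemma boundary_insert:
  assumes G: "graph_on V E" and t: "t \<in> V - X"
  shows "boundary V E (insert t X) + card (nb E t \<inter> X) = boundary V E X + card (nb E t - X)"
proof -
  note fin = graph_onD(1)[OF G]
  let ?W = "V - insert t X"
  have VX: "V - X = insert t ?W" "t \<notin> ?W" using t by auto
  have "card (nb E y \<inter> insert t X) = card (nb E y \<inter> X) + of_bool (E y t)" if "y \<in> ?W" for y
    using t finite_nb[OF G, of y] by (cases "E y t") auto
  then have "boundary V E (insert t X) = (\<Sum>y\<in>?W. card (nb E y \<inter> X)) + (\<Sum>y\<in>?W. of_bool (E y t))"
    unfolding boundary_def by (simp add: sum.distrib)
  also have "(\<Sum>y\<in>?W. of_bool (E y t)) = card (nb E t - X)"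
  proof -
    have "?W \<inter> {y. E y t} = nb E t - X" using graph_onD(2,3,5)[OF G] graph_onD(4)[OF G, of t t] by auto
    then show ?thesis using fin by simp
  qed
  moreover have "boundary V E X = card (nb E t \<inter> X) + (\<Sum>y\<in>?W. card (nb E y \<inter> X))"
    unfolding boundary_def VX(1) using VX(2) fin by simp
  ultimately show ?thesis by simp
qed

section \<open>Paths and the spreading of zero weights\<close>

definition linked :: "('a \<Rightarrow> 'a \<Rightarrow> bool) \<Rightarrow> 'a set \<Rightarrow> 'a \<Rightarrow> 'a \<Rightarrow> bool" where
  "linked E S = (induced E S)\<^sup>*\<^sup>*"

lemma linked_refl: "linked E S x x"
  by (simp add: linked_def)

lemma linked_step: "linked E S x y \<Longrightarrow> E y z \<Longrightarrow> y \<in> S \<Longrightarrow> z \<in> S \<Longrightarrow> linked E S x z"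
  unfolding linked_def by (rule rtranclp.rtrancl_into_rtrancl) (auto simp: induced_def)

lemma linked_in: "linked E S x y \<Longrightarrow> x \<in> S \<Longrightarrow> y \<in> S"
  unfolding linked_def by (induction rule: rtranclp_induct) (auto simp: induced_def)

lemma linked_trans: "linked E S x y \<Longrightarrow> linked E S y z \<Longrightarrow> linked E S x z"
  unfolding linked_def by (rule rtranclp_trans)

lemma linked_mono: "linked E S x y \<Longrightarrow> S \<subseteq> T \<Longrightarrow> linked E T x y"
  unfolding linked_def by (erule rtranclp_mono[THEN predicate2D, rotated]) (auto simp: induced_def)

lemma linked_sym:
  assumes "graph_on V E" "linked E S x y"
  shows "linked E S y x"
proof -
  have "symp (induced E S)" using assms(1) by (auto simp: symp_def induced_def graph_on_def)
  then show ?thesis using assms(2) unfolding linked_def by (metis symp_rtranclp sympD)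
qed

text \<open>At a vertex whose edges have pairwise distinct slopes, one vanishing weight out of at
  most three forces the others to vanish, so zero weights spread along paths.\<close>

lemma zero_at_vertex:
  assumes G: "graph_on V E" and st: "stress V E c \<sigma> w f g"
    and x: "x \<in> V" "f x = 0" "g x = 0"
    and supp: "finite A" "card A \<le> 2" "\<And>y. y \<notin> A \<Longrightarrow> w x y = 0"
    and inj: "\<And>y z. y \<in> A \<Longrightarrow> z \<in> A \<Longrightarrow> y \<noteq> z \<Longrightarrow> \<sigma> (c x y) \<noteq> \<sigma> (c x z)"
    and AV: "A \<subseteq> V"
  shows "w x y = 0"
proof -
  note fin = graph_onD(1)[OF G]
  have sums: "(\<Sum>y\<in>A. w x y) = 0" "(\<Sum>y\<in>A. \<sigma> (c x y) * w x y) = 0"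
  proof -
    have "(\<Sum>y\<in>A. w x y) = (\<Sum>y\<in>V. w x y)" "(\<Sum>y\<in>A. \<sigma> (c x y) * w x y) = (\<Sum>y\<in>V. \<sigma> (c x y) * w x y)"
      by (rule sum.mono_neutral_left; use fin AV supp(3) in auto)+
    then show "(\<Sum>y\<in>A. w x y) = 0" "(\<Sum>y\<in>A. \<sigma> (c x y) * w x y) = 0"
      using stressD(3,4)[OF st x(1)] x(2,3) by simp_all
  qed
  have "w x y = 0" if "y \<in> A" for y
  proof (cases "A = {y}")
    case True
    then show ?thesis using sums(1) by simp
  next
    case False
    then obtain z where z: "z \<in> A" "z \<noteq> y"
      by (metis \<open>y \<in> A\<close> insertI1 insert_absorb singletonD subsetI subset_antisym empty_subsetI insert_subset)
    then have "{y, z} \<subseteq> A" "card {y, z} = 2" using that by auto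
    then have A: "A = {y, z}" using supp(1,2) by (metis card_subset_eq card_mono le_antisym)
    have "w x y + w x z = 0" "\<sigma> (c x y) * w x y + \<sigma> (c x z) * w x z = 0"
      using sums z(2) by (simp_all add: A)
    then have "(\<sigma> (c x y) - \<sigma> (c x z)) * w x y = 0" by (simp add: add_eq_0_iff algebra_simps)
    then show ?thesis using inj[OF that z(1)] z(2) by simp
  qed
  then show ?thesis using supp(3) by blast
qed

text \<open>Coinciding slopes are tolerated at a vertex whose weights are already known to vanish.
  This lets a path run through the one vertex at which two slopes are identified.\<close>

lemma zero_spreads:
  assumes G: "graph_on V E" and deg: "\<And>x. x \<in> V \<Longrightarrow> card (nb E x) \<le> 3"
    and st: "stress V E c \<sigma> w f g"
    and S: "S \<subseteq> V" "\<And>x. x \<in> S \<Longrightarrow> f x = 0 \<and> g x = 0"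
    and inj: "\<And>x y z. x \<in> S \<Longrightarrow> E x y \<Longrightarrow> E x z \<Longrightarrow> y \<noteq> z \<Longrightarrow> (\<forall>t. w x t = 0) \<or> \<sigma> (c x y) \<noteq> \<sigma> (c x z)"
    and link: "linked E S p q" and p: "\<forall>t. w p t = 0"
  shows "\<forall>t. w q t = 0"
  using link unfolding linked_def
proof (induction rule: rtranclp_induct)
  case base
  then show ?case by (rule p)
next
  case (step y z)
  then have yz: "E y z" "y \<in> S" "z \<in> S" by (auto simp: induced_def)
  have zy: "E z y" using graph_onD(5)[OF G yz(1)] .
  have w0: "w z y = 0" using step.IH stressD(1)[OF st, of z y] by simp
  show ?case
  proof (rule ccontr)
    assume nz: "\<not> ?case"
    have "w z t = 0" for t
    proof (rule zero_at_vertex[OF G st])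
      show "z \<in> V" "f z = 0" "g z = 0" using yz S by auto
      show "finite (nb E z - {y})" using finite_nb[OF G] by simp
      show "card (nb E z - {y}) \<le> 2" using deg[of z] yz S(1) zy finite_nb[OF G, of z] by auto
      show "w z t = 0" if "t \<notin> nb E z - {y}" for t
        using that w0 stressD(2)[OF st, of z t] by auto
      show "\<sigma> (c z a) \<noteq> \<sigma> (c z b)" if "a \<in> nb E z - {y}" "b \<in> nb E z - {y}" "a \<noteq> b" for a b
        using inj[OF yz(3), of a b] that nz by auto
      show "nb E z - {y} \<subseteq> V" using graph_onD(3)[OF G] by auto
    qed
    then show False using nz by blast
  qed
qed

text \<open>As \<open>u\<close> and \<open>v\<close> are not adjacent, every edge has an end off
  these two vertices. All weights vanish, and the balance at \<open>u\<close> then leaves no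
  load.\<close>

lemma stress_away_zero:
  assumes G: "graph_on V E" and uv: "u \<in> V" "v \<in> V" "u \<noteq> v" "\<not> E u v"
    and st: "stress V E c \<sigma> w (\<lambda>x. a * dipole u v x) (\<lambda>x. b * dipole u v x)"
    and zero: "\<And>x t. x \<in> V - {u, v} \<Longrightarrow> w x t = 0"
  shows "(\<forall>x y. w x y = 0) \<and> a = 0 \<and> b = 0"
proof -
  have wu: "w u y = 0" for y
    using zero[of y u] stressD(1)[OF st, of u y] stressD(2)[OF st, of u y] uv(4)
      graph_onD(3,4)[OF G, of u y] by (cases "y \<in> V - {u, v}") auto
  have wv: "w v y = 0" for y
    using zero[of y v] stressD(1)[OF st, of v y] stressD(2)[OF st, of v y] uv(4)
      graph_onD(3,4,5)[OF G, of v y] by (cases "y \<in> V - {u, v}") auto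
  have "w x y = 0" for x y
    using wu wv zero[of x y] stressD(2)[OF st, of x y] graph_onD(2)[OF G, of x y] by blast
  then show ?thesis
    using stressD(3,4)[OF st uv(1)] uv(3) by (simp add: dipole_def)
qed

text \<open>Taken together with the exchange of the two sides, the bounds say that only single
  vertices can be cut off by fewer than four edges. A complement of two vertices is covered by
  \<open>cut4\<close> applied to that complement, as the graph has at least seven vertices.\<close>

locale tight_graph =
  fixes V :: "'a set" and E :: "'a \<Rightarrow> 'a \<Rightarrow> bool"
  assumes G: "graph_on V E"
    and deg: "x \<in> V \<Longrightarrow> card (nb E x) \<le> 3"
    and mindeg: "x \<in> V \<Longrightarrow> 2 \<le> card (nb E x)"
    and cut2: "X \<subseteq> V \<Longrightarrow> X \<noteq> V \<Longrightarrow> 2 \<le> card X \<Longrightarrow> 2 \<le> boundary V E X"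
    and cut4: "X \<subseteq> V \<Longrightarrow> 2 \<le> card X \<Longrightarrow> 3 \<le> card (V - X) \<Longrightarrow> 4 \<le> boundary V E X"
    and large: "7 \<le> card V"
begin

lemma fin: "finite V" and E_in: "E x y \<Longrightarrow> x \<in> V" "E x y \<Longrightarrow> y \<in> V" and E_ne: "E x y \<Longrightarrow> x \<noteq> y"
  and E_sym: "E x y \<Longrightarrow> E y x"
  using graph_onD[OF G] by blast+

lemma fin_nb: "finite (nb E x)"
  by (rule finite_nb[OF G])

lemma nb_sub: "nb E x \<subseteq> V"
  using E_in by auto

text \<open>Each vertex of a triangle has at most one edge that leaves it, so a triangle would be
  cut off by three edges.\<close>

lemma triangle_free: "\<not> (E a b \<and> E b d \<and> E a d)"
proof
  assume *: "E a b \<and> E b d \<and> E a d"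
  then have ne: "a \<noteq> b" "b \<noteq> d" "a \<noteq> d" and inV: "a \<in> V" "b \<in> V" "d \<in> V"
    using E_ne E_in by auto
  let ?X = "{a, b, d}"
  have X: "?X \<subseteq> V" "card ?X = 3" using ne inV by auto
  have one: "card (nb E x - ?X) \<le> 1" if "x \<in> V" "{y, z} \<subseteq> nb E x" "y \<noteq> z" "{y, z} \<subseteq> ?X" for x y z
  proof -
    have "nb E x - ?X \<subseteq> nb E x - {y, z}" using that by auto
    then have "card (nb E x - ?X) \<le> card (nb E x - {y, z})"
      by (intro card_mono) (auto simp: fin_nb)
    also have "\<dots> = card (nb E x) - 2" using that by (subst card_Diff_subset) auto
    finally show ?thesis using deg[OF that(1)] by simp
  qed
  have "boundary V E ?X = (\<Sum>x\<in>?X. card (nb E x - ?X))"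
    by (rule boundary_swap[OF G X(1)])
  also have "\<dots> = card (nb E a - ?X) + card (nb E b - ?X) + card (nb E d - ?X)"
    using ne by simp
  also have "\<dots> \<le> 3"
    using one[OF inV(1), of b d] one[OF inV(2), of a d] one[OF inV(3), of a b] * E_sym ne by auto
  finally have "boundary V E ?X \<le> 3" .
  moreover have "4 \<le> boundary V E ?X"
  proof (rule cut4[OF X(1)])
    have "card (V - ?X) = card V - 3" using X by (simp add: card_Diff_subset del: insert_iff)
    then show "3 \<le> card (V - ?X)" using large by simp
  qed (use X in simp)
  ultimately show False by simp
qed

text \<open>If all degrees were two, the ends of an edge would be cut off by two edges.\<close>

lemma ex_cubic: "\<exists>x\<in>V. card (nb E x) = 3"
proof (rule ccontr)
  assume "\<not> ?thesis"
  then have two: "card (nb E x) = 2" if "x \<in> V" for x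
    using deg[OF that] mindeg[OF that] that by force
  have "V \<noteq> {}" using large by auto
  then obtain a where a: "a \<in> V" by blast
  then have "nb E a \<noteq> {}" using two[OF a] by auto
  then obtain b where b: "E a b" by auto
  have inV: "b \<in> V" "a \<noteq> b" using b E_in E_ne by auto
  have X: "{a, b} \<subseteq> V" "card {a, b} = 2" using a inV by auto
  have "nb E a - {a, b} \<subseteq> nb E a - {b}" "nb E b - {a, b} \<subseteq> nb E b - {a}" by auto
  then have "card (nb E a - {a, b}) \<le> card (nb E a - {b})" "card (nb E b - {a, b}) \<le> card (nb E b - {a})"
    by (auto intro!: card_mono simp: fin_nb)
  then have "card (nb E a - {a, b}) \<le> 1" "card (nb E b - {a, b}) \<le> 1"
    using two[OF a] two[OF inV(1)] b E_sym[OF b] fin_nb by (auto simp: card_Diff_singleton)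
  then have "boundary V E {a, b} \<le> 2"
    using inV(2) by (simp add: boundary_swap[OF G X(1)])
  moreover have "4 \<le> boundary V E {a, b}"
  proof (rule cut4[OF X(1)])
    have "card (V - {a, b}) = card V - 2" using X by (simp add: card_Diff_subset del: insert_iff)
    then show "3 \<le> card (V - {a, b})" using large by simp
  qed (use X in simp)
  ultimately show False by simp
qed

lemma connected: "X \<subseteq> V \<Longrightarrow> X \<noteq> {} \<Longrightarrow> X \<noteq> V \<Longrightarrow> \<exists>x\<in>X. \<exists>y. E x y \<and> y \<notin> X"
proof (rule ccontr)
  assume X: "X \<subseteq> V" "X \<noteq> {}" "X \<noteq> V" and no: "\<not> (\<exists>x\<in>X. \<exists>y. E x y \<and> y \<notin> X)"
  then obtain x where x: "x \<in> X" by blast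
  have "nb E x \<subseteq> X" using no x by auto
  then have "card (nb E x) \<le> card X"
    by (rule card_mono[rotated]) (use X fin finite_subset in auto)
  then have "2 \<le> card X" using mindeg[of x] x X by auto
  then have "2 \<le> boundary V E X" using cut2 X by blast
  moreover have "nb E x - X = {}" if "x \<in> X" for x using no that by auto
  then have "boundary V E X = 0" unfolding boundary_swap[OF G X(1)] by (intro sum.neutral ballI) (simp only: card.empty)
  ultimately show False by simp
qed

text \<open>The share of \<open>B\<close> in the edges at \<open>u\<close> and \<open>v\<close>.
  There are at most six of them, and the following arguments count how many each part of the
  remaining graph has to receive.\<close>

definition ends :: "'a \<Rightarrow> 'a \<Rightarrow> 'a set \<Rightarrow> nat" where
  "ends u v B = card (nb E u \<inter> B) + card (nb E v \<inter> B)"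

lemma ends_Un:
  assumes "A \<inter> B = {}"
  shows "ends u v (A \<union> B) = ends u v A + ends u v B"
proof -
  have "card (nb E t \<inter> (A \<union> B)) = card (nb E t \<inter> A) + card (nb E t \<inter> B)" for t
    using assms fin_nb[of t] by (subst card_Un_disjoint[symmetric]) (auto simp: Int_Un_distrib)
  then show ?thesis by (simp add: ends_def)
qed

lemma ends_le: "u \<in> V \<Longrightarrow> v \<in> V \<Longrightarrow> ends u v B \<le> 6"
  using deg[of u] deg[of v] card_mono[OF fin_nb[of u], of "nb E u \<inter> B"] card_mono[OF fin_nb[of v], of "nb E v \<inter> B"]
  unfolding ends_def by auto

lemma boundary_ends:
  assumes uv: "u \<in> V" "v \<in> V" "u \<noteq> v" and B: "B \<subseteq> V - {u, v}"
    and cl: "\<And>x y. x \<in> B \<Longrightarrow> E x y \<Longrightarrow> y \<in> B \<union> {u, v}"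
  shows "boundary V E B = ends u v B"
proof -
  have "boundary V E B = (\<Sum>y\<in>{u, v}. card (nb E y \<inter> B))"
    unfolding boundary_def
  proof (rule sum.mono_neutral_right)
    show "\<forall>y\<in>V - B - {u, v}. card (nb E y \<inter> B) = 0"
    proof
      fix y assume y: "y \<in> V - B - {u, v}"
      have "nb E y \<inter> B = {}" using cl E_sym y by fastforce
      then show "card (nb E y \<inter> B) = 0" by simp
    qed
  qed (use fin uv B in auto)
  then show ?thesis using uv(3) by (simp add: ends_def)
qed

lemma boundary_ends_insert:
  assumes uv: "u \<in> V" "v \<in> V" "u \<noteq> v" "z \<in> V - {u, v}" and B: "B \<subseteq> V - {u, v, z}"
    and cl: "\<And>x y. x \<in> B \<Longrightarrow> E x y \<Longrightarrow> y \<in> B \<union> {u, v, z}"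
  shows "boundary V E B = ends u v B + card (nb E z \<inter> B)"
proof -
  have "boundary V E B = (\<Sum>y\<in>{u, v, z}. card (nb E y \<inter> B))"
    unfolding boundary_def
  proof (rule sum.mono_neutral_right)
    show "\<forall>y\<in>V - B - {u, v, z}. card (nb E y \<inter> B) = 0"
    proof
      fix y assume y: "y \<in> V - B - {u, v, z}"
      have "nb E y \<inter> B = {}" using cl E_sym y by fastforce
      then show "card (nb E y \<inter> B) = 0" by simp
    qed
  qed (use fin uv B in auto)
  then show ?thesis using uv(3,4) by (auto simp: ends_def)
qed

text \<open>If all neighbours of a cubic vertex \<open>z\<close> are separated in \<open>G - {u, v, z}\<close>, then the few edges
  at \<open>u\<close> and \<open>v\<close> do not suffice to attach the components, unless \<open>z\<close> is adjacent to both.\<close>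

lemma separated_neighbours:
  assumes uv: "u \<in> V" "v \<in> V" "u \<noteq> v" and z: "z \<in> V - {u, v}"
    and cubic: "\<And>y. linked E (V - {u, v}) z y \<Longrightarrow> card (nb E y) = 3"
    and sep: "\<And>p q. E z p \<Longrightarrow> E z q \<Longrightarrow> p \<noteq> q \<Longrightarrow> p \<notin> {u, v} \<Longrightarrow> q \<notin> {u, v} \<Longrightarrow>
      \<not> linked E (V - {u, v, z}) p q"
  shows "E z u \<and> E z v"
proof -
  define B where "B p = {y. linked E (V - {u, v, z}) p y}" for p
  let ?P = "nb E z - {u, v}"
  have B: "B p \<subseteq> V - {u, v, z}" "p \<in> B p" "finite (B p)"
    "\<And>x y. x \<in> B p \<Longrightarrow> E x y \<Longrightarrow> y \<in> B p \<union> {u, v, z}"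
    "nb E z \<inter> B p = {p}" "\<And>y. y \<in> B p \<Longrightarrow> card (nb E y) = 3"
    "2 \<le> ends u v (B p)" "ends u v (B p) \<le> 2 \<Longrightarrow> E p u \<and> E p v"
    if p: "p \<in> ?P" for p
  proof -
    have pV: "p \<in> V - {u, v, z}" using p E_in E_ne by fastforce
    show sub: "B p \<subseteq> V - {u, v, z}" unfolding B_def using linked_in pV by fast
    show pB: "p \<in> B p" by (simp add: B_def linked_refl)
    show finB: "finite (B p)" using sub fin finite_subset by auto
    show cl: "y \<in> B p \<union> {u, v, z}" if "x \<in> B p" "E x y" for x y
      using that linked_step[of E "V - {u, v, z}" p x y] sub E_in(2)[OF that(2)] unfolding B_def by blast
    show zB: "nb E z \<inter> B p = {p}"
      using sep[of p] p pB sub unfolding B_def by auto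
    show c3: "card (nb E y) = 3" if "y \<in> B p" for y
    proof (rule cubic)
      have "linked E (V - {u, v}) z p"
        using linked_step[OF linked_refl, of E z p "V - {u, v}"] p z pV by auto
      moreover have "linked E (V - {u, v}) p y"
        using that linked_mono[of E "V - {u, v, z}" p y "V - {u, v}"] by (auto simp: B_def)
      ultimately show "linked E (V - {u, v}) z y" by (rule linked_trans)
    qed
    \<comment> \<open>The vertex \<open>z\<close> sends exactly one edge into this component, as its
      neighbours lie in different ones.\<close>
    have bd: "boundary V E (B p) = ends u v (B p) + 1"
      using boundary_ends_insert[OF uv z sub cl] zB by simp
    \<comment> \<open>With two or more vertices the component needs four edges to the outside, hence
      three at \<open>u\<close> and \<open>v\<close>. A component consisting of \<open>p\<close>
      alone has exactly two, because the cubic vertex \<open>p\<close> is joined to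
      \<open>u\<close>, \<open>v\<close> and \<open>z\<close>.\<close>
    have both: "2 \<le> ends u v (B p) \<and> (ends u v (B p) \<le> 2 \<longrightarrow> E p u \<and> E p v)"
    proof (cases "2 \<le> card (B p)")
      case True
      have "card {u, v, z} = 3" using uv z by auto
      moreover have "{u, v, z} \<subseteq> V - B p" using uv z sub by auto
      ultimately have "3 \<le> card (V - B p)" using card_mono[of "V - B p" "{u, v, z}"] fin by auto
      then have "4 \<le> boundary V E (B p)" using cut4[of "B p"] sub True by auto
      then show ?thesis using bd by simp
    next
      case False
      moreover have "card (B p) \<noteq> 0" using pB finB by auto
      ultimately have "card (B p) = 1" by simp
      then have Bp: "B p = {p}" using pB by (auto simp: card_1_singleton_iff)
      have "nb E p \<subseteq> {u, v, z}" using cl[OF pB] E_ne Bp by fastforce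
      moreover have "card (nb E p) = 3" "card {u, v, z} = 3" using c3[OF pB] uv z by auto
      ultimately have "nb E p = {u, v, z}" by (intro card_subset_eq) auto
      then have "E p u" "E p v" by auto
      then show ?thesis using E_sym Bp by (simp add: ends_def)
    qed
    then show "2 \<le> ends u v (B p)" "ends u v (B p) \<le> 2 \<Longrightarrow> E p u \<and> E p v" by auto
  qed
  have disj: "B p \<inter> B q = {}" if "p \<in> ?P" "q \<in> ?P" "p \<noteq> q" for p q
  proof (rule ccontr)
    assume "\<not> ?thesis"
    then obtain y where "linked E (V - {u, v, z}) p y" "linked E (V - {u, v, z}) q y"
      by (auto simp: B_def)
    then have "linked E (V - {u, v, z}) p q" by (meson linked_trans linked_sym[OF G])
    then show False using sep[of p q] that by auto
  qed
  have cz: "card (nb E z) = 3" by (rule cubic[OF linked_refl])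
  have ez: "ends u v {z} = of_bool (E z u) + of_bool (E z v)"
    using E_sym by (auto simp: ends_def Int_insert_right)
  have split: "card (nb E z) = card ?P + of_bool (E z u) + of_bool (E z v)"
  proof -
    have "card (nb E z) = card ?P + card (nb E z \<inter> {u, v})"
      using card_Int_Diff[OF fin_nb, of z "{u, v}"] by simp
    also have "card (nb E z \<inter> {u, v}) = of_bool (E z u) + of_bool (E z v)"
      using uv(3) by (auto simp: Int_insert_right)
    finally show ?thesis by simp
  qed
  show ?thesis
  proof (rule ccontr)
    assume no: "\<not> ?thesis"
    consider "E z u \<or> E z v" | "\<not> E z u" "\<not> E z v" by blast
    then show False
    proof cases
      case 1
      then have "card ?P = 2" "ends u v {z} = 1" using no split cz ez by auto
      then obtain p q where P: "?P = {p, q}" "p \<noteq> q" by (auto simp: card_2_iff)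
      have "ends u v ({z} \<union> (B p \<union> B q)) \<le> 6" using ends_le uv by blast
      moreover have "ends u v ({z} \<union> (B p \<union> B q)) = ends u v {z} + ends u v (B p \<union> B q)"
        using B(1)[of p] B(1)[of q] P by (intro ends_Un) blast
      moreover have "ends u v (B p \<union> B q) = ends u v (B p) + ends u v (B q)"
        using P by (intro ends_Un disj) auto
      \<comment> \<open>One of the six edges leads to \<open>z\<close>, so the two components share
        five. The one with at most two is a single vertex adjacent to \<open>u\<close> and
        \<open>v\<close>, and it closes a triangle with \<open>z\<close>.\<close>
      ultimately have "ends u v (B p) \<le> 2 \<or> ends u v (B q) \<le> 2" using \<open>ends u v {z} = 1\<close> by linarith
      then obtain t where t: "t \<in> ?P" "E t u" "E t v" using B(8)[of p] B(8)[of q] P by auto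
      then show False using triangle_free 1 E_sym by (metis DiffD1 nb_iff)
    next
      case 2
      then have "card ?P = 3" "?P = nb E z" "ends u v {z} = 0" using split cz ez by auto
      then obtain p q t where P: "?P = {p, q, t}" "p \<noteq> q" "p \<noteq> t" "q \<noteq> t"
        by (auto simp: card_3_iff)
      have mem: "p \<in> ?P" "q \<in> ?P" "t \<in> ?P" using P by auto
      have "ends u v (B p \<union> (B q \<union> B t)) \<le> 6" using ends_le uv by blast
      moreover have "ends u v (B p \<union> (B q \<union> B t)) = ends u v (B p) + ends u v (B q \<union> B t)"
        using disj[OF mem(1,2) P(2)] disj[OF mem(1,3) P(3)] by (intro ends_Un) (simp add: Int_Un_distrib)
      moreover have "ends u v (B q \<union> B t) = ends u v (B q) + ends u v (B t)"
        by (rule ends_Un[OF disj[OF mem(2,3) P(4)]])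
      ultimately have "ends u v (B p) \<le> 2" "ends u v (B q) \<le> 2" "ends u v (B t) \<le> 2"
        using B(7)[OF mem(1)] B(7)[OF mem(2)] B(7)[OF mem(3)] by linarith+
      then have all: "E p u" "E p v" "E q u" "E q v" "E t u" "E t v"
        using B(8)[OF mem(1)] B(8)[OF mem(2)] B(8)[OF mem(3)] by blast+
      \<comment> \<open>The parts \<open>z, u, v\<close> and \<open>p, q, t\<close> form a K3,3. All
        its vertices are saturated, so no edge leaves it.\<close>
      define X where "X = {z, p, q, t, u, v}"
      have PV: "{p, q, t} \<subseteq> V - {u, v, z}" using B(1,2) mem by blast
      then have "p \<noteq> u" "p \<noteq> v" "p \<noteq> z" "q \<noteq> u" "q \<noteq> v" "q \<noteq> z" "t \<noteq> u" "t \<noteq> v" "t \<noteq> z" by auto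
      then have X: "X \<subseteq> V" "card X = 6"
        using PV uv z P(2-4) by (auto simp: X_def)
      have nbX: "nb E x \<subseteq> X" if "x \<in> X" for x
      proof -
        have tr: "nb E x = {a, b, d}" if "x \<in> V" "E x a" "E x b" "E x d" "a \<noteq> b" "a \<noteq> d" "b \<noteq> d" for x a b d
        proof -
          have "card {a, b, d} = 3" using that by auto
          then have "{a, b, d} = nb E x" using deg[OF that(1)] that(2-4)
            by (intro card_seteq fin_nb) auto
          then show ?thesis by simp
        qed
        have zp: "E z p" "E z q" "E z t" using mem by auto
        have u: "nb E u = {p, q, t}" by (rule tr) (use uv all E_sym P(2-4) in auto)
        have v: "nb E v = {p, q, t}" by (rule tr) (use uv all E_sym P(2-4) in auto)
        have "nb E s = {u, v, z}" if "s \<in> {p, q, t}" for s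
          by (rule tr) (use that PV all zp E_sym uv z in auto)
        then show ?thesis using that u v \<open>?P = nb E z\<close> P(1) unfolding X_def by auto
      qed
      have "X \<noteq> V" using X(2) large by auto
      then have "2 \<le> boundary V E X" using cut2 X by auto
      moreover have "boundary V E X = 0"
      proof -
        have "nb E x - X = {}" if "x \<in> X" for x using nbX[OF that] by auto
        then show ?thesis unfolding boundary_swap[OF G X(1)] by (intro sum.neutral ballI) (simp only: card.empty)
      qed
      ultimately show False by simp
    qed
  qed
qed

text \<open>The component \<open>K\<close> of \<open>x\<close> contains a neighbour of
  \<open>x\<close> and therefore takes at least four of the at most six edges at \<open>u\<close>
  and \<open>v\<close>. At most two remain for the rest \<open>R\<close>, too few for a set of two
  or more vertices.\<close>

lemma remote_part:
  assumes uv: "u \<in> V" "v \<in> V" "u \<noteq> v" and x: "x \<in> V - {u, v}"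
    and cubic: "\<And>y. linked E (V - {u, v}) x y \<Longrightarrow> card (nb E y) = 3"
    and y: "y \<in> V - {u, v}" "\<not> linked E (V - {u, v}) x y"
  shows "nb E y = {u, v}"
proof -
  let ?S = "V - {u, v}"
  define K where "K = {y. linked E ?S x y}"
  define R where "R = ?S - K"
  have K: "K \<subseteq> ?S" "x \<in> K" "finite K"
  proof -
    show "K \<subseteq> ?S" unfolding K_def using linked_in x by fast
    then show "finite K" using fin finite_subset by auto
    show "x \<in> K" by (simp add: K_def linked_refl)
  qed
  have clK: "b \<in> K \<union> {u, v}" if "a \<in> K" "E a b" for a b
    using that linked_step[of E ?S x a b] K(1) E_in(2)[OF that(2)] unfolding K_def by blast
  have clR: "b \<in> R \<union> {u, v}" if "a \<in> R" "E a b" for a b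
    using that clK[of b a] E_sym[OF that(2)] E_in(2)[OF that(2)] by (auto simp: R_def)
  have yR: "y \<in> R" using y by (simp add: R_def K_def)
  have finR: "finite R" using fin by (simp add: R_def)
  have "card (nb E x) = 3" by (rule cubic[OF linked_refl])
  moreover have "card {u, v} = 2" using uv by simp
  ultimately have "\<not> nb E x \<subseteq> {u, v}" using card_mono[of "{u, v}" "nb E x"] by auto
  then obtain x' where x': "E x x'" "x' \<notin> {u, v}" by (metis nb_iff subsetI)
  then have "{x, x'} \<subseteq> K" "x \<noteq> x'" using clK[OF K(2)] K(2) E_ne by auto
  then have K2: "2 \<le> card K" using card_mono[OF K(3), of "{x, x'}"] by simp
  have bK: "boundary V E K = ends u v K" by (rule boundary_ends[OF uv K(1) clK])
  have bR: "boundary V E R = ends u v R"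
    by (rule boundary_ends[OF uv _ clR]) (auto simp: R_def)
  have three: "card {u, v, y} = 3" using uv y by auto
  have "{u, v, y} \<subseteq> V - K" using uv y K(1) by (auto simp: K_def)
  then have "3 \<le> card (V - K)" using card_mono[of "V - K" "{u, v, y}"] three fin by simp
  then have "4 \<le> ends u v K" using cut4[of K] K(1) K2 bK by auto
  moreover have "ends u v (K \<union> R) = ends u v K + ends u v R"
    by (rule ends_Un) (auto simp: R_def)
  ultimately have R2: "ends u v R \<le> 2" using ends_le[OF uv(1,2), of "K \<union> R"] by simp
  have "card R < 2"
  proof (rule ccontr)
    assume R: "\<not> card R < 2"
    have "card {u, v, x} = 3" "{u, v, x} \<subseteq> V - R" using uv x K by (auto simp: R_def)
    then have "3 \<le> card (V - R)" using card_mono[of "V - R" "{u, v, x}"] fin by simp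
    then have "4 \<le> boundary V E R" using cut4[of R] R by (auto simp: R_def)
    then show False using R2 bR by simp
  qed
  moreover have "card R \<noteq> 0" using yR finR by auto
  ultimately have "card R = 1" by simp
  then have R: "R = {y}" using yR by (auto simp: card_1_singleton_iff)
  have "nb E y \<subseteq> {u, v}" using clR[OF yR] R E_ne by fastforce
  then show ?thesis using mindeg[of y] y(1) \<open>card {u, v} = 2\<close> by (intro card_seteq) auto
qed

text \<open>Otherwise every claw vertex off \<open>u\<close> and \<open>v\<close> is adjacent to
  both of them, by \<open>separated_neighbours\<close> in the component of \<open>x\<close> and by
  \<open>remote_part\<close> elsewhere. If the centre is off \<open>u\<close> and \<open>v\<close>,
  it lies in a triangle with a neighbour. If it is one of them, it has the same neighbours as the
  other, which gives a K2,3 with too few edges leaving it.\<close>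

lemma claw_meets_cycle:
  assumes x0: "x0 \<in> V" "card (nb E x0) = 3"
    and uv: "u \<in> V" "v \<in> V" "u \<noteq> v" and x: "x \<in> V - {u, v}"
    and cubic: "\<And>y. linked E (V - {u, v}) x y \<Longrightarrow> card (nb E y) = 3"
  shows "\<exists>z p q. z \<in> insert x0 (nb E x0) \<and> z \<in> V - {u, v} \<and> linked E (V - {u, v}) x z \<and>
    E z p \<and> E z q \<and> p \<noteq> q \<and> p \<notin> {u, v} \<and> q \<notin> {u, v} \<and> linked E (V - {u, v, z}) p q"
proof (rule ccontr)
  assume no: "\<not> ?thesis"
  have adj: "E z u \<and> E z v" if z: "z \<in> insert x0 (nb E x0)" "z \<in> V - {u, v}" for z
  proof (cases "linked E (V - {u, v}) x z")
    case True
    show ?thesis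
    proof (rule separated_neighbours[OF uv z(2)])
      show "card (nb E y) = 3" if "linked E (V - {u, v}) z y" for y
        by (rule cubic[OF linked_trans[OF True that]])
    qed (use no z True in blast)
  next
    case False
    then have "nb E z = {u, v}"
      using remote_part[OF uv x _ z(2)] cubic by blast
    then show ?thesis by auto
  qed
  have nbV: "y \<in> V" if "E x0 y" for y using that E_in by blast
  show False
  proof (cases "x0 \<in> {u, v}")
    case False
    then have x0': "x0 \<in> V - {u, v}" using x0 by simp
    have "\<not> nb E x0 \<subseteq> {u, v}" using card_mono[of "{u, v}" "nb E x0"] x0(2) uv by auto
    then obtain y where y: "E x0 y" "y \<notin> {u, v}" by (metis nb_iff subsetI)
    then show False
      using adj[of y] adj[OF _ x0'] nbV triangle_free E_sym by (metis DiffI insertCI nb_iff)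
  next
    case True
    then obtain t where t: "{u, v} = {x0, t}" "t \<noteq> x0" "t \<in> V" using uv by auto
    have adjt: "E y t" if "E x0 y" "y \<noteq> t" for y
    proof -
      have "y \<in> V - {u, v}" unfolding t(1) using that nbV E_ne by auto
      then have "E y u \<and> E y v" using adj[of y] that by auto
      then show ?thesis using t(1) by (metis insert_iff singletonD)
    qed
    have ntx: "\<not> E x0 t"
    proof
      assume E: "E x0 t"
      have "\<not> nb E x0 \<subseteq> {t}" using card_mono[of "{t}" "nb E x0"] x0(2) by auto
      then obtain y where "E x0 y" "y \<noteq> t" by (metis nb_iff singletonI subsetI)
      then show False using adjt E triangle_free E_sym by blast
    qed
    have "nb E x0 \<subseteq> nb E t"
    proof
      fix y assume "y \<in> nb E x0"
      then have "E y t" using adjt[of y] ntx by (cases "y = t") auto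
      then show "y \<in> nb E t" using E_sym by simp
    qed
    then have nbt: "nb E t = nb E x0"
      using card_seteq[OF fin_nb, of "nb E x0" t] deg[OF t(3)] x0(2) by auto
    \<comment> \<open>A K2,3 in which \<open>x0\<close> and \<open>t\<close> are saturated. Each of
      the three other vertices has at most one edge to the outside.\<close>
    define X where "X = {x0, t} \<union> nb E x0"
    have XV: "X \<subseteq> V" using x0 t nb_sub by (auto simp: X_def)
    have finX: "finite X" using XV fin finite_subset by auto
    have cX: "card X = 5"
    proof -
      have "{x0, t} \<inter> nb E x0 = {}" using ntx E_ne by auto
      then show ?thesis unfolding X_def using t(2) x0(2) fin_nb by (subst card_Un_disjoint) auto
    qed
    have one: "card (nb E y - X) \<le> 1" if "E x0 y" for y
    proof -
      have "E y x0" "E y t" using that nbt E_sym by (auto simp: nb_def set_eq_iff)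
      then have "card (nb E y - {x0, t}) \<le> 1"
        using deg[OF nbV[OF that]] t(2) by (subst card_Diff_subset) auto
      moreover have "card (nb E y - X) \<le> card (nb E y - {x0, t})"
        by (rule card_mono) (auto simp: fin_nb X_def)
      ultimately show ?thesis by simp
    qed
    have "boundary V E X = (\<Sum>y\<in>X. card (nb E y - X))"
      by (rule boundary_swap[OF G XV])
    also have "\<dots> = (\<Sum>y\<in>nb E x0. card (nb E y - X))"
    proof (rule sum.mono_neutral_right[OF finX])
      show "\<forall>i\<in>X - nb E x0. card (nb E i - X) = 0"
        using nbt by (auto simp: X_def)
    qed (auto simp: X_def)
    also have "\<dots> \<le> (\<Sum>y\<in>nb E x0. 1)" by (rule sum_mono) (use one in auto)
    finally have "boundary V E X \<le> 3" using x0(2) by simp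
    \<comment> \<open>For a graph with seven vertices the complement of \<open>X\<close> has only
      two, so \<open>cut4\<close> is applied with the sides exchanged.\<close>
    then have "boundary V E (V - X) \<le> 3" by (simp add: boundary_compl[OF G XV])
    moreover have "4 \<le> boundary V E (V - X)"
    proof (rule cut4)
      show "2 \<le> card (V - X)" using large cX XV finX by (simp add: card_Diff_subset)
      show "3 \<le> card (V - (V - X))" using cX XV by (simp add: double_diff)
    qed simp
    ultimately show False by simp
  qed
qed

end

section \<open>Loose pairs\<close>

definition delete_edge :: "('a \<Rightarrow> 'a \<Rightarrow> bool) \<Rightarrow> 'a \<Rightarrow> 'a \<Rightarrow> 'a \<Rightarrow> 'a \<Rightarrow> bool" where
  "delete_edge E u v x y \<longleftrightarrow> E x y \<and> \<not> (x = u \<and> y = v) \<and> \<not> (x = v \<and> y = u)"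

lemma graph_on_delete_edge: "graph_on V E \<Longrightarrow> graph_on V (delete_edge E u v)"
  by (auto simp: graph_on_def delete_edge_def)

text \<open>The graph without \<open>uv\<close> resists no pair of opposite forces at \<open>u\<close> and \<open>v\<close>.\<close>

definition loose_pair where
  "loose_pair V E c \<sigma> u v \<longleftrightarrow> (\<forall>w a b. stress V (delete_edge E u v) c \<sigma> w (\<lambda>x. a * dipole u v x) (\<lambda>x. b * dipole u v x) \<longrightarrow>
     (\<forall>x y. w x y = 0) \<and> a = 0 \<and> b = 0)"

lemma generic_loose_pair:
  assumes G: "graph_on V E" and loose: "loose_pair V E c \<sigma>\<^sub>0 u v"
  shows "generic (\<lambda>\<sigma>. loose_pair V E c \<sigma> u v)"
proof -
  let ?F = "\<lambda>k x (\<sigma> :: nat \<Rightarrow> real). if k then dipole u v x else 0"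
  let ?H = "\<lambda>k x (\<sigma> :: nat \<Rightarrow> real). if k then 0 else dipole u v x"
  have "generic (\<lambda>\<sigma>. \<forall>w \<phi>. stress V (delete_edge E u v) c \<sigma> w
      (\<lambda>x. \<Sum>k\<in>UNIV. \<phi> k * ?F k x \<sigma>) (\<lambda>x. \<Sum>k\<in>UNIV. \<phi> k * ?H k x \<sigma>) \<longrightarrow>
      (\<forall>x y. w x y = 0) \<and> (\<forall>k\<in>UNIV. \<phi> k = 0))"
  proof (rule generic_stress_kernel[OF graph_on_delete_edge[OF G]])
    show "poly_fun (?F k x)" "poly_fun (?H k x)" for k x by (auto intro: poly_fun.const)
    fix w \<phi>
    assume "stress V (delete_edge E u v) c \<sigma>\<^sub>0 w
      (\<lambda>x. \<Sum>k\<in>UNIV. \<phi> k * ?F k x \<sigma>\<^sub>0) (\<lambda>x. \<Sum>k\<in>UNIV. \<phi> k * ?H k x \<sigma>\<^sub>0)"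
    then show "(\<forall>x y. w x y = 0) \<and> (\<forall>k\<in>UNIV. \<phi> k = 0)"
      using loose unfolding loose_pair_def by (simp add: UNIV_bool)
  qed simp
  then show ?thesis
  proof (rule generic_mono)
    fix \<sigma> assume *: "\<forall>w \<phi>. stress V (delete_edge E u v) c \<sigma> w
      (\<lambda>x. \<Sum>k\<in>UNIV. \<phi> k * ?F k x \<sigma>) (\<lambda>x. \<Sum>k\<in>UNIV. \<phi> k * ?H k x \<sigma>) \<longrightarrow>
      (\<forall>x y. w x y = 0) \<and> (\<forall>k\<in>UNIV. \<phi> k = 0)"
    show "loose_pair V E c \<sigma> u v"
      unfolding loose_pair_def
    proof (intro allI impI)
      fix w a b assume "stress V (delete_edge E u v) c \<sigma> w (\<lambda>x. a * dipole u v x) (\<lambda>x. b * dipole u v x)"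
      then show "(\<forall>x y. w x y = 0) \<and> a = 0 \<and> b = 0"
        using *[rule_format, of w "\<lambda>k. if k then a else b"] by (auto simp: UNIV_bool)
    qed
  qed
qed

text \<open>Take out of a stress the part that the edge \<open>u v\<close> carries; looseness kills
  the remainder. The load at \<open>u\<close> and \<open>v\<close> is thus exactly what this edge
  carries, so it has the direction of its slope, and slopes of different colors are distinct.
  Stress-freeness is the case of zero load at an arbitrary pair.\<close>

lemma nice_if_loose:
  assumes G: "graph_on V E" "coloring E c" and two: "2 \<le> card V"
    and inj: "inj_on \<sigma> {..<7}"
    and loose: "\<And>u v. u \<in> V \<Longrightarrow> v \<in> V \<Longrightarrow> u \<noteq> v \<Longrightarrow> loose_pair V E c \<sigma> u v"
  shows "nice V E c \<sigma>"
proof -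
  have key: "(\<forall>x y. w x y = t * (of_bool (x = u \<and> y = v) - of_bool (x = v \<and> y = u))) \<and>
      a = t \<and> b = \<sigma> (c u v) * t \<and> (\<not> E u v \<longrightarrow> t = 0)"
    if uv: "u \<in> V" "v \<in> V" "u \<noteq> v"
      and st: "stress V E c \<sigma> w (\<lambda>x. a * dipole u v x) (\<lambda>x. b * dipole u v x)" and t: "t = w u v"
    for u v w a b t
  proof (cases "E u v")
    case True
    let ?w = "\<lambda>x y. w x y - t * (of_bool (x = u \<and> y = v) - of_bool (x = v \<and> y = u))"
    have "stress V E c \<sigma> ?w (\<lambda>x. (a - t) * dipole u v x) (\<lambda>x. (b - \<sigma> (c u v) * t) * dipole u v x)"
      using stress_subtract_edge[OF G True st, of t] by (simp add: left_diff_distrib)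
    moreover have "?w x y = 0" if nd: "\<not> delete_edge E u v x y" for x y
    proof (cases "E x y")
      case True
      then consider "x = u" "y = v" | "x = v" "y = u" using nd by (auto simp: delete_edge_def)
      then show ?thesis
        by cases (use uv t stressD(1)[OF st, of v u] in auto)
    next
      case False
      then show ?thesis using stressD(2)[OF calculation False] by simp
    qed
    ultimately have "stress V (delete_edge E u v) c \<sigma> ?w (\<lambda>x. (a - t) * dipole u v x)
        (\<lambda>x. (b - \<sigma> (c u v) * t) * dipole u v x)"
      unfolding stress_def by blast
    then have "(\<forall>x y. ?w x y = 0) \<and> a - t = 0 \<and> b - \<sigma> (c u v) * t = 0"
      using loose[OF uv] unfolding loose_pair_def by blast
    then show ?thesis using True by simp
  next
    case False
    have t0: "t = 0" using stressD(2)[OF st False] t by simp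
    have "delete_edge E u v = E"
      using False graph_on_sym[OF G(1)] by (auto simp: delete_edge_def fun_eq_iff)
    then have "(\<forall>x y. w x y = 0) \<and> a = 0 \<and> b = 0"
      using loose[OF uv] st unfolding loose_pair_def by metis
    then show ?thesis using t0 by simp
  qed
  have "stress_free V E c \<sigma>"
    unfolding stress_free_def
  proof (intro allI impI)
    fix w x y assume st: "stress V E c \<sigma> w (\<lambda>x. 0) (\<lambda>x. 0)"
    obtain u where u: "u \<in> V" using two by fastforce
    have "\<not> V \<subseteq> {u}" using two card_mono[of "{u}" V] by auto
    then obtain v where v: "v \<in> V" "u \<noteq> v" by auto
    have *: "stress V E c \<sigma> w (\<lambda>x. 0 * dipole u v x) (\<lambda>x. 0 * dipole u v x)" using st by simp
    from key[OF u v(1,2) * refl] have "0 = w u v"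
      "\<And>x y. w x y = w u v * (of_bool (x = u \<and> y = v) - of_bool (x = v \<and> y = u))" by blast+
    then show "w x y = 0" by (metis mult_zero_left)
  qed
  moreover have "separating V E c \<sigma>"
    unfolding separating_def
  proof (intro ballI allI impI)
    fix u v s w \<phi>
    assume uv: "u \<in> V" "v \<in> V" "s < (7 :: nat)" "u \<noteq> v" "\<not> (E u v \<and> c u v = s)"
      and st: "stress V E c \<sigma> w (\<lambda>x. \<phi> * dipole u v x) (\<lambda>x. \<sigma> s * \<phi> * dipole u v x)"
    from key[OF uv(1,2,4) st refl] have k: "\<phi> = w u v" "\<sigma> s * \<phi> = \<sigma> (c u v) * w u v" "\<not> E u v \<longrightarrow> w u v = 0"
      by blast+
    show "\<phi> = 0"
    proof (cases "E u v")
      case True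
      then have "c u v < 7" "c u v \<noteq> s" using G(2) uv unfolding coloring_def by auto
      then have "\<sigma> s \<noteq> \<sigma> (c u v)" using inj uv(3) by (auto dest: inj_onD)
      then show ?thesis using k(1,2) by (metis mult_cancel_right)
    qed (use k(1,3) in simp)
  qed
  ultimately show ?thesis by (simp add: nice_def)
qed

context tight_graph
begin

text \<open>The slopes may depend on \<open>u\<close> and \<open>v\<close> and may coincide, because
  \<open>generic_loose_pair\<close> turns each witness into a generic condition before the pairs are
  combined.\<close>

lemma loose_pair_exists:
  assumes x0: "x0 \<in> V" "card (nb E x0) = 3"
    and col: "coloring E c" "proper E c"
    and priv: "\<And>z q r t a b. E z q \<Longrightarrow> E z r \<Longrightarrow> q \<noteq> r \<Longrightarrow> z = x0 \<or> x0 = q \<or> x0 = r \<Longrightarrow> E t a \<Longrightarrow> E t b \<Longrightarrow>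
       c t a = c z q \<Longrightarrow> c t b = c z r \<Longrightarrow> t = z"
    and uv: "u \<in> V" "v \<in> V" "u \<noteq> v"
  shows "\<exists>\<sigma>. loose_pair V E c \<sigma> u v"
proof -
  let ?S = "V - {u, v}" and ?D = "delete_edge E u v"
  have GD: "graph_on V ?D" by (rule graph_on_delete_edge[OF G])
  have D_iff: "?D x y \<longleftrightarrow> E x y" if "x \<in> ?S" for x y
    using that by (auto simp: delete_edge_def)
  have nbD: "nb ?D x = nb E x" if "x \<in> ?S" for x
    using D_iff[OF that] by (simp add: nb_def)
  have degD: "card (nb ?D x) \<le> 3" if "x \<in> V" for x
    by (rule order.trans[OF card_mono[OF fin_nb] deg[OF that]]) (auto simp: delete_edge_def)
  have link_iff: "linked ?D T = linked E T" if "T \<subseteq> ?S" for T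
  proof -
    have "induced ?D T = induced E T"
      using that D_iff by (auto simp: induced_def fun_eq_iff)
    then show ?thesis by (simp add: linked_def)
  qed
  have loads: "a * dipole u v x = 0" if "x \<in> ?S" for a x
    using that by (simp add: dipole_def)
  have cu: "c x y \<noteq> c x z" if "E x y" "E x z" "y \<noteq> z" for x y z
    using col(2) that unfolding proper_def by blast
  have small_zero: "w y t = 0"
    if st: "stress V ?D c \<sigma> w (\<lambda>x. a * dipole u v x) (\<lambda>x. b * dipole u v x)"
      and y: "y \<in> ?S" "card (nb E y) \<le> 2"
      and inj: "\<And>p q. E y p \<Longrightarrow> E y q \<Longrightarrow> p \<noteq> q \<Longrightarrow> \<sigma> (c y p) \<noteq> \<sigma> (c y q)"
    for \<sigma> w a b y t
  proof (rule zero_at_vertex[OF GD st])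
    show "y \<in> V" "a * dipole u v y = 0" "b * dipole u v y = 0" using y loads by auto
    show "finite (nb E y)" "card (nb E y) \<le> 2" "nb E y \<subseteq> V" using fin_nb y nb_sub by auto
    show "w y t = 0" if "t \<notin> nb E y" for t
      using stressD(2)[OF st, of y t] D_iff[OF y(1)] that by simp
    show "\<sigma> (c y p) \<noteq> \<sigma> (c y q)" if "p \<in> nb E y" "q \<in> nb E y" "p \<noteq> q" for p q
      using inj that by simp
  qed
  have finish: "loose_pair V E c \<sigma> u v"
    if "\<And>w a b x t. stress V ?D c \<sigma> w (\<lambda>x. a * dipole u v x) (\<lambda>x. b * dipole u v x) \<Longrightarrow> x \<in> ?S \<Longrightarrow> w x t = 0" for \<sigma>
    unfolding loose_pair_def
  proof (intro allI impI)
    fix w a b assume st: "stress V ?D c \<sigma> w (\<lambda>x. a * dipole u v x) (\<lambda>x. b * dipole u v x)"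
    show "(\<forall>x y. w x y = 0) \<and> a = 0 \<and> b = 0"
      by (rule stress_away_zero[OF GD uv _ st that[OF st]]) (simp add: delete_edge_def)
  qed
  show ?thesis
  \<comment> \<open>If every component of the graph without \<open>u\<close> and \<open>v\<close>
    has a vertex of degree at most two, distinct slopes suffice: the weights at such a vertex are
    zero, and the zero reaches the whole component.\<close>
  proof (cases "\<forall>x\<in>?S. \<exists>y. linked E ?S x y \<and> card (nb E y) \<noteq> 3")
    case True
    have inj: "real (c x y) \<noteq> real (c x z)" if "E x y" "E x z" "y \<noteq> z" for x y z
      using cu that by simp
    have "loose_pair V E c real u v"
    proof (rule finish)
      fix w a b x t
      assume st: "stress V ?D c real w (\<lambda>x. a * dipole u v x) (\<lambda>x. b * dipole u v x)" and x: "x \<in> ?S"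
      obtain y where y: "linked E ?S x y" "card (nb E y) \<noteq> 3" using True x by blast
      have yS: "y \<in> ?S" using linked_in[OF y(1) x] .
      have "card (nb E y) \<le> 2" using deg[of y] yS y(2) by auto
      then have y0: "\<forall>t. w y t = 0" using small_zero[OF st yS] inj by blast
      have yx: "linked ?D ?S y x" using linked_sym[OF G y(1)] link_iff by simp
      have "\<forall>t. w x t = 0"
      proof (rule zero_spreads[OF GD degD st _ _ _ yx y0])
        show "a * dipole u v x = 0 \<and> b * dipole u v x = 0" if "x \<in> ?S" for x using loads that by simp
        show "(\<forall>t. w x t = 0) \<or> real (c x y) \<noteq> real (c x z)" if "?D x y" "?D x z" "y \<noteq> z" for x y z
          using inj that by (auto simp: delete_edge_def)
      qed auto
      then show "w x t = 0" by blast
    qed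
    then show ?thesis by blast
  next
    case False
    then obtain x where x: "x \<in> ?S" "\<And>y. linked E ?S x y \<Longrightarrow> card (nb E y) = 3" by blast
    obtain z p' q' where z: "z \<in> insert x0 (nb E x0)" "z \<in> ?S" "linked E ?S x z"
      and pq': "E z p'" "E z q'" "p' \<noteq> q'" "p' \<notin> {u, v}" "q' \<notin> {u, v}" "linked E (V - {u, v, z}) p' q'"
    proof -
      have "\<exists>z p q. z \<in> insert x0 (nb E x0) \<and> z \<in> ?S \<and> linked E ?S x z \<and>
          E z p \<and> E z q \<and> p \<noteq> q \<and> p \<notin> {u, v} \<and> q \<notin> {u, v} \<and> linked E (V - {u, v, z}) p q"
        by (rule claw_meets_cycle[OF x0 uv x(1)]) (rule x(2))
      then show ?thesis by (elim exE conjE) (rule that)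
    qed
    have cz: "card (nb E z) = 3" by (rule x(2)[OF z(3)])
    \<comment> \<open>The neighbours of \<open>z\<close> are named such that \<open>p\<close> and
      \<open>q\<close> lie on the cycle and \<open>priv\<close> applies to the pair
      \<open>q\<close>, \<open>r\<close>. This needs a claw edge among \<open>z q\<close> and
      \<open>z r\<close>, for which \<open>p'\<close> and \<open>q'\<close> may have to be
      exchanged.\<close>
    have "\<exists>p q r. nb E z = {p, q, r} \<and> p \<noteq> q \<and> p \<noteq> r \<and> q \<noteq> r \<and> p \<notin> {u, v} \<and> q \<notin> {u, v} \<and>
      linked E (V - {u, v, z}) p q \<and> (z = x0 \<or> x0 = q \<or> x0 = r)"
    proof -
      have "card (nb E z - {p', q'}) = 1"
        using cz pq' by (subst card_Diff_subset) auto
      then obtain r where r: "nb E z - {p', q'} = {r}" by (auto simp: card_1_singleton_iff)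
      have "{p', q'} \<subseteq> nb E z" using pq' by simp
      then have "nb E z = {p', q'} \<union> (nb E z - {p', q'})" by blast
      then have nbz: "nb E z = {p', q', r}" unfolding r by (simp add: insert_commute)
      have "r \<in> nb E z - {p', q'}" unfolding r by simp
      then have rne: "p' \<noteq> r" "q' \<noteq> r" by auto
      have x0z: "z = x0 \<or> x0 \<in> {p', q', r}"
        using z(1) E_sym unfolding nbz[symmetric] by auto
      show ?thesis
      proof (cases "x0 = p'")
        case True
        have "linked E (V - {u, v, z}) q' p'" by (rule linked_sym[OF G pq'(6)])
        moreover have "nb E z = {q', p', r}" unfolding nbz by (rule insert_commute)
        ultimately show ?thesis using rne pq' True by metis
      next
        case False
        then have "z = x0 \<or> x0 = q' \<or> x0 = r" using x0z by blast
        then show ?thesis using nbz rne pq' by metis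
      qed
    qed
    then obtain p q r where nbz: "nb E z = {p, q, r}" and ne: "p \<noteq> q" "p \<noteq> r" "q \<noteq> r"
      and pq: "p \<notin> {u, v}" "q \<notin> {u, v}" "linked E (V - {u, v, z}) p q"
      and sp: "z = x0 \<or> x0 = q \<or> x0 = r" by blast
    have Ez: "E z t \<longleftrightarrow> t \<in> {p, q, r}" for t
      using nb_iff[of t E z] unfolding nbz by blast
    have E: "E z p" "E z q" "E z r" by (simp_all add: Ez)
    \<comment> \<open>The colors of \<open>z q\<close> and \<open>z r\<close> get the same slope. By
      \<open>priv\<close> they meet at no vertex other than \<open>z\<close>, so the slopes at all
      other vertices stay distinct.\<close>
    define \<sigma> where "\<sigma> i = (if i = c z q then real (c z r) else real i)" for i
    have inj: "\<sigma> (c t a) \<noteq> \<sigma> (c t b)" if "E t a" "E t b" "a \<noteq> b" "t \<noteq> z" for t a b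
    proof
      assume eq: "\<sigma> (c t a) = \<sigma> (c t b)"
      have "c t a \<noteq> c t b" by (rule cu[OF that(1-3)])
      then have "c t a = c z q \<and> c t b = c z r \<or> c t b = c z q \<and> c t a = c z r"
        using eq by (auto simp: \<sigma>_def split: if_splits)
      then show False
        using priv[OF E(2,3) ne(3) sp that(1,2)] priv[OF E(2,3) ne(3) sp that(2,1)] that(4) by blast
    qed
    have zS: "z \<in> V" "z \<in> ?S" using z by auto
    have "loose_pair V E c \<sigma> u v"
    proof (rule finish)
      fix w a b y t
      assume st: "stress V ?D c \<sigma> w (\<lambda>x. a * dipole u v x) (\<lambda>x. b * dipole u v x)" and y: "y \<in> ?S"
      have sums: "w z p + w z q + w z r = 0" "\<sigma> (c z p) * w z p + \<sigma> (c z q) * w z q + \<sigma> (c z r) * w z r = 0"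
      proof -
        have supp: "w z y = 0" if "y \<notin> {p, q, r}" for y
          using stressD(2)[OF st, of z y] D_iff[OF zS(2)] that Ez[of y] by blast
        have "(\<Sum>y\<in>{p, q, r}. w z y) = (\<Sum>y\<in>V. w z y)"
          "(\<Sum>y\<in>{p, q, r}. \<sigma> (c z y) * w z y) = (\<Sum>y\<in>V. \<sigma> (c z y) * w z y)"
          by (rule sum.mono_neutral_left; use fin E E_in supp in auto)+
        then have "(\<Sum>y\<in>{p, q, r}. w z y) = 0" "(\<Sum>y\<in>{p, q, r}. \<sigma> (c z y) * w z y) = 0"
          using stressD(3,4)[OF st zS(1)] loads[OF zS(2)] by simp_all
        then show "w z p + w z q + w z r = 0" "\<sigma> (c z p) * w z p + \<sigma> (c z q) * w z q + \<sigma> (c z r) * w z r = 0"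
          using ne by (simp_all add: add.assoc)
      qed
      have \<sigma>z: "\<sigma> (c z q) = real (c z r)" "\<sigma> (c z r) = real (c z r)" "\<sigma> (c z p) = real (c z p)"
        using cu[OF E(1,2) ne(1)] by (auto simp: \<sigma>_def)
      \<comment> \<open>The edges \<open>z q\<close> and \<open>z r\<close> act like one edge. Only
        two different slopes remain at \<open>z\<close>, so \<open>z p\<close> carries
        nothing.\<close>
      have "real (c z p) * w z p + real (c z r) * (w z q + w z r) = 0"
        using sums(2) unfolding \<sigma>z by (simp add: distrib_left)
      moreover have "w z q + w z r = - w z p" using sums(1) by simp
      ultimately have "(real (c z p) - real (c z r)) * w z p = 0" by (simp add: left_diff_distrib)
      then have wzp: "w z p = 0" using cu[OF E(1,3) ne(2)] by simp
      have pS: "p \<in> ?S" and qS: "q \<in> ?S" using pq E E_in by auto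
      have "w p t = 0" for t
      proof (rule zero_at_vertex[OF GD st])
        show "p \<in> V" "a * dipole u v p = 0" "b * dipole u v p = 0" using pS loads by auto
        have "z \<in> nb E p" using E_sym[OF E(1)] by simp
        then show "card (nb E p - {z}) \<le> 2" using deg[of p] pS fin_nb[of p] by auto
        show "finite (nb E p - {z})" "nb E p - {z} \<subseteq> V" using fin_nb nb_sub by auto
        show "w p t = 0" if "t \<notin> nb E p - {z}" for t
          using that stressD(2)[OF st, of p t] D_iff[OF pS] wzp stressD(1)[OF st, of p z] by auto
        show "\<sigma> (c p a) \<noteq> \<sigma> (c p b)" if "a \<in> nb E p - {z}" "b \<in> nb E p - {z}" "a \<noteq> b" for a b
          using inj[of p a b] that E_ne[OF E(1)] by auto
      qed
      then have p0: "\<forall>t. w p t = 0" by blast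
      \<comment> \<open>The zero travels from \<open>p\<close> to \<open>q\<close> along the rest of
        the cycle, which avoids \<open>z\<close>, the only vertex at which slopes may coincide. It
        comes back to \<open>z\<close> through the edge \<open>z q\<close>.\<close>
      have q0: "\<forall>t. w q t = 0"
      proof (rule zero_spreads[OF GD degD st _ _ _ _ p0])
        show "linked ?D (V - {u, v, z}) p q" by (subst link_iff) (use pq(3) in auto)
        show "a * dipole u v x = 0 \<and> b * dipole u v x = 0" if "x \<in> V - {u, v, z}" for x
          using loads[of x] that by auto
        show "(\<forall>t. w x t = 0) \<or> \<sigma> (c x y) \<noteq> \<sigma> (c x s)" if "x \<in> V - {u, v, z}" "?D x y" "?D x s" "y \<noteq> s" for x y s
          using inj[of x y s] that by (auto simp: delete_edge_def)
        show "V - {u, v, z} \<subseteq> V" by blast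
      qed
      have "w z q = 0" using q0 stressD(1)[OF st, of z q] by simp
      then have wz3: "w z p = 0" "w z q = 0" "w z r = 0" using wzp sums(1) by auto
      have z0: "\<forall>t. w z t = 0"
      proof
        fix t
        show "w z t = 0"
          using wz3 Ez[of t] stressD(2)[OF st, of z t] D_iff[OF zS(2), of t] by (cases "E z t") auto
      qed
      show "w y t = 0"
      proof (cases "linked E ?S x y")
        case True
        have "linked E ?S z y" using linked_trans[OF linked_sym[OF G z(3)] True] .
        then have zy: "linked ?D ?S z y" using link_iff by simp
        have "\<forall>t. w y t = 0"
        proof (rule zero_spreads[OF GD degD st _ _ _ zy z0])
          show "a * dipole u v x = 0 \<and> b * dipole u v x = 0" if "x \<in> ?S" for x using loads that by simp
          show "(\<forall>t. w x t = 0) \<or> \<sigma> (c x y) \<noteq> \<sigma> (c x s)" if "?D x y" "?D x s" "y \<noteq> s" for x y s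
            using inj[of x y s] that z0 by (cases "x = z") (auto simp: delete_edge_def)
        qed auto
        then show ?thesis by blast
      next
        case False
        \<comment> \<open>Outside the component of \<open>x\<close> every vertex off
          \<open>u\<close> and \<open>v\<close> has only these two neighbours, and two edges of
          distinct slopes carry nothing at an unloaded vertex.\<close>
        have "nb E y = {u, v}" using remote_part[OF uv x(1) _ y False] x(2) by blast
        moreover have "y \<noteq> z" using False z(3) by auto
        ultimately show ?thesis
          using small_zero[OF st y] inj[of y] uv(3) by simp
      qed
    qed
    then show ?thesis by blast
  qed
qed

lemma tight_good: "good V E"
proof -
  obtain x0 where x0: "x0 \<in> V" "card (nb E x0) = 3" using ex_cubic by blast
  obtain c where c: "coloring E c" "proper E c"
    and priv: "\<And>z q r t a b. E z q \<Longrightarrow> E z r \<Longrightarrow> q \<noteq> r \<Longrightarrow> z = x0 \<or> x0 = q \<or> x0 = r \<Longrightarrow> E t a \<Longrightarrow> E t b \<Longrightarrow>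
       c t a = c z q \<Longrightarrow> c t b = c z r \<Longrightarrow> t = z"
  proof -
    have "\<exists>c. coloring E c \<and> proper E c \<and>
      (\<forall>z q r t a b. E z q \<and> E z r \<and> q \<noteq> r \<and> (z = x0 \<or> x0 = q \<or> x0 = r) \<and> E t a \<and> E t b \<and>
         c t a = c z q \<and> c t b = c z r \<longrightarrow> t = z)"
      by (rule claw_coloring[OF G _ x0]) (use deg connected in auto)
    then show ?thesis using that by blast
  qed
  let ?P = "{p \<in> V \<times> V. fst p \<noteq> snd p}"
  have "generic (\<lambda>\<sigma>. \<forall>p\<in>?P. loose_pair V E c \<sigma> (fst p) (snd p))"
  proof (rule generic_ball)
    show "finite ?P" using fin by simp
    fix p assume p: "p \<in> ?P"
    have "\<exists>\<sigma>. loose_pair V E c \<sigma> (fst p) (snd p)"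
    proof (rule loose_pair_exists[OF x0 c])
      show "t = z" if "E z q" "E z r" "q \<noteq> r" "z = x0 \<or> x0 = q \<or> x0 = r" "E t a" "E t b"
        "c t a = c z q" "c t b = c z r" for z q r t a b
        by (rule priv[OF that])
    qed (use p in auto)
    then obtain \<sigma> where "loose_pair V E c \<sigma> (fst p) (snd p)" ..
    then show "generic (\<lambda>\<sigma>. loose_pair V E c \<sigma> (fst p) (snd p))"
      by (rule generic_loose_pair[OF G])
  qed
  from generic_conj[OF generic_inj_on[of "{..<7}"] this]
  have "generic (nice V E c)"
  proof (rule generic_mono)
    fix \<sigma> assume "inj_on \<sigma> {..<7} \<and> (\<forall>p\<in>?P. loose_pair V E c \<sigma> (fst p) (snd p))"
    then show "nice V E c \<sigma>"
      using large by (intro nice_if_loose[OF G c(1)]) simp_all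
  qed simp
  then show ?thesis unfolding good_def by (intro exI[of _ c] conjI c)
qed

end

section \<open>Graphs with at most six vertices\<close>

text \<open>Release the edge \<open>u v\<close> and treat its weight as a load at its ends. The
  motion \<open>z\<close> does work on this load and on nothing else, so the weight is zero by
  \<open>virtual_work\<close>.\<close>

lemma stress_free_by_flexes:
  assumes G: "graph_on V E" "coloring E c"
    and flex: "\<And>u v. E u v \<Longrightarrow> \<exists>z. line_form (\<sigma> (c u v)) u v z \<noteq> 0 \<and>
      (\<forall>x y. delete_edge E u v x y \<longrightarrow> line_form (\<sigma> (c x y)) x y z = 0)"
  shows "stress_free V E c \<sigma>"
  unfolding stress_free_def
proof (intro allI impI)
  fix w u v assume st: "stress V E c \<sigma> w (\<lambda>x. 0) (\<lambda>x. 0)"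
  show "w u v = 0"
  proof (cases "E u v")
    case True
    let ?w = "\<lambda>x y. w x y - w u v * (of_bool (x = u \<and> y = v) - of_bool (x = v \<and> y = u))"
    have uv: "u \<in> V" "v \<in> V" "u \<noteq> v" using graph_onD[OF G(1)] True by blast+
    have st': "stress V E c \<sigma> ?w (\<lambda>x. - w u v * dipole u v x) (\<lambda>x. \<sigma> (c u v) * - w u v * dipole u v x)"
      using stress_subtract_edge[OF G True st, of "w u v"] by simp
    have "?w x y = 0" if nd: "\<not> delete_edge E u v x y" for x y
    proof (cases "E x y")
      case True
      then consider "x = u" "y = v" | "x = v" "y = u" using nd by (auto simp: delete_edge_def)
      then show ?thesis
        by cases (use uv stressD(1)[OF st, of v u] in simp_all)
    next
      case False
      then show ?thesis using stressD(2)[OF st' False] by simp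
    qed
    then have "stress V (delete_edge E u v) c \<sigma> ?w (\<lambda>x. - w u v * dipole u v x) (\<lambda>x. \<sigma> (c u v) * - w u v * dipole u v x)"
      using st' unfolding stress_def by blast
    moreover have "coloring (delete_edge E u v) c"
      using G(2) unfolding coloring_def delete_edge_def by blast
    moreover obtain z where z: "line_form (\<sigma> (c u v)) u v z \<noteq> 0"
      "\<And>x y. delete_edge E u v x y \<Longrightarrow> line_form (\<sigma> (c x y)) x y z = 0"
      using flex[OF True] by blast
    ultimately have "- w u v * line_form (\<sigma> (c u v)) u v z = 0"
      using virtual_work[OF graph_on_delete_edge[OF G(1)] _ uv(1,2)] by blast
    then show ?thesis using z(1) by simp
  qed (use stressD(2)[OF st] in blast)
qed

section \<open>Certificates for small graphs\<close>

definition table_edge :: "((nat \<times> nat) \<times> nat) list \<Rightarrow> nat \<Rightarrow> nat \<Rightarrow> bool" where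
  "table_edge L x y \<longleftrightarrow> map_of L (x, y) \<noteq> None \<or> map_of L (y, x) \<noteq> None"

definition table_color :: "((nat \<times> nat) \<times> nat) list \<Rightarrow> nat \<Rightarrow> nat \<Rightarrow> nat" where
  "table_color L x y = (case map_of L (x, y) of Some k \<Rightarrow> k | None \<Rightarrow>
     (case map_of L (y, x) of Some k \<Rightarrow> k | None \<Rightarrow> 0))"

text \<open>Integer counterpart of \<open>line_form\<close>, with points listed as pairs of abscissa
  and ordinate, so that tables can be checked by evaluation.\<close>

definition int_form :: "int \<Rightarrow> nat \<Rightarrow> nat \<Rightarrow> (int \<times> int) list \<Rightarrow> int" where
  "int_form m x y P = (snd (P ! x) - snd (P ! y)) - m * (fst (P ! x) - fst (P ! y))"

text \<open>Color \<open>k\<close> has slope \<open>k - 3\<close>. The points \<open>P\<close> realize the graph; each list in \<open>Q\<close> is a motion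
  that respects the slopes of all edges but one, so that this edge carries no stress.\<close>

definition check_table :: "nat \<Rightarrow> ((nat \<times> nat) \<times> nat) list \<Rightarrow> (int \<times> int) list \<Rightarrow> (int \<times> int) list list \<Rightarrow> bool" where
  "check_table n L P Q \<longleftrightarrow>
     list_all (\<lambda>((x, y), k). x < n \<and> y < n \<and> x \<noteq> y \<and> k < 7) L \<and>
     list_all (\<lambda>x. list_all (\<lambda>y. table_edge L x y \<longrightarrow>
       table_color L x y = table_color L y x \<and>
       list_all (\<lambda>z. table_edge L x z \<longrightarrow> y \<noteq> z \<longrightarrow> table_color L x y \<noteq> table_color L x z) [0..<n]) [0..<n]) [0..<n] \<and>
     list_all (\<lambda>x. list_all (\<lambda>y. x \<noteq> y \<longrightarrow>
       list_all (\<lambda>s. (int_form (int s - 3) x y P = 0) = (table_edge L x y \<and> table_color L x y = s)) [0..<7]) [0..<n]) [0..<n] \<and>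
     length Q = length L \<and>
     list_all (\<lambda>(((x, y), k), R). int_form (int k - 3) x y R \<noteq> 0 \<and>
       list_all (\<lambda>((x', y'), k'). (x' = x \<and> y' = y) \<or> int_form (int k' - 3) x' y' R = 0) L) (zip L Q)"

lemma good_by_table:
  assumes "check_table n L P Q"
  shows "good {..<n} (table_edge L)"
proof -
  let ?E = "table_edge L" and ?c = "table_color L"
  define \<sigma> where "\<sigma> k = real k - 3" for k
  define pos where "pos R j = real_of_int (if snd j then snd (R ! fst j) else fst (R ! fst j))"
    for R :: "(int \<times> int) list" and j :: "nat \<times> bool"
  have form: "line_form (\<sigma> k) x y (pos R) = real_of_int (int_form (int k - 3) x y R)" for k x y R
    by (simp add: line_form_def int_form_def pos_def \<sigma>_def)
  have flip: "line_form m x y z = - line_form m y x z" for m :: real and x y :: nat and z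
    by (simp add: line_form_def algebra_simps)
  note c = assms[unfolded check_table_def list_all_iff]
  note c1 = conjunct1[OF c] and c2 = conjunct1[OF conjunct2[OF c]]
    and c3 = conjunct1[OF conjunct2[OF conjunct2[OF c]]]
    and len = conjunct1[OF conjunct2[OF conjunct2[OF conjunct2[OF c]]]]
    and c5 = conjunct2[OF conjunct2[OF conjunct2[OF conjunct2[OF c]]]]
  have L: "x < n \<and> y < n \<and> x \<noteq> y \<and> k < 7" if "((x, y), k) \<in> set L" for x y k
    using bspec[OF c1 that] by simp
  have sym_prop: "?c x y = ?c y x \<and> (\<forall>z<n. ?E x z \<longrightarrow> y \<noteq> z \<longrightarrow> ?c x y \<noteq> ?c x z)"
    if "x < n" "y < n" "?E x y" for x y
    using bspec[OF bspec[OF c2], of x y] that by (metis atLeastLessThan_iff set_upt zero_le)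
  have P: "(int_form (int s - 3) x y P = 0) = (?E x y \<and> ?c x y = s)"
    if "x < n" "y < n" "x \<noteq> y" "s < 7" for x y s
    using bspec[OF bspec[OF c3], of x y] that by simp
  have Q: "int_form (int k - 3) x y R \<noteq> 0 \<and>
        (\<forall>((x', y'), k')\<in>set L. (x' = x \<and> y' = y) \<or> int_form (int k' - 3) x' y' R = 0)"
    if "(((x, y), k), R) \<in> set (zip L Q)" for x y k R
    using bspec[OF c5 that] by simp
  have E_cases: "((x, y), ?c x y) \<in> set L \<or> map_of L (x, y) = None \<and> ((y, x), ?c x y) \<in> set L" if "?E x y" for x y
    using that unfolding table_edge_def table_color_def
    by (auto split: option.splits dest: map_of_SomeD)
  have E_n: "x < n \<and> y < n \<and> x \<noteq> y \<and> ?c x y < 7" if "?E x y" for x y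
    using E_cases[OF that] L by blast
  have E_sym: "?E y x" if "?E x y" for x y
    using that by (auto simp: table_edge_def)
  have G: "graph_on {..<n} ?E"
    using E_n E_sym by (auto simp: graph_on_def)
  have col: "coloring ?E ?c"
    unfolding coloring_def using sym_prop E_n by blast
  have prp: "proper ?E ?c"
    unfolding proper_def using sym_prop E_n by blast
  have "stress_free {..<n} ?E ?c \<sigma>"
  proof (rule stress_free_by_flexes[OF G col])
    fix u v assume uv: "?E u v"
    have main: "\<exists>z. line_form (\<sigma> k) u v z \<noteq> 0 \<and>
        (\<forall>x y. delete_edge ?E u v x y \<longrightarrow> line_form (\<sigma> (?c x y)) x y z = 0)"
      if mem: "((u, v), k) \<in> set L" for u v k
    proof -
      obtain i where i: "i < length L" "L ! i = ((u, v), k)"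
        using mem by (auto simp: in_set_conv_nth)
      then have "(((u, v), k), Q ! i) \<in> set (zip L Q)"
        using len by (force simp: in_set_zip)
      note q = Q[OF this]
      have off: "line_form (\<sigma> k') x y (pos (Q ! i)) = 0" if "((x, y), k') \<in> set L" "\<not> (x = u \<and> y = v)" for x y k'
        using q that by (auto simp: form)
      have "line_form (\<sigma> (?c x y)) x y (pos (Q ! i)) = 0" if xy: "delete_edge ?E u v x y" for x y
      proof -
        have "?E x y" "\<not> (x = u \<and> y = v)" "\<not> (y = u \<and> x = v)" using xy by (auto simp: delete_edge_def)
        then show ?thesis
          using E_cases[of x y] off[of x y] off[of y x] flip[of _ x y] by auto
      qed
      moreover have "line_form (\<sigma> k) u v (pos (Q ! i)) \<noteq> 0" using q by (simp add: form)
      ultimately show ?thesis by blast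
    qed
    show "\<exists>z. line_form (\<sigma> (?c u v)) u v z \<noteq> 0 \<and>
        (\<forall>x y. delete_edge ?E u v x y \<longrightarrow> line_form (\<sigma> (?c x y)) x y z = 0)"
    proof (cases "((u, v), ?c u v) \<in> set L")
      case True
      then show ?thesis by (rule main)
    next
      case False
      then have "((v, u), ?c u v) \<in> set L" using E_cases[OF uv] by blast
      moreover have "delete_edge ?E v u = delete_edge ?E u v" by (auto simp: delete_edge_def fun_eq_iff)
      ultimately obtain z where "line_form (\<sigma> (?c u v)) v u z \<noteq> 0"
        "\<forall>x y. delete_edge ?E u v x y \<longrightarrow> line_form (\<sigma> (?c x y)) x y z = 0"
        using main[of v u "?c u v"] by auto
      then show ?thesis using flip[of _ u v z] by (metis neg_equal_0_iff_equal)
    qed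
  qed
  then have "nice {..<n} ?E ?c \<sigma>"
  proof (rule nice_by_positions[OF G col])
    show "line_form (\<sigma> (?c x y)) x y (pos P) = 0" if "?E x y" for x y
      using P[of x y "?c x y"] E_n[OF that] that by (simp add: form)
    show "line_form (\<sigma> s) u v (pos P) \<noteq> 0"
      if "u \<in> {..<n}" "v \<in> {..<n}" "s < 7" "u \<noteq> v" "\<not> (?E u v \<and> ?c u v = s)" for u v s
      using P[of u v s] that by (simp add: form)
  qed
  then have "generic (nice {..<n} ?E ?c)" by (rule nice_generic[OF G])
  then show ?thesis using col prp unfolding good_def by blast
qed

definition diamond_edges :: "((nat \<times> nat) \<times> nat) list" where
  "diamond_edges = [((0, 1), 1), ((0, 2), 4), ((0, 3), 3), ((1, 2), 3), ((1, 3), 5)]"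

lemma diamond_good: "good {..<4} (table_edge diamond_edges)"
proof (rule good_by_table)
  \<comment> \<open>The motions come in the order of \<open>diamond_edges\<close>, with which
    \<open>check_table\<close> zips them. Translations allow vertex 0 to stay at the origin, here
    and in the other tables.\<close>
  show "check_table 4 diamond_edges
    [(0, 0), (-1, 2), (2, 2), (-2, 0)]
    [[(0, 0), (-1, 0), (0, 0), (-1, 0)],
     [(0, 0), (0, 0), (-1, 0), (0, 0)],
     [(0, 0), (0, 0), (0, 0), (-1, -2)],
     [(0, 0), (0, 0), (-1, -1), (0, 0)],
     [(0, 0), (0, 0), (0, 0), (-1, 0)]]"
    by code_simp
qed

text \<open>K4 with the edge between 1 and 2 subdivided by the vertex 0. Every candidate for a
  counterexample on five vertices embeds into this graph.\<close>

definition house_edges :: "((nat \<times> nat) \<times> nat) list" where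
  "house_edges = [((0, 1), 5), ((0, 2), 2), ((1, 3), 4), ((1, 4), 2), ((2, 3), 1), ((2, 4), 5), ((3, 4), 3)]"

lemma house_good: "good {..<5} (table_edge house_edges)"
proof (rule good_by_table)
  show "check_table 5 house_edges
    [(0, 0), (1, 2), (1, -1), (0, 1), (2, 1)]
    [[(0, 0), (-1, 1), (-1, 1), (-1, 1), (-1, 1)],
     [(0, 0), (0, 0), (0, 3), (1, 1), (-1, 1)],
     [(0, 0), (0, 0), (-1, 1), (-1, 1), (-1, 1)],
     [(0, 0), (1, 2), (-2, 2), (-1, 0), (-3, 0)],
     [(0, 0), (0, 0), (-1, 1), (1, 1), (-1, 1)],
     [(0, 0), (0, 0), (3, -3), (1, 1), (-1, 1)],
     [(0, 0), (0, 0), (-3, 3), (-1, -1), (-3, 3)]]"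
    by code_simp
qed

definition prism_edges :: "((nat \<times> nat) \<times> nat) list" where
  "prism_edges = [((0, 1), 3), ((1, 2), 4), ((0, 2), 5), ((3, 4), 3), ((4, 5), 6), ((3, 5), 0), ((0, 3), 1), ((1, 4), 5), ((2, 5), 3)]"

lemma prism_good: "good {..<6} (table_edge prism_edges)"
proof (rule good_by_table)
  show "check_table 6 prism_edges
    [(0, 0), (-2, 0), (2, 4), (1, -2), (-3, -2), (-1, 4)]
    [[(0, 0), (-3, -2), (1, 2), (-1, 2), (-1, 2), (-1, 2)],
     [(0, 0), (-2, 0), (1, 2), (-1, 2), (-1, 2), (-1, 2)],
     [(0, 0), (0, 0), (-1, -1), (-1, 2), (1, 2), (0, -1)],
     [(0, 0), (1, 0), (-1, -2), (-2, 4), (0, -2), (0, -2)],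
     [(0, 0), (-1, 0), (1, 2), (-1, 2), (0, 2), (-1, 2)],
     [(0, 0), (1, 0), (-1, -2), (1, -2), (0, -2), (0, -2)],
     [(0, 0), (1, 0), (-1, -2), (0, -2), (0, -2), (0, -2)],
     [(0, 0), (-1, 0), (1, 2), (-1, 2), (-1, 2), (-1, 2)],
     [(0, 0), (0, 0), (0, 0), (-1, 2), (1, 2), (0, -1)]]"
    by code_simp
qed

definition utility_edges :: "((nat \<times> nat) \<times> nat) list" where
  "utility_edges = [((0, 3), 3), ((0, 4), 2), ((0, 5), 4), ((1, 3), 1), ((1, 4), 4), ((1, 5), 6), ((2, 3), 2), ((2, 4), 3), ((2, 5), 5)]"

lemma utility_good: "good {..<6} (table_edge utility_edges)"
proof (rule good_by_table)
  show "check_table 6 utility_edges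
    [(0, 0), (0, -2), (0, -1), (-1, 0), (1, -1), (1, 1)]
    [[(0, 0), (-2, -2), (-1, 0), (-5, 4), (0, 0), (-2, -2)],
     [(0, 0), (-6, 2), (-5, 0), (-5, 0), (-8, 0), (-10, -10)],
     [(0, 0), (2, -2), (3, -2), (1, 0), (2, -2), (0, -8)],
     [(0, 0), (-2, -2), (-1, 0), (-1, 0), (0, 0), (-2, -2)],
     [(0, 0), (-6, 2), (-5, 0), (-5, 0), (0, 0), (-10, -10)],
     [(0, 0), (-2, -2), (-3, 0), (-3, 0), (0, 0), (-6, -6)],
     [(0, 0), (-2, -2), (-1, 0), (-3, 0), (0, 0), (-2, -2)],
     [(0, 0), (6, 0), (5, 1), (6, 0), (3, -3), (9, 9)],
     [(0, 0), (-2, -2), (-3, 0), (-3, 0), (0, 0), (-2, -2)]]"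
    by code_simp
qed

lemma good_by_embedding:
  assumes G: "graph_on V E" and H: "good {..<n} (table_edge L)" "graph_on {..<n} (table_edge L)"
    and vs: "distinct vs" "V = set vs" "length vs \<le> n"
    and non: "\<And>i j. i < j \<Longrightarrow> j < length vs \<Longrightarrow> \<not> table_edge L i j \<Longrightarrow> \<not> E (vs ! i) (vs ! j)"
  shows "good V E"
proof -
  define f where "f x = (THE i. i < length vs \<and> vs ! i = x)" for x
  have f: "f (vs ! i) = i" if "i < length vs" for i
    unfolding f_def using that vs(1) by (auto simp: nth_eq_iff_index_eq)
  have V: "\<exists>i<length vs. x = vs ! i" if "x \<in> V" for x
    using that unfolding vs(2) in_set_conv_nth by blast
  show ?thesis
  proof (rule good_embed[OF G H(2,1)])
    show "inj_on f V" using f V by (metis inj_onI)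
    show "f ` V \<subseteq> {..<n}" using f V vs(3) by fastforce
    fix x y assume xy: "E x y"
    obtain i j where ij: "i < length vs" "x = vs ! i" "j < length vs" "y = vs ! j"
      using V graph_onD(2,3)[OF G xy] by metis
    have "i \<noteq> j" using graph_onD(4)[OF G xy] ij by auto
    then consider "i < j" | "j < i" by linarith
    then have "table_edge L i j"
    proof cases
      case 1
      then show ?thesis using non[of i j] ij xy by blast
    next
      case 2
      then have "table_edge L j i" using non[of j i] ij graph_onD(5)[OF G xy] by blast
      then show ?thesis by (auto simp: table_edge_def)
    qed
    then show "table_edge L (f x) (f y)" using f ij by simp
  qed
qed

lemma graph_on_table:
  assumes "list_all (\<lambda>((x, y), k). x < n \<and> y < n \<and> x \<noteq> y) L"
  shows "graph_on {..<n} (table_edge L)"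
proof -
  have "x < n \<and> y < n \<and> x \<noteq> y" if "((x, y), k) \<in> set L" for x y k
    using assms that by (auto simp: list_all_iff)
  then have "x < n \<and> y < n \<and> x \<noteq> y" if "table_edge L x y" for x y
    using that unfolding table_edge_def by (metis map_of_SomeD option.exhaust)
  then show ?thesis by (auto simp: graph_on_def table_edge_def)
qed

lemma good_diamond:
  assumes "graph_on V E" "V = {a, b, p, q}" "distinct [a, b, p, q]" "\<not> E p q"
  shows "good V E"
proof (rule good_by_embedding[OF assms(1) diamond_good _ assms(3)])
  show "graph_on {..<4} (table_edge diamond_edges)"
    by (rule graph_on_table) (simp add: diamond_edges_def)
  show "\<not> E ([a, b, p, q] ! i) ([a, b, p, q] ! j)"
    if "i < j" "j < length [a, b, p, q]" "\<not> table_edge diamond_edges i j" for i j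
    using that assms(4)
    by (auto simp: table_edge_def diamond_edges_def less_Suc_eq numeral_eq_Suc)
qed (use assms in auto)

lemma good_house:
  assumes "graph_on V E" "V = {a, p, q, r, s}" "distinct [a, p, q, r, s]" "\<not> E a r" "\<not> E a s" "\<not> E p q"
  shows "good V E"
proof (rule good_by_embedding[OF assms(1) house_good _ assms(3)])
  show "graph_on {..<5} (table_edge house_edges)"
    by (rule graph_on_table) (simp add: house_edges_def)
  show "\<not> E ([a, p, q, r, s] ! i) ([a, p, q, r, s] ! j)"
    if "i < j" "j < length [a, p, q, r, s]" "\<not> table_edge house_edges i j" for i j
    using that assms(4-6)
    by (auto simp: table_edge_def house_edges_def less_Suc_eq numeral_eq_Suc)
qed (use assms in auto)

lemma good_bipartite:
  assumes "graph_on V E" "V = {a, b, d, p, q, r}" "distinct [a, b, d, p, q, r]"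
    and "\<not> E a b" "\<not> E a d" "\<not> E b d" "\<not> E p q" "\<not> E p r" "\<not> E q r"
  shows "good V E"
proof (rule good_by_embedding[OF assms(1) utility_good _ assms(3)])
  show "graph_on {..<6} (table_edge utility_edges)"
    by (rule graph_on_table) (simp add: utility_edges_def)
  show "\<not> E ([a, b, d, p, q, r] ! i) ([a, b, d, p, q, r] ! j)"
    if "i < j" "j < length [a, b, d, p, q, r]" "\<not> table_edge utility_edges i j" for i j
    using that assms(4-9)
    by (auto simp: table_edge_def utility_edges_def less_Suc_eq numeral_eq_Suc)
qed (use assms in auto)

text \<open>The complement of the prism is a hexagon.\<close>

lemma good_hexagon:
  assumes "graph_on V E" "V = {a, b, d, p, q, r}" "distinct [a, b, d, p, q, r]"
    and "\<not> E a b" "\<not> E b d" "\<not> E d p" "\<not> E p q" "\<not> E q r" "\<not> E r a"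
  shows "good V E"
proof (rule good_by_embedding[OF assms(1) prism_good, of "[a, q, d, p, b, r]"])
  have sym: "\<not> E d b" "\<not> E q p" "\<not> E b a" "\<not> E a r" "\<not> E p d" "\<not> E r q"
    using assms graph_on_sym[OF assms(1)] by blast+
  show "graph_on {..<6} (table_edge prism_edges)"
    by (rule graph_on_table) (simp add: prism_edges_def)
  show "\<not> E ([a, q, d, p, b, r] ! i) ([a, q, d, p, b, r] ! j)"
    if "i < j" "j < length [a, q, d, p, b, r]" "\<not> table_edge prism_edges i j" for i j
    using that assms(4-9) sym
    by (auto simp: table_edge_def prism_edges_def less_Suc_eq numeral_eq_Suc)
qed (use assms in auto)

section \<open>Subcubic graphs without \<open>K\<^sub>4\<close>\<close>

definition K4_free :: "('a \<Rightarrow> 'a \<Rightarrow> bool) \<Rightarrow> bool" where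
  "K4_free E \<longleftrightarrow> \<not> (\<exists>a b d e. E a b \<and> E a d \<and> E a e \<and> E b d \<and> E b e \<and> E d e)"

lemma card_outer_le_boundary:
  assumes "graph_on V E"
  shows "card {y \<in> V - X. \<exists>x\<in>X. E x y} \<le> boundary V E X"
proof -
  let ?N = "{y \<in> V - X. \<exists>x\<in>X. E x y}"
  note fin = graph_onD(1)[OF assms]
  have "card ?N = (\<Sum>y\<in>?N. 1)" by simp
  also have "\<dots> \<le> (\<Sum>y\<in>?N. card (nb E y \<inter> X))"
  proof (rule sum_mono)
    fix y assume "y \<in> ?N"
    then obtain x where "x \<in> X" "E x y" by blast
    then have "x \<in> nb E y \<inter> X" using graph_onD(5)[OF assms] by simp
    then have "nb E y \<inter> X \<noteq> {}" by blast
    then show "1 \<le> card (nb E y \<inter> X)"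
      using finite_nb[OF assms, of y] by (simp add: Suc_le_eq card_gt_0_iff)
  qed
  also have "\<dots> \<le> boundary V E X"
    unfolding boundary_def by (rule sum_mono2) (use fin in auto)
  finally show ?thesis .
qed

lemma quotient_outside:
  assumes "graph_on V E" "X \<subseteq> V" "r \<in> X" "x \<in> V - X"
  shows "quotient_edge E (collapse X r) x y \<longleftrightarrow> (if y = r then \<exists>z\<in>X. E x z else E x y \<and> y \<in> V - X)"
    and "quotient_edge E (collapse X r) y x \<longleftrightarrow> (if y = r then \<exists>z\<in>X. E x z else E x y \<and> y \<in> V - X)"
proof -
  show 1: "quotient_edge E (collapse X r) x y \<longleftrightarrow> (if y = r then \<exists>z\<in>X. E x z else E x y \<and> y \<in> V - X)"
  proof -
    have "x \<noteq> r" using assms by auto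
    have "quotient_edge E (collapse X r) x y \<longleftrightarrow> x \<noteq> y \<and> (\<exists>z. E x z \<and> collapse X r z = y)"
      unfolding quotient_edge_def using assms(3,4) by (metis DiffD2 collapse_def)
    also have "\<dots> \<longleftrightarrow> (if y = r then \<exists>z\<in>X. E x z else E x y \<and> y \<in> V - X)"
    proof (cases "y = r")
      case True
      have "collapse X r z = r \<longleftrightarrow> z \<in> X" for z using assms(3) by (auto simp: collapse_def)
      then show ?thesis using True \<open>x \<noteq> r\<close> by auto
    next
      case False
      then have "collapse X r z = y \<longleftrightarrow> z = y \<and> y \<notin> X" for z by (auto simp: collapse_def)
      then show ?thesis using False graph_onD(3,4)[OF assms(1), of x y] by auto
    qed
    finally show ?thesis .
  qed
  show "quotient_edge E (collapse X r) y x \<longleftrightarrow> (if y = r then \<exists>z\<in>X. E x z else E x y \<and> y \<in> V - X)"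
    using 1 graph_on_sym[OF graph_on_quotient[OF assms(1-3)]] by metis
qed

text \<open>A K4 that avoids \<open>r\<close> would already be one of the original graph. So
  \<open>r\<close> is one of its vertices, and the other three form a triangle outside
  \<open>X\<close>, each joined to \<open>X\<close>.\<close>

lemma quotient_K4:
  assumes G: "graph_on V E" "K4_free E" and X: "X \<subseteq> V" "r \<in> X"
    and K4: "\<not> K4_free (quotient_edge E (collapse X r))"
  shows "\<exists>a b d. {a, b, d} \<subseteq> V - X \<and> E a b \<and> E a d \<and> E b d \<and>
    (\<exists>z\<in>X. E a z) \<and> (\<exists>z\<in>X. E b z) \<and> (\<exists>z\<in>X. E d z)"
proof -
  let ?Q = "quotient_edge E (collapse X r)"
  note GQ = graph_on_quotient[OF G(1) X]
  obtain a b d e where K: "?Q a b" "?Q a d" "?Q a e" "?Q b d" "?Q b e" "?Q d e"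
    using K4 unfolding K4_free_def by blast
  have sym: "?Q y x" if "?Q x y" for x y by (rule graph_onD(5)[OF GQ that])
  have ne: "x \<noteq> y" "x = r \<or> x \<in> V - X" "y = r \<or> y \<in> V - X" if "?Q x y" for x y
    using graph_onD(2-4)[OF GQ that] by auto
  have hub: ?thesis if q: "?Q r x" "?Q r y" "?Q r z" "?Q x y" "?Q x z" "?Q y z" for x y z
  proof -
    have "x \<noteq> r" "y \<noteq> r" "z \<noteq> r" using ne q by blast+
    then have V: "x \<in> V - X" "y \<in> V - X" "z \<in> V - X" using ne q by blast+
    have "\<exists>t\<in>X. E x t" "\<exists>t\<in>X. E y t" "\<exists>t\<in>X. E z t" "E x y" "E x z" "E y z"
      using quotient_outside(2)[OF G(1) X V(1), of r] quotient_outside(2)[OF G(1) X V(2), of r]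
        quotient_outside(2)[OF G(1) X V(3), of r] quotient_outside(1)[OF G(1) X V(1), of y]
        quotient_outside(1)[OF G(1) X V(1), of z] quotient_outside(1)[OF G(1) X V(2), of z]
        q \<open>y \<noteq> r\<close> \<open>z \<noteq> r\<close> by simp_all
    then show ?thesis using V by (intro exI[of _ x] exI[of _ y] exI[of _ z]) auto
  qed
  consider "a = r" | "b = r" | "d = r" | "e = r" | "r \<notin> {a, b, d, e}" by blast
  then show ?thesis
  proof cases
    case 1 then show ?thesis using hub[of b d e] K by simp
  next
    case 2 then show ?thesis using hub[of a d e] K sym by simp
  next
    case 3 then show ?thesis using hub[of a b e] K sym by simp
  next
    case 4 then show ?thesis using hub[of a b d] K sym by simp
  next
    case 5
    have out: "E x y" if "?Q x y" "x \<noteq> r" "y \<noteq> r" for x y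
      using quotient_outside(1)[OF G(1) X, of x y] ne(2)[OF that(1)] that by auto
    have "a \<noteq> r" "b \<noteq> r" "d \<noteq> r" "e \<noteq> r" using 5 by auto
    then have "E a b" "E a d" "E a e" "E b d" "E b e" "E d e" using out K by blast+
    then show ?thesis using G(2) unfolding K4_free_def by blast
  qed
qed

section \<open>The minimal counterexample\<close>

locale minimal_bad =
  fixes V :: "'a set" and E :: "'a \<Rightarrow> 'a \<Rightarrow> bool"
  assumes G: "graph_on V E"
    and deg: "x \<in> V \<Longrightarrow> card (nb E x) \<le> 3"
    and K4: "K4_free E"
    and bad: "\<not> good V E"
    and minimal: "graph_on W F \<Longrightarrow> (\<And>x. x \<in> W \<Longrightarrow> card (nb F x) \<le> 3) \<Longrightarrow> K4_free F \<Longrightarrow>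
      card W < card V \<Longrightarrow> good W (F :: 'a \<Rightarrow> 'a \<Rightarrow> bool)"
begin

lemma fin: "finite V" and E_in: "E x y \<Longrightarrow> x \<in> V" "E x y \<Longrightarrow> y \<in> V" and E_ne: "E x y \<Longrightarrow> x \<noteq> y"
  and E_sym: "E x y \<Longrightarrow> E y x"
  using graph_onD[OF G] by blast+

lemma fin_nb: "finite (nb E x)"
  by (rule finite_nb[OF G])

text \<open>Both the part \<open>X\<close> and the quotient are smaller. If the quotient were free
  of K4, both would be good by minimality, and \<open>good_glue\<close> would make the whole graph
  good. The conclusion describes the K4.\<close>

lemma irreducible:
  assumes X: "X \<subseteq> V" "X \<noteq> V" "2 \<le> card X" "boundary V E X \<le> 3"
    and one: "\<And>y. y \<in> V - X \<Longrightarrow> card (nb E y \<inter> X) \<le> 1"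
  shows "\<exists>a b d. {a, b, d} \<subseteq> V - X \<and> E a b \<and> E a d \<and> E b d \<and>
    (\<exists>z\<in>X. E a z) \<and> (\<exists>z\<in>X. E b z) \<and> (\<exists>z\<in>X. E d z)"
proof (rule ccontr)
  assume no: "\<not> ?thesis"
  have finX: "finite X" using X fin finite_subset by blast
  obtain r where r: "r \<in> X" using X(3) by fastforce
  let ?Q = "quotient_edge E (collapse X r)" and ?W = "insert r (V - X)"
  have K4Q: "K4_free ?Q" using quotient_K4[OF G K4 X(1) r] no by blast
  note GQ = graph_on_quotient[OF G X(1) r]
  have small: "card {y \<in> V - X. \<exists>x\<in>X. E x y} \<le> 3"
    using card_outer_le_boundary[OF G, of X] X(4) by simp
  have degQ: "card (nb ?Q x) \<le> 3" if x: "x \<in> ?W" for x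
  proof (cases "x = r")
    case True
    have "nb ?Q r \<subseteq> {y \<in> V - X. \<exists>x\<in>X. E x y}"
    proof
      fix y assume y: "y \<in> nb ?Q r"
      then have "y \<in> V - X" using graph_onD(3,4)[OF GQ, of r y] by auto
      then show "y \<in> {y \<in> V - X. \<exists>x\<in>X. E x y}"
        using y quotient_outside(2)[OF G X(1) r, of y r] E_sym by auto
    qed
    then have "card (nb ?Q r) \<le> card {y \<in> V - X. \<exists>x\<in>X. E x y}"
      by (rule card_mono[rotated]) (use fin in simp)
    then show ?thesis using small True by simp
  next
    case False
    then have xV: "x \<in> V - X" using x by simp
    have "nb ?Q x \<subseteq> collapse X r ` nb E x"
    proof
      fix y assume "y \<in> nb ?Q x"
      then have "if y = r then \<exists>z\<in>X. E x z else E x y \<and> y \<in> V - X"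
        using quotient_outside(1)[OF G X(1) r xV] by simp
      then show "y \<in> collapse X r ` nb E x"
        by (cases "y = r") (auto simp: collapse_def image_iff intro: bexI)
    qed
    then have "card (nb ?Q x) \<le> card (collapse X r ` nb E x)"
      by (rule card_mono[rotated]) (simp add: fin_nb)
    then show ?thesis using card_image_le[OF fin_nb, of "collapse X r" x] deg[of x] xV by simp
  qed
  have cV: "card X < card V" using X fin by (simp add: psubset_card_mono psubset_eq)
  have "good X (induced E X)"
  proof (rule minimal[OF graph_on_induced[OF G X(1)] _ _ cV])
    show "K4_free (induced E X)" using K4 unfolding K4_free_def induced_def by blast
    fix x assume "x \<in> X"
    have "card (nb (induced E X) x) \<le> card (nb E x)"
      by (rule card_mono[OF fin_nb]) (auto simp: induced_def)
    then show "card (nb (induced E X) x) \<le> 3" using deg[of x] \<open>x \<in> X\<close> X(1) by auto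
  qed
  moreover have "good ?W ?Q"
  proof (rule minimal[OF GQ degQ K4Q])
    have "card ?W = Suc (card V - card X)"
      using r X(1) fin finX by (simp add: card_Diff_subset)
    then show "card ?W < card V" using X(3) cV by simp
  qed
  ultimately have "good V E"
  proof (intro good_glue[OF G _ X(1) r _ small])
    show "card {y. E x y} \<le> 3" if "x \<in> V" for x using deg[OF that] by (simp add: nb_def)
    show "x = x'" if h: "E x y" "E x' y" "x \<in> X" "x' \<in> X" "y \<notin> X" for x x' y
    proof (rule ccontr)
      assume "x \<noteq> x'"
      then have "card {x, x'} \<le> card (nb E y \<inter> X)"
        using h E_sym by (intro card_mono) (auto simp: fin_nb)
      then show False using one[of y] h E_in(2)[OF h(1)] \<open>x \<noteq> x'\<close> by simp
    qed
  qed
  then show False using bad by simp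
qed

lemma nb_le_boundary: "y \<in> V - X \<Longrightarrow> card (nb E y \<inter> X) \<le> boundary V E X"
  unfolding boundary_def by (rule member_le_sum) (use fin in auto)

lemma three_outer:
  assumes "{a, b, d} \<subseteq> V - X" "E a b" "E a d" "E b d" "\<exists>z\<in>X. E a z" "\<exists>z\<in>X. E b z" "\<exists>z\<in>X. E d z"
  shows "3 \<le> boundary V E X"
proof -
  have "{a, b, d} \<subseteq> {y \<in> V - X. \<exists>x\<in>X. E x y}" using assms E_sym by blast
  then have "card {a, b, d} \<le> card {y \<in> V - X. \<exists>x\<in>X. E x y}"
    by (rule card_mono[rotated]) (use fin in simp)
  moreover have "card {a, b, d} = 3" using assms E_ne by auto
  ultimately show ?thesis using card_outer_le_boundary[OF G, of X] by simp
qed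

text \<open>The triangle provided by \<open>irreducible\<close> has three vertices attached to
  \<open>X\<close> and so needs three cut edges.\<close>

lemma cut2: "X \<subseteq> V \<Longrightarrow> X \<noteq> V \<Longrightarrow> 2 \<le> card X \<Longrightarrow> 2 \<le> boundary V E X"
proof (rule ccontr)
  assume X: "X \<subseteq> V" "X \<noteq> V" "2 \<le> card X" and b: "\<not> 2 \<le> boundary V E X"
  then have one: "card (nb E y \<inter> X) \<le> 1" if "y \<in> V - X" for y
    using nb_le_boundary[OF that] by simp
  have "boundary V E X \<le> 3" using b by simp
  from irreducible[OF X this one] have "3 \<le> boundary V E X" using three_outer[of _ _ _ X] by blast
  then show False using b by simp
qed

lemma mindeg: "3 \<le> card V \<Longrightarrow> t \<in> V \<Longrightarrow> 2 \<le> card (nb E t)"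
proof -
  assume c: "3 \<le> card V" and t: "t \<in> V"
  have "2 \<le> boundary V E (V - {t})"
    using c t fin by (intro cut2) auto
  also have "V - (V - {t}) = {t}" using t by auto
  then have "boundary V E (V - {t}) = card (nb E t \<inter> (V - {t}))" by (simp add: boundary_def)
  also have "\<dots> \<le> card (nb E t)" by (rule card_mono) (auto simp: fin_nb)
  finally show ?thesis .
qed

text \<open>A vertex with two neighbours in \<open>X\<close> has at most one neighbour elsewhere.
  Moving it into \<open>X\<close> disposes of the outer vertices at which cut edges meet, and these
  are what prevents gluing.\<close>

lemma absorb:
  assumes "t \<in> V - X" "2 \<le> card (nb E t \<inter> X)"
  shows "boundary V E (insert t X) < boundary V E X"
proof -
  have "card (nb E t \<inter> X) + card (nb E t - X) = card (nb E t)"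
    by (rule card_Int_Diff[OF fin_nb, symmetric])
  then show ?thesis
    using boundary_insert[OF G assms(1)] deg[of t] assms by auto
qed

text \<open>Absorbing an outer vertex with two edges into \<open>X\<close> leaves at most one cut
  edge, so by \<open>cut2\<close> nothing else is outside. Without such a vertex
  \<open>irreducible\<close> applies and demands a third cut edge.\<close>

lemma cut_two:
  assumes X: "X \<subseteq> V" "X \<noteq> V" "2 \<le> card X" "boundary V E X \<le> 2"
  shows "card (V - X) = 1"
proof (cases "\<exists>t\<in>V - X. 2 \<le> card (nb E t \<inter> X)")
  case True
  then obtain t where t: "t \<in> V - X" "2 \<le> card (nb E t \<inter> X)" by blast
  have finX: "finite X" using X fin finite_subset by blast
  have "boundary V E (insert t X) < 2" using absorb[OF t] X(4) by simp
  then have "insert t X = V"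
    using cut2[of "insert t X"] X t finX by (auto simp: not_less)
  then have "V - X = {t}" using t by auto
  then show ?thesis by simp
next
  case False
  have one: "card (nb E y \<inter> X) \<le> 1" if "y \<in> V - X" for y
  proof -
    have "\<not> 2 \<le> card (nb E y \<inter> X)" using False that by blast
    then show ?thesis by simp
  qed
  have "boundary V E X \<le> 3" using X(4) by simp
  from irreducible[OF X(1-3) this one] have "3 \<le> boundary V E X" using three_outer[of _ _ _ X] by blast
  then show ?thesis using X(4) by simp
qed

text \<open>An outer vertex with two edges into \<open>X\<close> could be absorbed, leaving a cut of
  at most two edges with at least two vertices outside, against \<open>cut_two\<close>. So the cut
  edges have distinct outer ends and \<open>irreducible\<close> applies.\<close>

lemma cut_three:
  assumes X: "X \<subseteq> V" "2 \<le> card X" "3 \<le> card (V - X)" "boundary V E X \<le> 3"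
  shows "boundary V E X = 3 \<and> (\<exists>a b d. {a, b, d} \<subseteq> V - X \<and> E a b \<and> E a d \<and> E b d \<and>
    (\<exists>z\<in>X. E a z) \<and> (\<exists>z\<in>X. E b z) \<and> (\<exists>z\<in>X. E d z))"
proof -
  have XV: "X \<noteq> V" using X(3) by auto
  have b3: "boundary V E X = 3"
    using cut_two[OF X(1) XV X(2)] X(3,4) by (cases "boundary V E X \<le> 2") auto
  have "card (nb E y \<inter> X) \<le> 1" if y: "y \<in> V - X" for y
  proof (rule ccontr)
    assume "\<not> ?thesis"
    then have "boundary V E (insert y X) \<le> 2" using absorb[OF y] b3 by simp
    moreover have "card (V - insert y X) = card (V - X) - 1"
      using y fin by (simp add: card_Diff_insert)
    then have "2 \<le> card (V - insert y X)" using X(3) by simp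
    moreover have "2 \<le> card (insert y X)"
      using X(1,2) fin card_insert_le[of X y] le_trans by blast
    ultimately show False
      using cut_two[of "insert y X"] y X(1) by (cases "insert y X = V") auto
  qed
  then show ?thesis using irreducible[OF X(1) XV X(2,4)] b3 by blast
qed

lemma triangle_boundary:
  assumes "E a b" "E a d" "E b d"
  shows "boundary V E {a, b, d} \<le> 3" "card {a, b, d} = 3" "{a, b, d} \<subseteq> V"
    "x \<in> {a, b, d} \<Longrightarrow> card (nb E x - {a, b, d}) \<le> 1"
proof -
  have ne: "a \<noteq> b" "a \<noteq> d" "b \<noteq> d" using assms E_ne by auto
  show card3: "card {a, b, d} = 3" using ne by simp
  show sub: "{a, b, d} \<subseteq> V" using assms E_in by blast
  show one: "card (nb E x - {a, b, d}) \<le> 1" if x: "x \<in> {a, b, d}" for x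
  proof -
    have "{a, b, d} - {x} \<subseteq> nb E x" using x assms E_sym by auto
    then have "card ({a, b, d} - {x}) \<le> card (nb E x \<inter> {a, b, d})"
      by (intro card_mono) (auto simp: fin_nb)
    moreover have "card ({a, b, d} - {x}) = 2" using x card3 by simp
    moreover have "card (nb E x) = card (nb E x \<inter> {a, b, d}) + card (nb E x - {a, b, d})"
      by (rule card_Int_Diff[OF fin_nb])
    ultimately show ?thesis using deg[of x] x sub by fastforce
  qed
  have "boundary V E {a, b, d} = (\<Sum>x\<in>{a, b, d}. card (nb E x - {a, b, d}))"
    by (rule boundary_swap[OF G sub])
  also have "\<dots> \<le> (\<Sum>x\<in>{a, b, d}. 1)" by (rule sum_mono) (rule one)
  finally show "boundary V E {a, b, d} \<le> 3" using card3 by simp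
qed

text \<open>A three-edge cut yields a triangle \<open>?T\<close>, which is itself cut off by at most
  three edges. The same argument for \<open>?T\<close> yields a second triangle attached to it. The
  two form a prism, a whole component with six vertices, whereas the graph has at least
  seven.\<close>

lemma cut4:
  assumes large: "7 \<le> card V" and X: "X \<subseteq> V" "2 \<le> card X" "3 \<le> card (V - X)"
  shows "4 \<le> boundary V E X"
proof (rule ccontr)
  assume "\<not> ?thesis"
  then have "boundary V E X \<le> 3" by simp
  then obtain a b d where T: "E a b" "E a d" "E b d"
    using cut_three[OF X] by blast
  let ?T = "{a, b, d}"
  note tb = triangle_boundary[OF T]
  have "card (V - ?T) = card V - 3"
    using tb(2,3) by (metis card_Diff_subset finite.emptyI finite.insertI)
  then have "3 \<le> card (V - ?T)" using large by simp
  then obtain a' b' d' where b3: "boundary V E ?T = 3" and T': "{a', b', d'} \<subseteq> V - ?T" "E a' b'" "E a' d'" "E b' d'"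
    and att: "\<exists>z\<in>?T. E a' z" "\<exists>z\<in>?T. E b' z" "\<exists>z\<in>?T. E d' z"
    using cut_three[OF tb(3) _ _ tb(1)] tb(2) by auto
  let ?T' = "{a', b', d'}"
  note tb' = triangle_boundary[OF T'(2-4)]
  define S where "S = ?T \<union> ?T'"
  have SV: "S \<subseteq> V" using tb(3) T'(1) by (auto simp: S_def)
  have cS: "card S = 6"
  proof -
    have "?T \<inter> ?T' = {}" using T'(1) by blast
    then show ?thesis unfolding S_def using tb(2) tb'(2) by (subst card_Un_disjoint) auto
  qed
  \<comment> \<open>Edges leaving \<open>?T\<close> are used up by the three vertices of
    \<open>?T'\<close>, and a vertex of \<open>?T'\<close> has just one edge leaving
    \<open>?T'\<close>, which goes to \<open>?T\<close>.\<close>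
  have nbS: "nb E x \<subseteq> S" if x: "x \<in> S" for x
  proof (cases "x \<in> ?T")
    case True
    show ?thesis
    proof
      fix y assume y: "y \<in> nb E x"
      show "y \<in> S"
      proof (rule ccontr)
        assume nS: "y \<notin> S"
        have "E x y" "y \<in> V - ?T" using y nS E_in(2)[of x y] by (simp_all add: S_def)
        then have "y \<in> {y \<in> V - ?T. \<exists>x\<in>?T. E x y}" using True by blast
        moreover have "t \<in> {y \<in> V - ?T. \<exists>x\<in>?T. E x y}" if t: "t \<in> ?T'" for t
        proof -
          have "\<exists>z\<in>?T. E t z" using t att by blast
          then have "\<exists>z\<in>?T. E z t" using E_sym by blast
          then show ?thesis using t T'(1) by blast
        qed
        ultimately have "insert y ?T' \<subseteq> {y \<in> V - ?T. \<exists>x\<in>?T. E x y}" by blast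
        then have "card (insert y ?T') \<le> card {y \<in> V - ?T. \<exists>x\<in>?T. E x y}"
          by (rule card_mono[rotated]) (use fin in simp)
        moreover have "card (insert y ?T') = 4"
          using nS tb'(2) unfolding S_def by (subst card_insert_disjoint) auto
        ultimately show False using card_outer_le_boundary[OF G, of ?T] b3 by simp
      qed
    qed
  next
    case False
    then have xT': "x \<in> ?T'" using x by (auto simp: S_def)
    obtain z where z: "z \<in> ?T" "E x z" using xT' att by blast
    have zo: "z \<in> nb E x - ?T'" using z T'(1) by auto
    have "finite (nb E x - ?T')" using fin_nb by simp
    then have "\<forall>a\<in>nb E x - ?T'. \<forall>b\<in>nb E x - ?T'. a = b"
      using card_le_Suc0_iff_eq tb'(4)[OF xT'] by (metis One_nat_def)
    then have "nb E x - ?T' \<subseteq> {z}" using zo by blast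
    then show ?thesis using z(1) unfolding S_def by blast
  qed
  have "nb E x - S = {}" if "x \<in> S" for x using nbS[OF that] by auto
  then have "boundary V E S = 0"
    unfolding boundary_swap[OF G SV] by (intro sum.neutral ballI) (simp only: card.empty)
  moreover have "2 \<le> boundary V E S"
    by (rule cut2[OF SV]) (use cS large in auto)
  ultimately show False by simp
qed

lemma small: "card V \<le> 6"
proof (rule ccontr)
  assume "\<not> ?thesis"
  then have large: "7 \<le> card V" by simp
  have "tight_graph V E"
  proof
    show "2 \<le> card (nb E x)" if "x \<in> V" for x using mindeg[OF _ that] large by simp
    show "4 \<le> boundary V E X" if "X \<subseteq> V" "2 \<le> card X" "3 \<le> card (V - X)" for X
      by (rule cut4[OF large that])
  qed (fact G deg cut2 large)+
  then show False using tight_graph.tight_good bad by blast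
qed

end

text \<open>Handshake lemma for the subgraph induced on \<open>X\<close>: each new vertex adds its
  degree into \<open>X\<close> twice.\<close>

lemma even_degree_sum:
  assumes G: "graph_on V E" and "finite X"
  shows "even (\<Sum>x\<in>X. card (nb E x \<inter> X))"
  using assms(2)
proof (induction rule: finite_induct)
  case (insert t X)
  have "card (nb E x \<inter> insert t X) = card (nb E x \<inter> X) + of_bool (E x t)" if "x \<in> X" for x
    using insert.hyps finite_nb[OF G, of x] by (cases "E x t") auto
  then have "(\<Sum>x\<in>X. card (nb E x \<inter> insert t X)) = (\<Sum>x\<in>X. card (nb E x \<inter> X)) + (\<Sum>x\<in>X. of_bool (E x t))"
    by (simp add: sum.distrib)
  also have "(\<Sum>x\<in>X. of_bool (E x t)) = card (nb E t \<inter> X)"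
  proof -
    have "X \<inter> {x. E x t} = nb E t \<inter> X" using graph_onD(5)[OF G] by auto
    then show ?thesis using insert.hyps by simp
  qed
  moreover have "nb E t \<inter> insert t X = nb E t \<inter> X" using graph_onD(4)[OF G, of t t] by auto
  ultimately show ?case using insert by simp
qed simp

section \<open>Counterexamples with at most six vertices\<close>

context minimal_bad
begin

lemma saturated: "E x a \<Longrightarrow> E x b \<Longrightarrow> E x d \<Longrightarrow> distinct [a, b, d, e] \<Longrightarrow> \<not> E x e"
proof
  assume h: "E x a" "E x b" "E x d" "distinct [a, b, d, e]" "E x e"
  then have "card {a, b, d, e} \<le> card (nb E x)" by (intro card_mono) (auto simp: fin_nb)
  then show False using h deg[of x] E_in(1)[OF h(1)] by simp
qed

lemma three_nbs: "nb E x \<subseteq> {a, b, d} \<Longrightarrow> 3 \<le> card (nb E x) \<Longrightarrow> E x a \<and> E x b \<and> E x d"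
proof -
  assume h: "nb E x \<subseteq> {a, b, d}" "3 \<le> card (nb E x)"
  have "card {a, b, d} \<le> 3" by (simp add: card_insert_if)
  then have "nb E x = {a, b, d}" using h by (intro card_seteq) auto
  then show ?thesis by (auto simp: set_eq_iff)
qed

lemma two_nbs: "nb E x \<subseteq> {a, b} \<Longrightarrow> 2 \<le> card (nb E x) \<Longrightarrow> E x a \<and> E x b"
proof -
  assume h: "nb E x \<subseteq> {a, b}" "2 \<le> card (nb E x)"
  have "card {a, b} \<le> 2" by (simp add: card_insert_if)
  then have "nb E x = {a, b}" using h by (intro card_seteq) auto
  then show ?thesis by (auto simp: set_eq_iff)
qed

lemma five_le: "5 \<le> card V"
proof (rule ccontr)
  assume "\<not> ?thesis"
  then consider "card V \<le> 3" | "card V = 4" by linarith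
  then show False
  proof cases
    case 1
    obtain vs where vs: "set vs = V" "distinct vs" using finite_distinct_list[OF fin] by blast
    then have len: "length vs \<le> 3" using 1 distinct_card by fastforce
    have "good V E"
    proof (rule good_by_embedding[OF G diamond_good _ vs(2) vs(1)[symmetric]])
      show "graph_on {..<4} (table_edge diamond_edges)"
        by (rule graph_on_table) (simp add: diamond_edges_def)
      show "\<not> E (vs ! i) (vs ! j)" if "i < j" "j < length vs" "\<not> table_edge diamond_edges i j" for i j
      proof -
        \<comment> \<open>The vertices 0, 1 and 2 of the diamond are pairwise adjacent, so any graph
          with at most three vertices embeds.\<close>
        have "j < 3" using that len by simp
        then have "table_edge diamond_edges i j"
          using that(1) by (auto simp: table_edge_def diamond_edges_def less_Suc_eq numeral_eq_Suc)
        then show ?thesis using that by blast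
      qed
    qed (use len in simp)
    then show False using bad by blast
  next
    case 2
    obtain vs where vs: "set vs = V" "distinct vs" using finite_distinct_list[OF fin] by blast
    then have "length vs = 4" using 2 distinct_card by fastforce
    then obtain a b p q where vs4: "vs = [a, b, p, q]"
      by (auto simp: length_Suc_conv numeral_eq_Suc)
    have V: "V = {a, b, p, q}" and d: "distinct [a, b, p, q]" using vs vs4 by auto
    have "\<not> (E a b \<and> E a p \<and> E a q \<and> E b p \<and> E b q \<and> E p q)" using K4 unfolding K4_free_def by blast
    moreover have adj: "E x y" if "V = {r, s, x, y}" "distinct [r, s, x, y]" for x y r s
      using good_diamond[OF G that] bad by blast
    have "E a b" "E a p" "E a q" "E b p" "E b q" "E p q"
      by (rule adj[of p q a b] adj[of b q a p] adj[of b p a q] adj[of a q b p] adj[of a p b q] adj[of a b p q];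
          use V d in auto)+
    ultimately show False by blast
  qed
qed

lemma mindeg2: "t \<in> V \<Longrightarrow> 2 \<le> card (nb E t)"
  using mindeg five_le by simp

text \<open>If \<open>p\<close> or \<open>q\<close> had degree two, it would be cut off together
  with \<open>a\<close> by two edges; if \<open>p\<close> and \<open>q\<close> were adjacent, the
  triangle would be. Both contradict \<open>cut_two\<close>, which permits only one vertex on the
  other side.\<close>

lemma degree_two:
  assumes a: "nb E a = {p, q}" "p \<noteq> q"
  shows "\<not> E p q" "card (nb E p) = 3" "card (nb E q) = 3"
proof -
  have E: "E a p" "E a q" using a by (auto simp: set_eq_iff)
  have inV: "a \<in> V" "p \<in> V" "q \<in> V" using E E_in by auto
  have ne: "a \<noteq> p" "a \<noteq> q" using E E_ne by auto
  have cubic: "card (nb E p) = 3" if a: "nb E a = {p, q}" "p \<noteq> q" for p q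
  proof (rule ccontr)
    assume "\<not> ?thesis"
    have E: "E a p" using a by (auto simp: set_eq_iff)
    have p: "p \<in> V" "a \<noteq> p" using E_in(2)[OF E] E_ne[OF E] by auto
    then have p2: "card (nb E p) \<le> 2" using \<open>card (nb E p) \<noteq> 3\<close> deg[of p] by simp
    let ?X = "{a, p}"
    have XV: "?X \<subseteq> V" "card ?X = 2" using inV p by auto
    have "card (nb E a - ?X) \<le> card {q}" by (rule card_mono) (use a in auto)
    moreover have "card (nb E p - ?X) \<le> card (nb E p - {a})" by (rule card_mono) (auto simp: fin_nb)
    moreover have "card (nb E p - {a}) \<le> 1" using p2 E_sym[OF E] fin_nb[of p] by simp
    ultimately have "boundary V E ?X \<le> 2" using p(2) by (simp add: boundary_swap[OF G XV(1)])
    then have "card (V - ?X) = 1" using XV five_le by (intro cut_two) auto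
    moreover have "card (V - ?X) = card V - 2" using XV by (metis card_Diff_subset finite.emptyI finite.insertI)
    ultimately show False using five_le by simp
  qed
  show "card (nb E p) = 3" by (rule cubic[OF a])
  show "card (nb E q) = 3" by (rule cubic[of q p]) (use a in auto)
  show "\<not> E p q"
  proof
    assume pq: "E p q"
    let ?X = "{a, p, q}"
    note tb = triangle_boundary[OF E pq]
    have "nb E a - ?X = {}" using a by auto
    then have "card (nb E a - ?X) = 0" by (simp only: card.empty)
    moreover have "boundary V E ?X = card (nb E a - ?X) + (card (nb E p - ?X) + card (nb E q - ?X))"
      using ne a(2) by (simp add: boundary_swap[OF G tb(3)])
    ultimately have "boundary V E ?X \<le> 2" using tb(4)[of p] tb(4)[of q] by simp
    then have "card (V - ?X) = 1" using tb(2,3) five_le by (intro cut_two) auto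
    moreover have "card (V - ?X) = card V - 3" using tb(2,3) by (metis card_Diff_subset finite.emptyI finite.insertI)
    ultimately show False using five_le by simp
  qed
qed

text \<open>Five cubic vertices have an odd degree sum, so some vertex \<open>a\<close> has degree
  two. Its two missing neighbours and the missing edge between its neighbours are precisely the
  three non-edges of \<open>house_edges\<close>.\<close>

lemma not_five: "card V \<noteq> 5"
proof
  assume c: "card V = 5"
  have "\<exists>a\<in>V. card (nb E a) = 2"
  proof (rule ccontr)
    assume "\<not> ?thesis"
    then have "card (nb E x) = 3" if "x \<in> V" for x using mindeg2[OF that] deg[OF that] that by fastforce
    moreover have "nb E x \<inter> V = nb E x" for x using E_in by auto
    ultimately have "(\<Sum>x\<in>V. card (nb E x \<inter> V)) = 15" using c by simp
    then show False using even_degree_sum[OF G fin] by simp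
  qed
  then obtain a where a: "a \<in> V" "card (nb E a) = 2" by blast
  then obtain p q where nba: "nb E a = {p, q}" "p \<noteq> q" by (auto simp: card_2_iff)
  have E: "E a p" "E a q" using nba by (auto simp: set_eq_iff)
  have apq: "{a, p, q} \<subseteq> V" "card {a, p, q} = 3" using a E E_in E_ne nba(2) by auto
  then have "card (V - {a, p, q}) = card V - 3"
    by (metis card_Diff_subset finite.emptyI finite.insertI)
  then have "card (V - {a, p, q}) = 2" using c by simp
  then obtain r s where rs: "V - {a, p, q} = {r, s}" "r \<noteq> s" by (auto simp: card_2_iff)
  have V: "V = {a, p, q, r, s}" using rs(1) apq(1) by blast
  have rs': "r \<notin> {a, p, q}" "s \<notin> {a, p, q}" using rs(1) by blast+
  have "\<not> E a r" "\<not> E a s" using nba(1) rs' by (auto simp: set_eq_iff)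
  moreover have "distinct [a, p, q, r, s]" using rs' rs(2) nba(2) E_ne[OF E(1)] E_ne[OF E(2)] by auto
  ultimately have "good V E" using good_house[OF G V] degree_two(1)[OF nba] by blast
  then show False using bad by blast
qed

text \<open>If \<open>p\<close> and \<open>q\<close> both miss \<open>t\<close>, each of
  \<open>p\<close>, \<open>q\<close>, \<open>t\<close> is joined to \<open>r\<close> and
  \<open>s\<close>. These are then saturated and not adjacent, so the graph is bipartite with parts
  \<open>r, s, a\<close> and \<open>p, q, t\<close>.\<close>

lemma six_same:
  assumes V: "V = {a, p, q, r, s, t}" "distinct [a, p, q, r, s, t]" and nba: "nb E a = {p, q}"
    and "\<not> E p t" "\<not> E q t"
  shows False
proof -
  have na: "\<not> E a r" "\<not> E a s" "\<not> E a t" using nba V(2) by (auto simp: set_eq_iff)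
  have d: "\<not> E p q" "card (nb E p) = 3" "card (nb E q) = 3" using degree_two[OF nba] V(2) by auto
  have "nb E p \<subseteq> {a, r, s}" "nb E q \<subseteq> {a, r, s}" "nb E t \<subseteq> {r, s}"
    using E_in(2) E_ne E_sym V(1) assms(4,5) d(1) na by fastforce+
  then have "E p r" "E p s" "E q r" "E q s" "E t r" "E t s"
    using three_nbs[of p] three_nbs[of q] two_nbs[of t] d(2,3) mindeg2[of t] V(1) by auto
  then have "\<not> E r s" using saturated[of r p q t s] E_sym V(2) by auto
  then have "good V E"
    by (intro good_bipartite[OF G, of r s a p q t]) (use V na d(1) assms(4,5) in \<open>auto dest: E_sym\<close>)
  then show False using bad by blast
qed

text \<open>Both \<open>p\<close> and \<open>q\<close> are joined to \<open>t\<close>, which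
  therefore misses \<open>r\<close> or \<open>s\<close>. With this the non-edges contain a hexagon,
  and the graph embeds into the prism.\<close>

lemma six_different:
  assumes V: "V = {a, p, q, r, s, t}" "distinct [a, p, q, r, s, t]" and nba: "nb E a = {p, q}"
    and "\<not> E p r" "\<not> E q s"
  shows False
proof -
  have na: "\<not> E a r" "\<not> E a s" "\<not> E a t" using nba V(2) by (auto simp: set_eq_iff)
  have d: "\<not> E p q" "card (nb E p) = 3" "card (nb E q) = 3" using degree_two[OF nba] V(2) by auto
  have "nb E p \<subseteq> {a, s, t}" "nb E q \<subseteq> {a, r, t}"
    using E_in(2) E_ne E_sym V(1) assms(4,5) d(1) by fastforce+
  then have t: "E p t" "E q t" using three_nbs[of p] three_nbs[of q] d(2,3) by auto
  have "\<not> E t s \<or> \<not> E t r" using saturated[of t p q r s] t E_sym V(2) by auto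
  then have "good V E"
  proof
    assume "\<not> E t s"
    then show ?thesis
      by (intro good_hexagon[OF G, of a r p q s t]) (use V na d(1) assms(4,5) in \<open>auto dest: E_sym\<close>)
  next
    assume "\<not> E t r"
    then show ?thesis
      by (intro good_hexagon[OF G, of a s q p r t]) (use V na d(1) assms(4,5) in \<open>auto dest: E_sym\<close>)
  qed
  then show False using bad by blast
qed

text \<open>If \<open>s\<close> and \<open>t\<close> both missed \<open>p\<close>, then
  \<open>s\<close>, \<open>t\<close> and \<open>p\<close> would all be adjacent to \<open>q\<close>,
  which is also adjacent to \<open>a\<close>.\<close>

lemma six_cubic:
  assumes V: "V = {a, p, q, r, s, t}" "distinct [a, p, q, r, s, t]" and nba: "nb E a = {p, q, r}"
    and cubic: "\<And>x. x \<in> V \<Longrightarrow> card (nb E x) = 3" and miss: "\<not> E s p"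
  shows "E t p"
proof -
  have na: "\<not> E a s" "\<not> E a t" using nba V(2) by (auto simp: set_eq_iff)
  have Ea: "E a p" "E a q" "E a r" using nba by (auto simp: set_eq_iff)
  have "nb E s \<subseteq> {q, r, t}" using E_in(2) E_ne E_sym V(1) miss na by fastforce
  then have s: "E s q" "E s r" "E s t" using three_nbs[of s] cubic[of s] V(1) by auto
  have "E t p"
  proof (rule ccontr)
    assume tp: "\<not> E t p"
    have "nb E t \<subseteq> {q, r, s}" "nb E p \<subseteq> {a, q, r}" using E_in(2) E_ne E_sym V(1) tp miss na by fastforce+
    then have "E t q" "E p q" using three_nbs[of t] three_nbs[of p] cubic[of t] cubic[of p] V(1) by auto
    then show False using saturated[of q a p s t] Ea s E_sym V(2) by auto
  qed
  then show ?thesis .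
qed

lemma not_six: "card V \<noteq> 6"
proof
  assume c: "card V = 6"
  show False
  proof (cases "\<exists>a\<in>V. card (nb E a) = 2")
    case True
    then obtain a where a: "a \<in> V" "card (nb E a) = 2" by blast
    then obtain p q where nba: "nb E a = {p, q}" "p \<noteq> q" by (auto simp: card_2_iff)
    have E: "E a p" "E a q" using nba by (auto simp: set_eq_iff)
    have apq: "{a, p, q} \<subseteq> V" "card {a, p, q} = 3" using a E E_in E_ne nba(2) by auto
    then have "card (V - {a, p, q}) = card V - 3"
      by (metis card_Diff_subset finite.emptyI finite.insertI)
    then have "card (V - {a, p, q}) = 3" using c by simp
    then obtain r s t where rst: "V - {a, p, q} = {r, s, t}" "r \<noteq> s" "r \<noteq> t" "s \<noteq> t" by (auto simp: card_3_iff)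
    have V: "V = {a, p, q, r, s, t}" using rst(1) apq(1) by blast
    have out: "r \<notin> {a, p, q}" "s \<notin> {a, p, q}" "t \<notin> {a, p, q}" using rst(1) by blast+
    have dist: "distinct [a, p, q, r, s, t]"
      using out rst(2-4) nba(2) E_ne[OF E(1)] E_ne[OF E(2)] by auto
    have miss: "\<not> E x r \<or> \<not> E x s \<or> \<not> E x t" if "x \<in> {p, q}" for x
      using saturated[of x a r s t] that E E_sym dist by auto
    have perm: "V = {a, p, q, r, t, s}" "V = {a, p, q, s, r, t}" "V = {a, p, q, s, t, r}" "V = {a, p, q, t, r, s}" "V = {a, p, q, t, s, r}"
      using V by auto
    have dperm: "distinct [a, p, q, r, t, s]" "distinct [a, p, q, s, r, t]" "distinct [a, p, q, s, t, r]"
      "distinct [a, p, q, t, r, s]" "distinct [a, p, q, t, s, r]"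
      using dist by auto
    \<comment> \<open>Each of \<open>p\<close> and \<open>q\<close> misses one of \<open>r\<close>,
      \<open>s\<close>, \<open>t\<close>, either the same one or two different ones; the
      permutations bring every combination into the form of \<open>six_same\<close> or
      \<open>six_different\<close>.\<close>
    show False
      using miss[of p] miss[of q]
        six_same[OF V dist nba(1)] six_same[OF perm(1) dperm(1) nba(1)] six_same[OF perm(3) dperm(3) nba(1)]
        six_different[OF V dist nba(1)] six_different[OF perm(1) dperm(1) nba(1)]
        six_different[OF perm(2) dperm(2) nba(1)] six_different[OF perm(3) dperm(3) nba(1)]
        six_different[OF perm(4) dperm(4) nba(1)] six_different[OF perm(5) dperm(5) nba(1)]
      by blast
  next
    case False
    then have cubic: "card (nb E x) = 3" if "x \<in> V" for x using mindeg2[OF that] deg[OF that] that by fastforce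
    have "V \<noteq> {}" using c by auto
    then obtain a where a: "a \<in> V" by blast
    obtain p q r where nba: "nb E a = {p, q, r}" "p \<noteq> q" "p \<noteq> r" "q \<noteq> r"
      using cubic[OF a] by (auto simp: card_3_iff)
    have E: "E a p" "E a q" "E a r" using nba(1) by (auto simp: set_eq_iff)
    have apqr: "{a, p, q, r} \<subseteq> V" "card {a, p, q, r} = 4" using a E E_in E_ne nba(2-4) by auto
    then have "card (V - {a, p, q, r}) = card V - 4"
      by (metis card_Diff_subset finite.emptyI finite.insertI)
    then have "card (V - {a, p, q, r}) = 2" using c by simp
    then obtain s t where st: "V - {a, p, q, r} = {s, t}" "s \<noteq> t" by (auto simp: card_2_iff)
    have V: "V = {a, p, q, r, s, t}" using st(1) apqr(1) by blast
    have out: "s \<notin> {a, p, q, r}" "t \<notin> {a, p, q, r}" using st(1) by blast+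
    have dist: "distinct [a, p, q, r, s, t]"
      using out st(2) nba(2-4) E_ne[OF E(1)] E_ne[OF E(2)] E_ne[OF E(3)] by auto
    have na: "\<not> E a s" "\<not> E a t" using nba(1) dist by (auto simp: set_eq_iff)
    show False
    proof (cases "E s t")
      case False
      have "nb E s \<subseteq> {p, q, r}" "nb E t \<subseteq> {p, q, r}" using E_in(2) E_ne E_sym V False na by fastforce+
      then have s: "E s p" "E s q" "E s r" and t: "E t p" "E t q" "E t r"
        using three_nbs[of s] three_nbs[of t] cubic[of s] cubic[of t] V by auto
      have "\<not> E p q" "\<not> E p r" "\<not> E q r"
        using saturated[of p a s t q] saturated[of p a s t r] saturated[of q a s t r] E s t E_sym dist by auto
      then have "good V E"
        by (intro good_bipartite[OF G, of a s t p q r]) (use V dist na False in auto)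
      then show False using bad by blast
    next
      case True
      \<comment> \<open>By \<open>six_cubic\<close> the vertices \<open>s\<close> and
        \<open>t\<close> miss different neighbours of \<open>a\<close>, say \<open>p\<close> and
        \<open>q\<close>. The remaining neighbour \<open>r\<close> is then saturated by
        \<open>a\<close>, \<open>s\<close>, \<open>t\<close>, and the non-edges contain the hexagon
        \<open>a, s, p, r, q, t\<close>.\<close>
      have hex: False if V: "V = {a, p, q, r, s, t}" and dist: "distinct [a, p, q, r, s, t]"
        and nba: "nb E a = {p, q, r}" and m: "\<not> E s p" "\<not> E t q" for p q r
      proof -
        have E: "E a p" "E a q" "E a r" using nba by (auto simp: set_eq_iff)
        have "nb E s \<subseteq> {q, r, t}" "nb E t \<subseteq> {p, r, s}" using E_in(2) E_ne E_sym V m na by fastforce+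
        then have "E s r" "E t r" using three_nbs[of s] three_nbs[of t] cubic[of s] cubic[of t] V by auto
        then have "\<not> E r p" "\<not> E r q"
          using saturated[of r a s t p] saturated[of r a s t q] E E_sym dist by auto
        then have "good V E"
          by (intro good_hexagon[OF G, of a s p r q t]) (use V dist na m in \<open>auto dest: E_sym\<close>)
        then show False using bad by blast
      qed
      have miss: "\<not> E s p \<or> \<not> E s q \<or> \<not> E s r" "\<not> E t p \<or> \<not> E t q \<or> \<not> E t r"
        using saturated[of s t p q r] saturated[of t s p q r] True E_sym[OF True] dist by auto
      have perm: "V = {a, p, r, q, s, t}" "V = {a, q, p, r, s, t}" "V = {a, q, r, p, s, t}" "V = {a, r, p, q, s, t}" "V = {a, r, q, p, s, t}"
        using V by auto
      have dperm: "distinct [a, p, r, q, s, t]" "distinct [a, q, p, r, s, t]" "distinct [a, q, r, p, s, t]"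
        "distinct [a, r, p, q, s, t]" "distinct [a, r, q, p, s, t]"
        using dist by auto
      have nperm: "nb E a = {p, r, q}" "nb E a = {q, p, r}" "nb E a = {q, r, p}" "nb E a = {r, p, q}" "nb E a = {r, q, p}"
        using nba(1) by auto
      show False
        using miss
          six_cubic[OF V dist nba(1) cubic] six_cubic[OF perm(2) dperm(2) nperm(2) cubic]
          six_cubic[OF perm(4) dperm(4) nperm(4) cubic]
          hex[OF V dist nba(1)] hex[OF perm(1) dperm(1) nperm(1)] hex[OF perm(2) dperm(2) nperm(2)]
          hex[OF perm(3) dperm(3) nperm(3)] hex[OF perm(4) dperm(4) nperm(4)] hex[OF perm(5) dperm(5) nperm(5)]
        by blast
    qed
  qed
qed

lemma contradiction: False
  using small five_le not_five not_six by linarith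

end

theorem subcubic_good:
  fixes E :: "'a \<Rightarrow> 'a \<Rightarrow> bool"
  assumes "graph_on V E" "\<And>x. x \<in> V \<Longrightarrow> card (nb E x) \<le> 3" "K4_free E"
  shows "good V E"
  using assms
proof (induction "card V" arbitrary: V E rule: less_induct)
  case less
  show ?case
  proof (rule ccontr)
    assume bad: "\<not> good V E"
    have "minimal_bad V E"
    proof
      show "graph_on V E" by (rule less.prems(1))
      show "card (nb E x) \<le> 3" if "x \<in> V" for x by (rule less.prems(2)[OF that])
      show "K4_free E" by (rule less.prems(3))
      show "\<not> good V E" by (rule bad)
      show "good W F" if "graph_on W F" "\<And>x. x \<in> W \<Longrightarrow> card (nb F x) \<le> 3" "K4_free F" "card W < card V"
        for W :: "'a set" and F
        using that by (intro less.hyps) blast+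
    qed
    then show False by (rule minimal_bad.contradiction)
  qed
qed

section \<open>Slope realizations of subcubic graphs\<close>

lemma stress_total:
  assumes "finite V" and st: "stress V E c \<sigma> w f g"
  shows "(\<Sum>x\<in>V. f x) = 0"
proof -
  have "(\<Sum>x\<in>V. f x) = (\<Sum>x\<in>V. \<Sum>y\<in>V. w x y)"
    using stressD(3)[OF st] by simp
  also have "\<dots> = (\<Sum>y\<in>V. \<Sum>x\<in>V. w x y)" by (rule sum.swap)
  also have "\<dots> = - (\<Sum>y\<in>V. \<Sum>x\<in>V. w y x)"
    by (subst stressD(1)[OF st]) (simp add: sum_negf)
  also have "(\<Sum>y\<in>V. \<Sum>x\<in>V. w y x) = (\<Sum>x\<in>V. f x)"
    using stressD(3)[OF st] by simp
  finally show ?thesis by simp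
qed

lemma stress_restrict_closed:
  assumes G: "graph_on V E" and st: "stress V E c \<sigma> w f g" and X: "X \<subseteq> V"
    and closed: "\<And>x y. x \<in> X \<Longrightarrow> E x y \<Longrightarrow> y \<in> X"
  shows "stress X (induced E X) c \<sigma> (\<lambda>x y. if x \<in> X \<and> y \<in> X then w x y else 0) f g"
proof (rule stress_loads[OF stress_restrict[OF G st X]])
  fix x assume x: "x \<in> X"
  have "w x y = 0" if "y \<in> V - X" for y
    using closed[OF x, of y] that stressD(2)[OF st, of x y] by blast
  then show "f x - (\<Sum>y\<in>V - X. w x y) = f x" "g x - (\<Sum>y\<in>V - X. \<sigma> (c x y) * w x y) = g x" by simp_all
qed

text \<open>The forces inside a union of components add up to zero, and so must the load on it. With
  exactly one end of the dipole in \<open>X\<close> this load is \<open>\<phi>\<close> up to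
  sign.\<close>

lemma no_load_across:
  assumes G: "graph_on V E"
    and st: "stress V E c \<sigma> w (\<lambda>x. \<phi> * dipole u v x) g" and X: "X \<subseteq> V"
    and closed: "\<And>x y. x \<in> X \<Longrightarrow> E x y \<Longrightarrow> y \<in> X" and uv: "u \<in> X \<longleftrightarrow> v \<notin> X"
  shows "\<phi> = 0"
proof -
  have finX: "finite X" using graph_onD(1)[OF G] X finite_subset by blast
  have "0 = (\<Sum>x\<in>X. \<phi> * dipole u v x)"
    using stress_total[OF finX stress_restrict_closed[OF G st X closed]] by simp
  also have "\<dots> = \<phi> * ((\<Sum>x\<in>X. of_bool (x = u)) - (\<Sum>x\<in>X. of_bool (x = v)))"
    by (simp only: dipole_def sum_distrib_left sum_subtractf right_diff_distrib)
  finally have *: "\<phi> * ((\<Sum>x\<in>X. of_bool (x = u)) - (\<Sum>x\<in>X. of_bool (x = v))) = 0" by simp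
  have "(\<Sum>x\<in>X. of_bool (x = p)) = (of_bool (p \<in> X) :: real)" for p
    using finX by (auto simp: of_bool_def)
  with * have "\<phi> * (of_bool (u \<in> X) - of_bool (v \<in> X)) = 0" by (simp only:)
  then show ?thesis using uv by (cases "u \<in> X") auto
qed

text \<open>All edges in K4 components get color 0, so each such component is drawn on a line of
  slope \<open>\<sigma> 0\<close>. A K4 on a line carries nonzero stresses, and the claim is about
  \<open>separating\<close> only. Every pair inside the component is an edge, so lying on a common
  line of that slope is correct.\<close>

lemma subcubic_separating:
  fixes E :: "'a \<Rightarrow> 'a \<Rightarrow> bool"
  assumes G: "graph_on V E" and deg: "\<And>x. x \<in> V \<Longrightarrow> card (nb E x) \<le> 3"
  shows "\<exists>c \<sigma>. coloring E c \<and> separating V E c \<sigma>"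
proof -
  note GD = graph_onD[OF G]
  define K where "K a b d e \<longleftrightarrow> E a b \<and> E a d \<and> E a e \<and> E b d \<and> E b e \<and> E d e" for a b d e
  define U where "U = {x \<in> V. \<exists>b d e. K x b d e}"
  define W where "W = V - U"
  have nbK: "nb E x = {b, d, e}" if "K x b d e" for x b d e
  proof -
    have "x \<in> V" "b \<noteq> d" "b \<noteq> e" "d \<noteq> e" using that GD unfolding K_def by blast+
    moreover have "{b, d, e} \<subseteq> nb E x" using that by (simp add: K_def)
    ultimately have "{b, d, e} = nb E x"
      using deg[of x] by (intro card_seteq finite_nb[OF G]) auto
    then show ?thesis by simp
  qed
  have rot: "K b x d e" "K d x b e" "K e x b d" if "K x b d e" for x b d e
    using that GD(5) unfolding K_def by blast+
  have closedU: "y \<in> U" if "x \<in> U" "E x y" for x y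
  proof -
    obtain b d e where K: "K x b d e" using \<open>x \<in> U\<close> by (auto simp: U_def)
    have "y \<in> {b, d, e}" using nbK[OF K] that(2) nb_iff[of y E x] by simp
    then show ?thesis using rot[OF K] GD(3)[OF that(2)] unfolding U_def by blast
  qed
  have closedW: "y \<in> W" if "x \<in> W" "E x y" for x y
    using that closedU[OF _ GD(5)[OF that(2)]] GD(3)[OF that(2)] by (auto simp: W_def)
  have "good W (induced E W)"
  proof (rule subcubic_good)
    show "graph_on W (induced E W)" by (rule graph_on_induced[OF G]) (auto simp: W_def)
    show "card (nb (induced E W) x) \<le> 3" if "x \<in> W" for x
    proof -
      have "card (nb (induced E W) x) \<le> card (nb E x)"
        by (rule card_mono[OF finite_nb[OF G]]) (auto simp: induced_def)
      then show ?thesis using deg[of x] that by (auto simp: W_def)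
    qed
    show "K4_free (induced E W)"
      unfolding K4_free_def
    proof clarify
      fix a b d e
      assume "induced E W a b" "induced E W a d" "induced E W a e" "induced E W b d" "induced E W b e" "induced E W d e"
      then have "a \<in> W" "K a b d e" by (auto simp: induced_def K_def)
      then show False unfolding W_def U_def by blast
    qed
  qed
  then obtain c1 where c1: "coloring (induced E W) c1" "generic (nice W (induced E W) c1)"
    unfolding good_def by blast
  obtain \<sigma> where \<sigma>: "nice W (induced E W) c1 \<sigma>" "inj_on \<sigma> {..<7}"
    using generic_ex[OF generic_conj[OF c1(2) generic_inj_on[of "{..<7}"]]] by auto
  define c where "c x y = (if x \<in> U then 0 else c1 x y)" for x y
  have col: "coloring E c"
    unfolding coloring_def
  proof (intro allI impI)
    fix x y assume xy: "E x y"
    show "c x y = c y x \<and> c x y < 7"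
    proof (cases "x \<in> U")
      case True
      then show ?thesis using closedU[OF True xy] by (simp add: c_def)
    next
      case False
      then have "x \<in> W" "y \<in> W" using GD(2)[OF xy] closedW[OF _ xy] by (auto simp: W_def)
      then have "induced E W x y" "x \<notin> U" "y \<notin> U" using xy by (auto simp: induced_def W_def)
      then show ?thesis using c1(1) unfolding coloring_def c_def by auto
    qed
  qed
  have "separating V E c \<sigma>"
    unfolding separating_def
  proof (intro ballI allI impI)
    fix u v s w \<phi>
    assume uv: "u \<in> V" "v \<in> V" "s < (7 :: nat)" "u \<noteq> v" "\<not> (E u v \<and> c u v = s)"
      and st: "stress V E c \<sigma> w (\<lambda>x. \<phi> * dipole u v x) (\<lambda>x. \<sigma> s * \<phi> * dipole u v x)"
    have WV: "W \<subseteq> V" by (auto simp: W_def)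
    consider "u \<in> W" "v \<in> W" | "u \<in> W \<longleftrightarrow> v \<notin> W" | "u \<in> U" "v \<in> U"
      using uv(1,2) by (auto simp: W_def)
    then show "\<phi> = 0"
    proof cases
      case 1
      have eq: "stress W (induced E W) c \<sigma> = stress W (induced E W) c1 \<sigma>"
        by (simp add: stress_def fun_eq_iff c_def W_def cong: sum.cong)
      have sep: "separating W (induced E W) c1 \<sigma>" using \<sigma>(1) by (simp add: nice_def)
      show ?thesis
      proof (rule separatingD[OF sep 1 uv(4,3)])
        show "\<not> (induced E W u v \<and> c1 u v = s)" using uv(5) 1 by (auto simp: induced_def c_def W_def)
        show "stress W (induced E W) c1 \<sigma> (\<lambda>x y. if x \<in> W \<and> y \<in> W then w x y else 0)
            (\<lambda>x. \<phi> * dipole u v x) (\<lambda>x. \<sigma> s * \<phi> * dipole u v x)"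
          unfolding eq[symmetric] by (rule stress_restrict_closed[OF G st WV closedW])
      qed
    next
      case 2
      show ?thesis by (rule no_load_across[OF G st WV closedW 2])
    next
      case 3
      \<comment> \<open>All edges at \<open>u\<close> have slope \<open>\<sigma> 0\<close>, so they
        can only balance a load in that direction. This settles \<open>s \<noteq> 0\<close>.\<close>
      have "(\<Sum>y\<in>V. w u y) = \<phi>" "(\<Sum>y\<in>V. \<sigma> 0 * w u y) = \<sigma> s * \<phi>"
        using stressD(3,4)[OF st uv(1)] 3(1) uv(4) by (simp_all add: dipole_def c_def)
      then have *: "\<sigma> 0 * \<phi> = \<sigma> s * \<phi>" by (simp flip: sum_distrib_left)
      show ?thesis
      proof (cases "s = 0")
        case False
        then have "\<sigma> 0 \<noteq> \<sigma> s" using \<sigma>(2) uv(3) by (auto dest: inj_onD)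
        then show ?thesis using * by simp
      next
        case True
        \<comment> \<open>For color 0 the two vertices are not adjacent, hence in different K4
          components, and no load passes between components.\<close>
        then have nE: "\<not> E u v" using uv(5) 3(1) by (simp add: c_def)
        obtain b d e where K: "K u b d e" using 3(1) by (auto simp: U_def)
        let ?X = "{u, b, d, e}"
        have XV: "?X \<subseteq> V" using uv(1) K GD(3) unfolding K_def by blast
        have cl: "y \<in> ?X" if "x \<in> ?X" "E x y" for x y
        proof -
          have "nb E x \<subseteq> ?X"
            using that(1) nbK[OF K] nbK[OF rot(1)[OF K]] nbK[OF rot(2)[OF K]] nbK[OF rot(3)[OF K]] by auto
          then show ?thesis using that(2) by auto
        qed
        have "v \<notin> ?X" using nE uv(4) K by (auto simp: K_def)
        then show ?thesis using no_load_across[OF G st XV cl] by simp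
      qed
    qed
  qed
  then show ?thesis using col by blast
qed

theorem subcubic_slopes:
  fixes E :: "'a \<Rightarrow> 'a \<Rightarrow> bool"
  assumes G: "graph_on V E" and deg: "\<And>x. x \<in> V \<Longrightarrow> card (nb E x) \<le> 3"
  shows "\<exists>(\<sigma> :: nat \<Rightarrow> real) X Y. inj_on (\<lambda>v. (X v, Y v)) V \<and>
    (\<forall>u\<in>V. \<forall>v\<in>V. u \<noteq> v \<longrightarrow> E u v = (X u \<noteq> X v \<and> (\<exists>s<7. (Y v - Y u) / (X v - X u) = \<sigma> s)))"
proof -
  obtain c \<sigma> where c: "coloring E c" "separating V E c \<sigma>"
    using subcubic_separating[OF G deg] by blast
  obtain z where z: "\<And>x y. E x y \<Longrightarrow> line_form (\<sigma> (c x y)) x y z = 0"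
    "\<And>u v s. u \<in> V \<Longrightarrow> v \<in> V \<Longrightarrow> s < 7 \<Longrightarrow> u \<noteq> v \<Longrightarrow> \<not> (E u v \<and> c u v = s) \<Longrightarrow> line_form (\<sigma> s) u v z \<noteq> 0"
    using separating_points[OF G c] by blast
  define X Y where "X v = z (v, False)" and "Y v = z (v, True)" for v
  have form: "line_form m u v z = (Y u - Y v) - m * (X u - X v)" for m u v
    by (simp add: line_form_def X_def Y_def)
  have ne: "X u \<noteq> X v \<or> Y u \<noteq> Y v" if uv: "u \<in> V" "v \<in> V" "u \<noteq> v" for u v
  proof -
    \<comment> \<open>Any color other than \<open>c u v\<close> shows that the two points differ, as
      coinciding points would make all line forms zero.\<close>
    define s :: nat where "s = (if c u v = 0 then 1 else 0)"
    have "line_form (\<sigma> s) u v z \<noteq> 0" by (rule z(2)) (use uv in \<open>auto simp: s_def\<close>)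
    then show ?thesis by (auto simp: form)
  qed
  have "E u v = (X u \<noteq> X v \<and> (\<exists>s<7. (Y v - Y u) / (X v - X u) = \<sigma> s))"
    if uv: "u \<in> V" "v \<in> V" "u \<noteq> v" for u v
  proof
    assume E: "E u v"
    then have l: "Y u - Y v = \<sigma> (c u v) * (X u - X v)" using z(1) by (simp add: form)
    then have "X u \<noteq> X v" using ne[OF uv] by auto
    moreover have "(Y v - Y u) / (X v - X u) = \<sigma> (c u v)"
      using l \<open>X u \<noteq> X v\<close> by (simp add: field_simps)
    moreover have "c u v < 7" using c(1) E unfolding coloring_def by blast
    ultimately show "X u \<noteq> X v \<and> (\<exists>s<7. (Y v - Y u) / (X v - X u) = \<sigma> s)" by blast
  next
    assume "X u \<noteq> X v \<and> (\<exists>s<7. (Y v - Y u) / (X v - X u) = \<sigma> s)"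
    then obtain s where s: "X u \<noteq> X v" "s < 7" "(Y v - Y u) / (X v - X u) = \<sigma> s" by blast
    then have "line_form (\<sigma> s) u v z = 0" by (simp add: form field_simps)
    then show "E u v" using z(2)[OF uv(1,2) s(2) uv(3)] by blast
  qed
  moreover have "inj_on (\<lambda>v. (X v, Y v)) V"
    using ne by (auto simp: inj_on_def)
  ultimately show ?thesis by blast
qed

section \<open>From coordinates to an isomorphism of digraphs\<close>

lemma slope_graph_iso:
  assumes G: "pair_graph G" and inj: "inj_on p (pverts G)"
    and adj: "\<And>u v. u \<in> pverts G \<Longrightarrow> v \<in> pverts G \<Longrightarrow> u \<noteq> v \<Longrightarrow>
      (u, v) \<in> parcs G \<longleftrightarrow> line_slope (p u) (p v) \<in> S"
  shows "digraph_iso (with_proj G) (with_proj (slope_graph (p ` pverts G) S))"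
proof -
  interpret pair_graph G by (rule G)
  have arc: "u \<in> pverts G \<and> v \<in> pverts G \<and> u \<noteq> v" if "(u, v) \<in> parcs G" for u v
    using that arc_fst_in_verts[OF that] arc_snd_in_verts[OF that] pair_no_loops[OF that] by auto
  define hom :: "('a, 'a \<times> 'a, real \<times> real, (real \<times> real) \<times> (real \<times> real)) digraph_isomorphism" where
    "hom = \<lparr> iso_verts = p, iso_arcs = map_prod p p, iso_head = snd, iso_tail = fst \<rparr>"
  have "inj_on (map_prod p p) (parcs G)"
    using inj arc by (auto simp: inj_on_def)
  then have "pre_digraph.digraph_isomorphism (with_proj G) hom"
    using inj wf_digraph_axioms by (simp add: pre_digraph.digraph_isomorphism_def hom_def)
  moreover have "with_proj (slope_graph (p ` pverts G) S) = app_iso hom (with_proj G)"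
  proof -
    have "parcs (slope_graph (p ` pverts G) S) = map_prod p p ` parcs G"
    proof (intro set_eqI iffI)
      fix e assume e: "e \<in> parcs (slope_graph (p ` pverts G) S)"
      then obtain u v where uv: "u \<in> pverts G" "v \<in> pverts G" "e = (p u, p v)" "p u \<noteq> p v" "line_slope (p u) (p v) \<in> S"
      proof -
        have "e \<in> {(a, b). a \<in> p ` pverts G \<and> b \<in> p ` pverts G \<and> a \<noteq> b \<and> line_slope a b \<in> S}"
          using e unfolding slope_graph_def pair_pre_digraph.simps .
        then have "fst e \<in> p ` pverts G" "snd e \<in> p ` pverts G" "fst e \<noteq> snd e" "line_slope (fst e) (snd e) \<in> S"
          unfolding mem_Collect_eq case_prod_beta by blast+
        then show ?thesis using that by (metis imageE prod.collapse)
      qed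
      then have "(u, v) \<in> parcs G" using adj by auto
      then show "e \<in> map_prod p p ` parcs G" using uv(3) by force
    next
      fix e assume "e \<in> map_prod p p ` parcs G"
      then obtain u v where uv: "(u, v) \<in> parcs G" "e = (p u, p v)" by auto
      have "p u \<noteq> p v" using inj arc[OF uv(1)] by (auto dest: inj_onD)
      then show "e \<in> parcs (slope_graph (p ` pverts G) S)"
        using uv arc[OF uv(1)] adj by (simp add: slope_graph_def)
    qed
    then show ?thesis
      by (simp add: with_proj_def app_iso_def hom_def slope_graph_def)
  qed
  ultimately show ?thesis unfolding digraph_iso_def by blast
qed

theorem theorem7p1:
  fixes G :: "'a pair_pre_digraph"
  assumes "pair_graph G"
    and "\<forall>v \<in> pverts G. out_degree (with_proj G) v \<le> 3"
  shows "slope_parameter G \<le> 7"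
proof -
  interpret pair_graph G by (rule assms(1))
  let ?E = "\<lambda>u v. (u, v) \<in> parcs G"
  have graph: "graph_on (pverts G) ?E"
    unfolding graph_on_def
    using pair_finite_verts arc_fst_in_verts arc_snd_in_verts pair_no_loops arcs_symmetric by fastforce
  have deg: "card (nb ?E v) \<le> 3" if "v \<in> pverts G" for v
  proof -
    have "out_arcs (with_proj G) v = Pair v ` nb ?E v"
      by (auto simp: out_arcs_def nb_def)
    then have "out_degree (with_proj G) v = card (nb ?E v)"
      by (simp add: out_degree_def card_image inj_on_def)
    then show ?thesis using assms(2) that by metis
  qed
  obtain \<sigma> :: "nat \<Rightarrow> real" and X Y where
    inj: "inj_on (\<lambda>v. (X v, Y v)) (pverts G)"
    and adj: "\<And>u v. u \<in> pverts G \<Longrightarrow> v \<in> pverts G \<Longrightarrow> u \<noteq> v \<Longrightarrow>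
      ?E u v \<longleftrightarrow> X u \<noteq> X v \<and> (\<exists>s<7. (Y v - Y u) / (X v - X u) = \<sigma> s)"
    using subcubic_slopes[OF graph deg] by blast
  define S where "S = Finite_slope ` \<sigma> ` {..<7}"
  have "digraph_iso (with_proj G) (with_proj (slope_graph ((\<lambda>v. (X v, Y v)) ` pverts G) S))"
    by (rule slope_graph_iso[OF assms(1) inj]) (auto simp: adj line_slope_def S_def image_iff)
  then have "slope_parameter G \<le> enat (card S)"
    unfolding slope_parameter_def using pair_finite_verts
    by (intro Inf_lower CollectI exI[of _ S] exI[of _ "(\<lambda>v. (X v, Y v)) ` pverts G"]) (simp add: S_def)
  also have "card S \<le> 7"
    unfolding S_def using card_image_le[of "\<sigma> ` {..<7}" Finite_slope] card_image_le[of "{..<7}" \<sigma>] by simp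
  then have "enat (card S) \<le> 7" by (simp add: numeral_eq_enat)
  finally show ?thesis .
qed

end
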